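(* Let $\{\mathbf{G}_k\}_{k\ge1}$ be the observed chain of the stationary Sampled Moran Genealogy Process with population size $n$, event rate $\mu$, sampling times $t_1<t_2<\cdots$ and attachment times $\{a_k\}_{k\ge2}$, and let $k\ge2$. Then the joint distribution of $(\mathbf{G}_1,\dots,\mathbf{G}_k)$, as a function of $\mathbf a=(a_2,\dots,a_k)$, is \[ f_{\mathbf{G}_1,\dots,\mathbf{G}_k}(\mathbf a)\,d\mathbf a=n^{r-k}\left(\frac{\mu}{\binom n2}\right)^{r-1}\exp\left(-\int_{-\infty}^\infty\mu\frac{\binom{\ell_k(t)}{2}}{\binom n2}dt\right)\prod_{\{i\le k:\ \nexists j>i,\ a_j=t_i\}}\left(1-\frac{\ell_k(t_i)}{n}\right)\prod_{\{j:\ \nexists i<j,\ a_j=t_i\}}da_j\prod_{\{j:\ \exists i<j,\ a_j=t_i\}}dn_j, \] where $r=|\mathrm{live}(\mathbf{G}_k)|$, $da_j$ is Lebesgue measure and $dn_j$ counting measure on $\mathbb R$ (the indices $j$ ranging over $2,\dots,k$), and the density is with respect to counting measure over the discrete choices of the lineages to which successive samples attach. Moreover $f_{\mathbf{G}_1,\dots,\mathbf{G}_k}=f_{\mathbf{G}_k}$.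
   Context: Fix an integer $n\ge2$, $\mu>0$ and deterministic sampling times $t_1<t_2<\cdots$. A population of constant size $n$ evolves under Moran dynamics: events occur at rate $\mu$; at each, an ordered pair of distinct individuals is chosen uniformly at random, the first dies and the second gives birth. Stationary: the population has evolved under these dynamics from the infinite past. At each time $t_i$ one living individual chosen uniformly at random is sampled (without altering the population). The observed genealogy $\mathbf{G}_k$ is the genealogy (tree with times) formed by the ancestral lineages of samples $1,\dots,k$ (sample $i$'s lineage traced back from $t_i$); $\mathbf{G}_{k-1}$ is a deterministic function of $\mathbf{G}_k$. For $j\ge2$ the attachment time $a_j\le t_{j-1}$ is the most recent time $s$ at which the ancestor at time $s$ of sample $j$ coincides with the ancestor-or-self at time $s$ of some sample $i<j$ with $t_i\ge s$; a.s. $a_j$ is either a sample time (direct descent) or not a sample time (a branch point). Sample $i\le k$ is dead in $\mathbf{G}_k$ if $a_j=t_i$ for some $i<j\le k$, live otherwise; $\mathrm{live}(\mathbf{G}_k)$ is the set of sample times of live samples. Branch points of $\mathbf{G}_k$: the $a_j$, $2\le j\le k$, that are not sample times. $\ell_k(t)=|\{e\in\mathrm{live}(\mathbf{G}_k):e>t\}|-|\{\text{branch points }b\text{ of }\mathbf{G}_k:b>t\}|$. *)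

theory Defs
  imports "HOL-Probability.Probability"
begin

text \<open>Sample points: \<omega> = (ev, U); the events of the Moran process are indexed by
  integers, ev m = (E m, (d m, b m)): E m are i.i.d. Exp(mu) gaps and
  (d m, b m) i.i.d. uniform ordered pairs of distinct slots in {0..<n}
  (d dies, b gives birth).  U i is the slot of the individual
  sampled at time t i (uniform in {0..<n}), all independent.\<close>

type_synonym smg_omega = "(int \<Rightarrow> real \<times> (nat \<times> nat)) \<times> (nat \<Rightarrow> nat)"

definition pair_unif :: "nat \<Rightarrow> (nat \<times> nat) measure" where
  "pair_unif n = measure_pmf (pmf_of_set {(d, b). d < n \<and> b < n \<and> d \<noteq> b})"

definition smg_space :: "nat \<Rightarrow> real \<Rightarrow> smg_omega measure" where
  "smg_space n \<mu> =
     (\<Pi>\<^sub>M m\<in>(UNIV::int set). density lborel (exponential_density \<mu>) \<Otimes>\<^sub>M pair_unif n)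
     \<Otimes>\<^sub>M (\<Pi>\<^sub>M i\<in>(UNIV::nat set). measure_pmf (pmf_of_set {..<n}))"

text \<open>Event times: a Poisson process of rate mu on the whole real line
  (..., tau(-1) < tau 0 \<le> 0 < tau 1 < tau 2 < ...).\<close>

definition ev_time :: "smg_omega \<Rightarrow> int \<Rightarrow> real" where
  "ev_time \<omega> m =
     (if m \<ge> 1 then (\<Sum>i\<in>{1..m}. fst (fst \<omega> i)) else - (\<Sum>i\<in>{m..0}. fst (fst \<omega> i)))"

definition ev_death :: "smg_omega \<Rightarrow> int \<Rightarrow> nat" where
  "ev_death \<omega> m = fst (snd (fst \<omega> m))"

definition ev_birth :: "smg_omega \<Rightarrow> int \<Rightarrow> nat" where
  "ev_birth \<omega> m = snd (snd (fst \<omega> m))"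

text \<open>Slot occupied at time s by the ancestor of the individual occupying slot
  x at time t \<ge> s; the state at time s is the state after all events at
  times \<le> s.  Events in (s,t] are processed from the most recent backwards.\<close>

definition anc :: "smg_omega \<Rightarrow> nat \<Rightarrow> real \<Rightarrow> real \<Rightarrow> nat" where
  "anc \<omega> x t s =
     foldr (\<lambda>m y. if y = ev_death \<omega> m then ev_birth \<omega> m else y)
       (sorted_list_of_set {m. s < ev_time \<omega> m \<and> ev_time \<omega> m \<le> t}) x"

definition samp_anc :: "(nat \<Rightarrow> real) \<Rightarrow> smg_omega \<Rightarrow> nat \<Rightarrow> real \<Rightarrow> nat" where
  "samp_anc t \<omega> i s = anc \<omega> (snd \<omega> i) (t i) s"

definition attach_time :: "(nat \<Rightarrow> real) \<Rightarrow> smg_omega \<Rightarrow> nat \<Rightarrow> real" where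
  "attach_time t \<omega> j =
     Sup {s. s \<le> t (j - 1) \<and> (\<exists>i. 1 \<le> i \<and> i < j \<and> s \<le> t i \<and> samp_anc t \<omega> j s = samp_anc t \<omega> i s)}"

definition merge_time :: "(nat \<Rightarrow> real) \<Rightarrow> smg_omega \<Rightarrow> nat \<Rightarrow> nat \<Rightarrow> real" where
  "merge_time t \<omega> i j = Sup {s. s \<le> t i \<and> samp_anc t \<omega> j s = samp_anc t \<omega> i s}"

text \<open>The observed genealogy G_k (tree with times on samples 1..k) is encoded by its matrix of
  pairwise coalescence times (entries for pairs 1 \<le> i < j \<le> k, all other entries 0).\<close>

type_synonym gmat = "nat \<times> nat \<Rightarrow> real"

definition gen_space :: "gmat measure" where
  "gen_space = (\<Pi>\<^sub>M p\<in>(UNIV::(nat \<times> nat) set). (borel :: real measure))"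

definition trunc :: "nat \<Rightarrow> gmat \<Rightarrow> gmat" where
  "trunc k g = (\<lambda>(i, j). if 1 \<le> i \<and> i < j \<and> j \<le> k then g (i, j) else 0)"

definition genealogy :: "(nat \<Rightarrow> real) \<Rightarrow> nat \<Rightarrow> smg_omega \<Rightarrow> gmat" where
  "genealogy t k \<omega> = trunc k (\<lambda>(i, j). merge_time t \<omega> i j)"

definition gsym :: "gmat \<Rightarrow> nat \<Rightarrow> nat \<Rightarrow> real" where
  "gsym g i j = g (min i j, max i j)"

definition g_attach :: "gmat \<Rightarrow> nat \<Rightarrow> real" where
  "g_attach g j = Max {g (i, j) | i. 1 \<le> i \<and> i < j}"

definition attach_vec :: "nat \<Rightarrow> gmat \<Rightarrow> (nat \<Rightarrow> real)" where
  "attach_vec k g = (\<lambda>j\<in>{2..k}. g_attach g j)"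

text \<open>Genealogies that can occur (outside a null set): an ultrametric coalescence matrix,
  coalescences of i and j not later than the earlier sample time, an attachment time equal to a
  sample time t l only by direct descent from sample l (l < j), and each sample is
  the direct ancestor of at most one attaching lineage.\<close>

definition valid_gen :: "(nat \<Rightarrow> real) \<Rightarrow> nat \<Rightarrow> gmat \<Rightarrow> bool" where
  "valid_gen t k g \<longleftrightarrow>
     trunc k g = g \<and>
     (\<forall>i j. 1 \<le> i \<and> i < j \<and> j \<le> k \<longrightarrow> g (i, j) \<le> t i) \<and>
     (\<forall>i\<in>{1..k}. \<forall>j\<in>{1..k}. \<forall>l\<in>{1..k}. i \<noteq> j \<and> i \<noteq> l \<and> j \<noteq> l \<longrightarrow>
        min (gsym g i j) (gsym g i l) \<le> gsym g j l) \<and>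
     (\<forall>j\<in>{2..k}. \<forall>l\<ge>1. g_attach g j = t l \<longrightarrow> l < j \<and> g (l, j) = t l) \<and>
     (\<forall>i j j'. 1 \<le> i \<and> i < j \<and> j < j' \<and> j' \<le> k \<and> g (i, j) = t i \<and> g (i, j') = t i
        \<longrightarrow> g (j, j') > t i)"

definition is_sample_time :: "(nat \<Rightarrow> real) \<Rightarrow> real \<Rightarrow> bool" where
  "is_sample_time t x \<longleftrightarrow> (\<exists>i\<ge>1. t i = x)"

definition dead :: "(nat \<Rightarrow> real) \<Rightarrow> nat \<Rightarrow> (nat \<Rightarrow> real) \<Rightarrow> nat \<Rightarrow> bool" where
  "dead t k a i \<longleftrightarrow> (\<exists>j. i < j \<and> j \<le> k \<and> a j = t i)"

definition live_idx :: "(nat \<Rightarrow> real) \<Rightarrow> nat \<Rightarrow> (nat \<Rightarrow> real) \<Rightarrow> nat set" where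
  "live_idx t k a = {i\<in>{1..k}. \<not> dead t k a i}"

definition branch_idx :: "(nat \<Rightarrow> real) \<Rightarrow> nat \<Rightarrow> (nat \<Rightarrow> real) \<Rightarrow> nat set" where
  "branch_idx t k a = {j\<in>{2..k}. \<not> is_sample_time t (a j)}"

definition lineages :: "(nat \<Rightarrow> real) \<Rightarrow> nat \<Rightarrow> (nat \<Rightarrow> real) \<Rightarrow> real \<Rightarrow> int" where
  "lineages t k a x = int (card {i\<in>live_idx t k a. t i > x}) - int (card {j\<in>branch_idx t k a. a j > x})"

definition smg_density :: "nat \<Rightarrow> real \<Rightarrow> (nat \<Rightarrow> real) \<Rightarrow> nat \<Rightarrow> (nat \<Rightarrow> real) \<Rightarrow> real" where
  "smg_density n \<mu> t k a =
     (let r = card (live_idx t k a); L = lineages t k a; C = real (n choose 2) in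
       real n powi (int r - int k) * (\<mu> / C) ^ (r - 1)
       * exp (- (\<integral>x. \<mu> * ((real_of_int (L x) * (real_of_int (L x) - 1) / 2) / C) \<partial>lborel))
       * (\<Prod>i\<in>live_idx t k a. 1 - real_of_int (L (t i)) / real n))"

text \<open>Reference measure for a single attachment time: Lebesgue measure plus counting measure
  on the sample times (i.e. da_j off the sample times, dn_j on them).\<close>

definition ref_meas :: "(nat \<Rightarrow> real) \<Rightarrow> real measure" where
  "ref_meas t = measure_of UNIV (sets borel)
     (\<lambda>A. emeasure lborel A + emeasure (count_space UNIV) {i::nat. 1 \<le> i \<and> t i \<in> A})"

definition attach_ref :: "(nat \<Rightarrow> real) \<Rightarrow> nat \<Rightarrow> (nat \<Rightarrow> real) measure" where
  "attach_ref t k = (\<Pi>\<^sub>M j\<in>{2..k}. ref_meas t)"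

end

theory Submission imports Defs begin

text \<open>Followed backwards in time, the ancestral lines are driven by the marks of a Poisson process, so by the
  memoryless property the words of marks over disjoint time intervals are independent. A word moves \<open>l\<close>
  distinct lines without any merger in time \<open>d\<close> with probability \<open>exp (- \<mu> d C(l,2) / C(n,2))\<close>, whatever the
  slots they occupy; likewise the probability that exactly one given pair merges depends on \<open>l\<close> and \<open>d\<close> only.
  A sample point meets one given line out of \<open>l\<close> with probability \<open>1 / n\<close> and misses all of them with
  probability \<open>1 - l / n\<close>. For a fixed tree shape this yields the probability that every attachment time lies
  in a prescribed interval or equals a prescribed sample time, provided these cells are disjoint; the
  integral of the density over the same product of cells factorises and gives the same value. Products of
  such cells determine the measure up to a null set, and summing over the shapes yields the law of the
  genealogy. The chain \<open>G 1, \<dots>, G k\<close> is a function of \<open>G k\<close>.\<close>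

section \<open>The marked Poisson process\<close>

locale moran =
  fixes n :: nat and \<mu> :: real
  assumes n2: "2 \<le> n" and mu: "0 < \<mu>"
begin

abbreviation slot_pairs :: "(nat \<times> nat) set" where
  "slot_pairs \<equiv> {(d, b). d < n \<and> b < n \<and> d \<noteq> b}"

abbreviation pair_pmf_n :: "(nat \<times> nat) pmf" where
  "pair_pmf_n \<equiv> pmf_of_set slot_pairs"

lemma finite_slot_pairs: "finite slot_pairs"
  by (rule finite_subset[of _ "{..<n} \<times> {..<n}"]) auto

lemma slot_pairs_nonempty: "slot_pairs \<noteq> {}"
proof -
  have "(0, 1) \<in> slot_pairs" using n2 by auto
  then show ?thesis by blast
qed

lemma card_slot_pairs: "card slot_pairs = n * (n - 1)"
proof -
  have "slot_pairs = (SIGMA d:{..<n}. {..<n} - {d})" by auto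
  then show ?thesis by (simp add: card_SigmaI)
qed

definition gap_meas :: "(real \<times> nat \<times> nat) measure" where
  "gap_meas = density lborel (exponential_density \<mu>) \<Otimes>\<^sub>M pair_unif n"

lemma prob_space_gap_meas: "prob_space gap_meas"
  unfolding gap_meas_def pair_unif_def
  by (intro prob_space_pair prob_space_exponential_density mu measure_pmf.prob_space_axioms)

sublocale gap: prob_space gap_meas
  by (rule prob_space_gap_meas)

sublocale seq: sequence_space gap_meas
  by unfold_locales

lemma sets_gap_meas[measurable_cong, simp]: "sets gap_meas = sets (borel \<Otimes>\<^sub>M count_space UNIV)"
  unfolding gap_meas_def pair_unif_def by (intro sets_pair_measure_cong) auto

lemma space_gap_meas[simp]: "space gap_meas = UNIV"
  unfolding gap_meas_def pair_unif_def by (simp add: space_pair_measure)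

lemma space_seq[simp]: "space seq.S = UNIV"
  by (simp add: space_PiM)

lemma nn_integral_gap:
  assumes [measurable]: "f \<in> borel_measurable (borel \<Otimes>\<^sub>M count_space UNIV)"
  shows "(\<integral>\<^sup>+x. f x \<partial>gap_meas)
    = (\<integral>\<^sup>+m. \<integral>\<^sup>+e. ennreal (exponential_density \<mu> e) * f (e, m) \<partial>lborel \<partial>pair_pmf_n)"
proof -
  interpret E: prob_space "density lborel (exponential_density \<mu>)"
    by (rule prob_space_exponential_density[OF mu])
  interpret pair_sigma_finite "density lborel (exponential_density \<mu>)" "measure_pmf pair_pmf_n"
    by unfold_locales
  have f: "f \<in> borel_measurable (density lborel (exponential_density \<mu>) \<Otimes>\<^sub>M measure_pmf pair_pmf_n)"
    using assms by (simp cong: measurable_cong_sets sets_pair_measure_cong)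
  have "(\<integral>\<^sup>+x. f x \<partial>gap_meas)
      = (\<integral>\<^sup>+m. \<integral>\<^sup>+e. f (e, m) \<partial>density lborel (exponential_density \<mu>) \<partial>pair_pmf_n)"
    unfolding gap_meas_def pair_unif_def by (rule nn_integral_snd[OF f, symmetric])
  also have "\<dots> = (\<integral>\<^sup>+m. \<integral>\<^sup>+e. ennreal (exponential_density \<mu> e) * f (e, m) \<partial>lborel \<partial>pair_pmf_n)"
    by (intro nn_integral_cong nn_integral_density) auto
  finally show ?thesis .
qed

lemma nn_integral_seq_iter:
  assumes [measurable]: "f \<in> borel_measurable seq.S"
  shows "(\<integral>\<^sup>+a. f a \<partial>seq.S) = (\<integral>\<^sup>+x. \<integral>\<^sup>+a. f (case_nat x a) \<partial>seq.S \<partial>gap_meas)"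
proof -
  have "(\<integral>\<^sup>+a. f a \<partial>seq.S) = (\<integral>\<^sup>+p. f (case p of (x, a) \<Rightarrow> case_nat x a) \<partial>(gap_meas \<Otimes>\<^sub>M seq.S))"
    by (subst seq.PiM_iter[symmetric], subst nn_integral_distr) auto
  also have "\<dots> = (\<integral>\<^sup>+x. \<integral>\<^sup>+a. f (case_nat x a) \<partial>seq.S \<partial>gap_meas)"
    by (subst seq.P.nn_integral_fst[symmetric]) auto
  finally show ?thesis .
qed

definition psum :: "(nat \<Rightarrow> real \<times> 'm) \<Rightarrow> nat \<Rightarrow> real" where
  "psum a m = (\<Sum>i<m. fst (a i))"

definition shift :: "real \<Rightarrow> nat \<Rightarrow> (nat \<Rightarrow> real \<times> 'm) \<Rightarrow> nat \<Rightarrow> real \<times> 'm" where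
  "shift t m a = case_nat (psum a (Suc m) - t, snd (a m)) (\<lambda>i. a (Suc m + i))"

definition word_at :: "real \<Rightarrow> 'm list \<Rightarrow> (nat \<Rightarrow> real \<times> 'm) \<Rightarrow> bool" where
  "word_at t w a \<longleftrightarrow> psum a (length w) \<le> t \<and> t < psum a (Suc (length w))
     \<and> (\<forall>i<length w. snd (a i) = w ! i)"

definition word_prob :: "real \<Rightarrow> (nat \<times> nat) list \<Rightarrow> real" where
  "word_prob t w = (if t < 0 then 0 else
     exp (- \<mu> * t) * (\<mu> * t) ^ length w / fact (length w) * prod_list (map (pmf pair_pmf_n) w))"

lemma word_prob_nonneg: "0 \<le> word_prob t w"
  unfolding word_prob_def using mu by (auto intro!: mult_nonneg_nonneg divide_nonneg_pos prod_list_nonneg)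

lemma word_prob_measurable[measurable]: "(\<lambda>t. word_prob t w) \<in> borel_measurable borel"
  unfolding word_prob_def by measurable

lemma psum_case_nat: "psum (case_nat x a) (Suc m) = fst x + psum a m"
  unfolding psum_def by (subst sum.lessThan_Suc_shift) simp

lemma psum_0[simp]: "psum a 0 = 0"
  by (simp add: psum_def)

lemma shift_case_nat: "shift t (Suc m) (case_nat x a) = shift (t - fst x) m a"
  unfolding shift_def by (auto simp: psum_case_nat fun_eq_iff split: nat.split)

lemma word_at_Cons: "word_at t (z # w) (case_nat x a) \<longleftrightarrow> snd x = z \<and> word_at (t - fst x) w a"
  unfolding word_at_def by (auto simp: psum_case_nat less_Suc_eq_0_disj)

lemma psum_measurable[measurable]: "(\<lambda>a. psum a m) \<in> borel_measurable seq.S"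
  unfolding psum_def by measurable

lemma mark_measurable[measurable]: "(\<lambda>a. snd (a i)) \<in> measurable seq.S (count_space UNIV)"
  by measurable

lemma word_at_measurable[measurable]: "Measurable.pred seq.S (word_at t w)"
  unfolding word_at_def by measurable

lemma case_nat_PiM_measurable:
  assumes [measurable]: "f \<in> measurable N M" "g \<in> measurable N (PiM UNIV (\<lambda>_::nat. M))"
  shows "(\<lambda>x. case_nat (f x) (g x)) \<in> measurable N (PiM UNIV (\<lambda>_::nat. M))"
  by measurable

lemma shift_measurable[measurable]: "shift t m \<in> measurable seq.S seq.S"
  unfolding shift_def
proof (rule case_nat_PiM_measurable)
  show "(\<lambda>a. (psum a (Suc m) - t, snd (a m))) \<in> measurable seq.S gap_meas"
    by (subst measurable_cong_sets[OF refl sets_gap_meas]) measurable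
  show "(\<lambda>a i. a (Suc m + i)) \<in> measurable seq.S seq.S"
    by (rule measurable_PiM_single') (auto simp: space_PiM)
qed

lemma memoryless:
  assumes [measurable]: "g \<in> borel_measurable (borel \<Otimes>\<^sub>M count_space UNIV)" and t: "0 \<le> t"
  shows "(\<integral>\<^sup>+x. indicator {t<..} (fst x) * g (fst x - t, snd x) \<partial>gap_meas)
    = ennreal (exp (- \<mu> * t)) * (\<integral>\<^sup>+x. g x \<partial>gap_meas)"
proof -
  have inner: "(\<integral>\<^sup>+e. ennreal (exponential_density \<mu> e) * (indicator {t<..} e * g (e - t, m)) \<partial>lborel)
      = ennreal (exp (- \<mu> * t)) * (\<integral>\<^sup>+e. ennreal (exponential_density \<mu> e) * g (e, m) \<partial>lborel)" for m
  proof -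
    have "(\<integral>\<^sup>+e. ennreal (exponential_density \<mu> e) * (indicator {t<..} e * g (e - t, m)) \<partial>lborel)
        = ennreal 1 * (\<integral>\<^sup>+e. ennreal (exponential_density \<mu> (t + 1 * e))
            * (indicator {t<..} (t + 1 * e) * g (t + 1 * e - t, m)) \<partial>lborel)"
      by (subst nn_integral_real_affine[where c=1 and t=t]) auto
    also have "\<dots> = (\<integral>\<^sup>+e. ennreal (exp (- \<mu> * t)) * (ennreal (exponential_density \<mu> e) * g (e, m)) \<partial>lborel)"
      unfolding ennreal_1 mult_1_left
    proof (rule nn_integral_cong_AE)
      have "AE e in lborel. e \<noteq> (0::real)" by (rule AE_lborel_singleton)
      then show "AE e in lborel. ennreal (exponential_density \<mu> (t + e))
            * (indicator {t<..} (t + e) * g (t + e - t, m))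
          = ennreal (exp (- \<mu> * t)) * (ennreal (exponential_density \<mu> e) * g (e, m))"
      proof eventually_elim
        case (elim e)
        show ?case
        proof (cases "e < 0")
          case False
          with elim have e: "0 < e" by simp
          have "exponential_density \<mu> (t + e) = exp (- \<mu> * t) * exponential_density \<mu> e"
            using e t by (simp add: exponential_density_def exp_add[symmetric] algebra_simps)
          then show ?thesis using e mu
            by (simp add: ennreal_mult exponential_density_nonneg mult.assoc)
        next
          case True
          then show ?thesis by (simp add: exponential_density_def)
        qed
      qed
    qed
    also have "\<dots> = ennreal (exp (- \<mu> * t)) * (\<integral>\<^sup>+e. ennreal (exponential_density \<mu> e) * g (e, m) \<partial>lborel)"
      by (rule nn_integral_cmult) auto
    finally show ?thesis .
  qed
  show ?thesis
    by (subst (1 2) nn_integral_gap) (auto simp: inner nn_integral_cmult)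
qed

lemma word_prob_Cons_integral:
  "(\<integral>\<^sup>+e. ennreal (exponential_density \<mu> e) * ennreal (word_prob (t - e) w) \<partial>lborel) * ennreal (pmf pair_pmf_n z)
   = ennreal (word_prob t (z # w))"
proof (cases "t < 0")
  case True
  have "ennreal (exponential_density \<mu> e) * ennreal (word_prob (t - e) w) = 0" for e
    using True by (cases "e < 0") (auto simp: exponential_density_def word_prob_def)
  then have "(\<integral>\<^sup>+e. ennreal (exponential_density \<mu> e) * ennreal (word_prob (t - e) w) \<partial>lborel) = 0"
    by (simp only: nn_integral_const) simp
  then show ?thesis using True by (simp add: word_prob_def[of _ "_ # _"])
next
  case False
  then have t: "0 \<le> t" by simp
  define m where "m = length w"
  define P where "P = prod_list (map (pmf pair_pmf_n) w)"
  have P: "0 \<le> P" unfolding P_def by (intro prod_list_nonneg) auto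
  define G where "G e = - (exp (- \<mu> * t) * (\<mu> * (t - e)) ^ Suc m / fact (Suc m) * P)" for e
  define h where "h e = \<mu> * exp (- \<mu> * t) * (\<mu> * (t - e)) ^ m / fact m * P" for e
  have deriv: "DERIV G x :> h x" for x
  proof -
    define K where "K = - (exp (- \<mu> * t) * P / fact (Suc m))"
    have G: "G = (\<lambda>e. K * (\<mu> * (t - e)) ^ Suc m)" by (auto simp: G_def K_def fun_eq_iff)
    have "(G has_real_derivative K * (real (Suc m) * (\<mu> * (t - x)) ^ m * (- \<mu>))) (at x)"
    proof -
      have "((\<lambda>e. \<mu> * (t - e)) has_real_derivative - \<mu>) (at x)"
        by (auto intro!: derivative_eq_intros)
      from DERIV_cmult[OF DERIV_power[OF this, of "Suc m"], of K] show ?thesis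
        unfolding G by (simp add: algebra_simps del: power_Suc)
    qed
    also have "K * (real (Suc m) * (\<mu> * (t - x)) ^ m * (- \<mu>)) = h x"
      unfolding K_def h_def by (simp add: fact_Suc del: of_nat_Suc)
    finally show ?thesis .
  qed
  have "(\<integral>\<^sup>+e. ennreal (exponential_density \<mu> e) * ennreal (word_prob (t - e) w) \<partial>lborel)
      = (\<integral>\<^sup>+e. ennreal (h e) * indicator {0..t} e \<partial>lborel)"
  proof (rule nn_integral_cong)
    fix e
    have "exp (- (e * \<mu>)) * exp (- (\<mu> * (t - e))) = exp (- (\<mu> * t))"
      by (simp add: mult_exp_exp algebra_simps)
    then have "exponential_density \<mu> e * word_prob (t - e) w = h e" if "0 \<le> e" "e \<le> t"
      using that by (simp add: exponential_density_def word_prob_def h_def P_def[symmetric] m_def[symmetric])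
    moreover have "0 \<le> exponential_density \<mu> e" using mu by (simp add: exponential_density_nonneg)
    ultimately show "ennreal (exponential_density \<mu> e) * ennreal (word_prob (t - e) w) = ennreal (h e) * indicator {0..t} e"
      by (auto simp: ennreal_mult'[symmetric] split: split_indicator)
        (auto simp: exponential_density_def word_prob_def)
  qed
  also have "\<dots> = ennreal (G t - G 0)"
  proof (rule nn_integral_FTC_Icc)
    show "h \<in> borel_measurable borel" unfolding h_def by measurable
    show "\<And>x. x \<in> {0..t} \<Longrightarrow> DERIV G x :> h x"
      by (rule deriv)
    show "\<And>x. x \<in> {0..t} \<Longrightarrow> 0 \<le> h x" unfolding h_def using mu P by auto
  qed (rule t)
  also have "G t - G 0 = exp (- \<mu> * t) * (\<mu> * t) ^ Suc m / fact (Suc m) * P"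
    by (simp add: G_def)
  finally show ?thesis using t mu P
    by (simp add: word_prob_def P_def[symmetric] m_def[symmetric] ennreal_mult'[symmetric] ac_simps
       ennreal_mult''[symmetric])
qed

theorem renewal:
  assumes g[measurable]: "g \<in> borel_measurable seq.S"
  shows "(\<integral>\<^sup>+a. indicator {a. word_at t w a} a * g (shift t (length w) a) \<partial>seq.S)
    = ennreal (word_prob t w) * (\<integral>\<^sup>+a. g a \<partial>seq.S)"
proof (induction w arbitrary: t)
  case Nil
  define G where "G x = (\<integral>\<^sup>+a. g (case_nat x a) \<partial>seq.S)" for x
  have "(\<lambda>x. \<integral>\<^sup>+a. g (case_nat x a) \<partial>seq.S) \<in> borel_measurable gap_meas" by measurable
  then have G[measurable]: "G \<in> borel_measurable (borel \<Otimes>\<^sub>M count_space UNIV)"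
    unfolding G_def[abs_def] by simp
  have "(\<integral>\<^sup>+a. indicator {a. word_at t [] a} a * g (shift t (length []) a) \<partial>seq.S)
      = (\<integral>\<^sup>+x. \<integral>\<^sup>+a. indicator {a. word_at t [] a} (case_nat x a) * g (shift t 0 (case_nat x a)) \<partial>seq.S \<partial>gap_meas)"
    by (subst nn_integral_seq_iter) auto
  also have "\<dots> = (\<integral>\<^sup>+x. (if 0 \<le> t then 1 else 0) * (indicator {t<..} (fst x) * G (fst x - t, snd x)) \<partial>gap_meas)"
  proof (rule nn_integral_cong)
    fix x
    have "indicator {a. word_at t [] a} (case_nat x a) * g (shift t 0 (case_nat x a))
        = (if 0 \<le> t then 1 else 0) * indicator {t<..} (fst x) * g (case_nat (fst x - t, snd x) a)" for a
      by (auto simp: word_at_def psum_case_nat shift_def split: split_indicator)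
    then show "(\<integral>\<^sup>+a. indicator {a. word_at t [] a} (case_nat x a) * g (shift t 0 (case_nat x a)) \<partial>seq.S)
       = (if 0 \<le> t then 1 else 0) * (indicator {t<..} (fst x) * G (fst x - t, snd x))"
      unfolding G_def by (simp add: nn_integral_cmult mult.assoc)
  qed
  also have "\<dots> = ennreal (word_prob t []) * (\<integral>\<^sup>+x. G x \<partial>gap_meas)"
  proof (cases "0 \<le> t")
    case True
    then show ?thesis by (simp add: memoryless[OF G] word_prob_def)
  qed (simp add: word_prob_def)
  also have "(\<integral>\<^sup>+x. G x \<partial>gap_meas) = (\<integral>\<^sup>+a. g a \<partial>seq.S)"
    unfolding G_def by (subst nn_integral_seq_iter[OF g]) simp
  finally show ?case .
next
  case (Cons z w)
  have "(\<integral>\<^sup>+a. indicator {a. word_at t (z # w) a} a * g (shift t (length (z # w)) a) \<partial>seq.S)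
      = (\<integral>\<^sup>+x. \<integral>\<^sup>+a. indicator {a. word_at t (z # w) a} (case_nat x a)
            * g (shift t (Suc (length w)) (case_nat x a)) \<partial>seq.S \<partial>gap_meas)"
    by (subst nn_integral_seq_iter) auto
  also have "\<dots> = (\<integral>\<^sup>+x. indicator {z} (snd x) * (ennreal (word_prob (t - fst x) w) * (\<integral>\<^sup>+a. g a \<partial>seq.S)) \<partial>gap_meas)"
  proof (rule nn_integral_cong)
    fix x
    have "indicator {a. word_at t (z # w) a} (case_nat x a) * g (shift t (Suc (length w)) (case_nat x a))
        = indicator {z} (snd x) * (indicator {a. word_at (t - fst x) w a} a * g (shift (t - fst x) (length w) a))" for a
      by (auto simp: word_at_Cons shift_case_nat split: split_indicator)
    then show "(\<integral>\<^sup>+a. indicator {a. word_at t (z # w) a} (case_nat x a)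
            * g (shift t (Suc (length w)) (case_nat x a)) \<partial>seq.S)
        = indicator {z} (snd x) * (ennreal (word_prob (t - fst x) w) * (\<integral>\<^sup>+a. g a \<partial>seq.S))"
      by (simp add: nn_integral_cmult Cons.IH)
  qed
  also have "\<dots> = (\<integral>\<^sup>+m. \<integral>\<^sup>+e. ennreal (exponential_density \<mu> e)
      * (indicator {z} m * (ennreal (word_prob (t - e) w) * (\<integral>\<^sup>+a. g a \<partial>seq.S))) \<partial>lborel \<partial>pair_pmf_n)"
  proof (subst nn_integral_gap)
    have [measurable]: "(\<lambda>x::real \<times> nat \<times> nat. indicator {z} (snd x) :: ennreal)
        \<in> borel_measurable (borel \<Otimes>\<^sub>M count_space UNIV)"
      by (rule measurable_compose[OF measurable_snd]) simp
    show "(\<lambda>x. indicator {z} (snd x) * (ennreal (word_prob (t - fst x) w) * (\<integral>\<^sup>+a. g a \<partial>seq.S)))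
        \<in> borel_measurable (borel \<Otimes>\<^sub>M count_space UNIV)"
      by measurable
  qed simp
  also have "\<dots> = (\<integral>\<^sup>+m. indicator {z} m * ((\<integral>\<^sup>+e. ennreal (exponential_density \<mu> e)
      * ennreal (word_prob (t - e) w) \<partial>lborel) * (\<integral>\<^sup>+a. g a \<partial>seq.S)) \<partial>pair_pmf_n)"
  proof (rule nn_integral_cong)
    fix m
    show "(\<integral>\<^sup>+e. ennreal (exponential_density \<mu> e)
      * (indicator {z} m * (ennreal (word_prob (t - e) w) * (\<integral>\<^sup>+a. g a \<partial>seq.S))) \<partial>lborel)
      = indicator {z} m * ((\<integral>\<^sup>+e. ennreal (exponential_density \<mu> e)
      * ennreal (word_prob (t - e) w) \<partial>lborel) * (\<integral>\<^sup>+a. g a \<partial>seq.S))"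
      by (subst nn_integral_multc[symmetric] nn_integral_cmult[symmetric]; simp?)
        (auto intro!: nn_integral_cong split: split_indicator simp: ac_simps nn_integral_cmult nn_integral_multc)
  qed
  also have "\<dots> = ennreal (word_prob t (z # w)) * (\<integral>\<^sup>+a. g a \<partial>seq.S)"
    by (subst word_prob_Cons_integral[symmetric])
      (simp add: nn_integral_multc emeasure_pmf_single ac_simps)
  finally show ?case .
qed

definition good_seq :: "(nat \<Rightarrow> real \<times> 'm) \<Rightarrow> bool" where
  "good_seq a \<longleftrightarrow> (\<forall>i. 0 < fst (a i)) \<and> (\<forall>x::nat. \<exists>m. real x < psum a m)"

lemma psum_strict_mono: "good_seq a \<Longrightarrow> strict_mono (psum a)"
  by (rule strict_monoI_Suc) (simp add: psum_def good_seq_def)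

lemma good_seq_unbounded:
  assumes "good_seq a" shows "\<exists>m. x < psum a m"
proof -
  obtain k :: nat where "x < real k" using reals_Archimedean2 by blast
  moreover obtain m where "real k < psum a m" using assms by (auto simp: good_seq_def)
  ultimately show ?thesis by (intro exI[of _ m]) linarith
qed

lemma good_seq_measurable[measurable]: "Measurable.pred seq.S good_seq"
  unfolding good_seq_def by measurable

lemma AE_gap: "AE x in gap_meas. 0 < fst x \<and> snd x \<in> slot_pairs"
proof -
  interpret E: prob_space "density lborel (exponential_density \<mu>)"
    by (rule prob_space_exponential_density[OF mu])
  interpret P: prob_space "measure_pmf pair_pmf_n" by unfold_locales
  interpret pair_sigma_finite "density lborel (exponential_density \<mu>)" "measure_pmf pair_pmf_n"
    by unfold_locales
  have e: "AE e in density lborel (exponential_density \<mu>). 0 < e"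
  proof -
    have "AE e in lborel. e \<noteq> (0::real)" by (rule AE_lborel_singleton)
    then have "AE e in lborel. 0 < ennreal (exponential_density \<mu> e) \<longrightarrow> 0 < e"
      by eventually_elim (auto simp: exponential_density_def split: if_splits)
    then show ?thesis by (subst AE_density) auto
  qed
  have p: "AE m in measure_pmf pair_pmf_n. m \<in> slot_pairs"
    using finite_slot_pairs slot_pairs_nonempty by (simp add: AE_measure_pmf_iff)
  have 1: "AE x in gap_meas. 0 < fst x"
    unfolding gap_meas_def pair_unif_def
    by (rule AE_distrD[where M'="density lborel (exponential_density \<mu>)"])
      (simp_all only: measurable_fst measure_pmf.distr_pair_fst e)
  have 2: "AE x in gap_meas. snd x \<in> slot_pairs"
    unfolding gap_meas_def pair_unif_def
  proof (rule AE_distrD[where M'="measure_pmf pair_pmf_n"])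
    have "distr (density lborel (exponential_density \<mu>) \<Otimes>\<^sub>M measure_pmf pair_pmf_n) (measure_pmf pair_pmf_n) snd
        = measure_pmf pair_pmf_n"
    proof (rule measure_eqI)
      fix A assume "A \<in> sets (distr (density lborel (exponential_density \<mu>) \<Otimes>\<^sub>M measure_pmf pair_pmf_n)
          (measure_pmf pair_pmf_n) snd)"
      have "snd -` A \<inter> space (density lborel (exponential_density \<mu>) \<Otimes>\<^sub>M measure_pmf pair_pmf_n)
        = space (density lborel (exponential_density \<mu>)) \<times> A"
        by (auto simp: space_pair_measure)
      then show "emeasure (distr (density lborel (exponential_density \<mu>) \<Otimes>\<^sub>M measure_pmf pair_pmf_n)
          (measure_pmf pair_pmf_n) snd) A = emeasure (measure_pmf pair_pmf_n) A"
        using E.emeasure_space_1 by (subst emeasure_distr) (auto simp: measure_pmf.emeasure_pair_measure_Times)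
    qed simp
    then show "AE m in distr (density lborel (exponential_density \<mu>) \<Otimes>\<^sub>M measure_pmf pair_pmf_n)
        (measure_pmf pair_pmf_n) snd. m \<in> slot_pairs" by (simp only: p)
  qed simp
  from 1 2 show ?thesis by eventually_elim auto
qed

lemma AE_seq_marks: "AE a in seq.S. \<forall>i. 0 < fst (a i) \<and> snd (a i) \<in> slot_pairs"
  unfolding AE_all_countable using seq.AE_component[OF _ AE_gap] by blast

lemma laplace_gap: "(\<integral>\<^sup>+x. ennreal (exp (- fst x)) \<partial>gap_meas) = ennreal (\<mu> / (1 + \<mu>))"
proof -
  have "(\<integral>\<^sup>+x. ennreal (exp (- fst x)) \<partial>gap_meas)
     = (\<integral>\<^sup>+e. ennreal (exponential_density \<mu> e) * ennreal (exp (- e)) \<partial>lborel)"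
    by (subst nn_integral_gap) auto
  also have "\<dots> = (\<integral>\<^sup>+e. ennreal (\<mu> / (1 + \<mu>)) * ennreal (exponential_density (1 + \<mu>) e) \<partial>lborel)"
  proof (rule nn_integral_cong)
    fix e
    have "exp (- e * \<mu>) * exp (- e) = exp (- e * (1 + \<mu>))"
      by (simp add: mult_exp_exp algebra_simps)
    then have "exponential_density \<mu> e * exp (- e) = \<mu> / (1 + \<mu>) * exponential_density (1 + \<mu>) e"
      using mu by (auto simp: exponential_density_def)
    then show "ennreal (exponential_density \<mu> e) * ennreal (exp (- e))
        = ennreal (\<mu> / (1 + \<mu>)) * ennreal (exponential_density (1 + \<mu>) e)"
      using mu by (simp add: ennreal_mult'[symmetric] exponential_density_nonneg
          flip: ennreal_mult'')
  qed
  also have "\<dots> = ennreal (\<mu> / (1 + \<mu>)) * emeasure (density lborel (exponential_density (1 + \<mu>)))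
      (space (density lborel (exponential_density (1 + \<mu>))))"
    by (subst nn_integral_cmult) (auto simp: emeasure_density)
  also have "\<dots> = ennreal (\<mu> / (1 + \<mu>))"
    using mu by (subst prob_space.emeasure_space_1[OF prob_space_exponential_density]) auto
  finally show ?thesis .
qed

lemma laplace_psum: "(\<integral>\<^sup>+a. ennreal (exp (- psum a m)) \<partial>seq.S) = ennreal ((\<mu> / (1 + \<mu>)) ^ m)"
proof (induction m)
  case 0
  then show ?case by (simp add: seq.emeasure_space_1[simplified])
next
  case (Suc m)
  have "(\<integral>\<^sup>+a. ennreal (exp (- psum a (Suc m))) \<partial>seq.S)
     = (\<integral>\<^sup>+x. ennreal (exp (- fst x)) * (\<integral>\<^sup>+a. ennreal (exp (- psum a m)) \<partial>seq.S) \<partial>gap_meas)"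
  proof -
    have "exp (- (fst x + psum a m)) = exp (- fst x) * exp (- psum a m)" for x and a :: "nat \<Rightarrow> real \<times> nat \<times> nat"
      by (simp add: mult_exp_exp)
    then show ?thesis
      by (subst nn_integral_seq_iter) (auto simp: psum_case_nat ennreal_mult' nn_integral_cmult)
  qed
  also have "\<dots> = ennreal (\<mu> / (1 + \<mu>)) * ennreal ((\<mu> / (1 + \<mu>)) ^ m)"
    by (simp add: Suc.IH nn_integral_multc laplace_gap)
  finally show ?case using mu by (simp add: ennreal_mult'[symmetric])
qed

lemma AE_good_seq: "AE a in seq.S. good_seq a"
proof -
  have "AE a in seq.S. \<exists>m. real x < psum a m" for x :: nat
  proof -
    define A where "A = {a :: nat \<Rightarrow> real \<times> nat \<times> nat. \<forall>m. psum a m \<le> real x}"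
    have [measurable]: "A \<in> sets seq.S"
    proof -
      have "{a \<in> space seq.S. \<forall>m. psum a m \<le> real x} \<in> sets seq.S" by measurable
      then show ?thesis by (simp add: A_def)
    qed
    have le: "emeasure seq.S A \<le> ennreal (exp x * (\<mu> / (1 + \<mu>)) ^ m)" for m
    proof -
      have "emeasure seq.S A = (\<integral>\<^sup>+a. indicator A a \<partial>seq.S)" by simp
      also have "\<dots> \<le> (\<integral>\<^sup>+a. ennreal (exp x) * ennreal (exp (- psum a m)) \<partial>seq.S)"
        by (intro nn_integral_mono)
          (auto simp: A_def ennreal_mult'[symmetric] mult_exp_exp split: split_indicator
            intro!: ennreal_leI simp flip: ennreal_1)
      also have "\<dots> = ennreal (exp x * (\<mu> / (1 + \<mu>)) ^ m)"
        by (simp add: nn_integral_cmult laplace_psum ennreal_mult')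
      finally show ?thesis .
    qed
    have "(\<lambda>m. exp x * (\<mu> / (1 + \<mu>)) ^ m) \<longlonglongrightarrow> exp x * 0"
      using mu by (intro tendsto_mult tendsto_const LIMSEQ_power_zero) auto
    then have "(\<lambda>m. ennreal (exp x * (\<mu> / (1 + \<mu>)) ^ m)) \<longlonglongrightarrow> ennreal 0"
      by (intro tendsto_ennrealI) simp
    then have "emeasure seq.S A \<le> ennreal 0"
      by (rule LIMSEQ_le_const) (use le in auto)
    then have "A \<in> null_sets seq.S" by auto
    then show ?thesis by (rule AE_I') (auto simp: A_def not_less)
  qed
  then have "AE a in seq.S. \<forall>x::nat. \<exists>m. real x < psum a m"
    by (simp add: AE_all_countable)
  with AE_seq_marks show ?thesis by eventually_elim (auto simp: good_seq_def)
qed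

lemma AE_psum_neq: "AE a in seq.S. psum a (Suc m) \<noteq> t"
proof -
  have eq: "(\<integral>\<^sup>+x. indicator {t - s} (fst x) \<partial>gap_meas) = 0" for s
  proof -
    have [measurable]: "(\<lambda>x::real \<times> nat \<times> nat. indicator {t - s} (fst x) :: ennreal)
        \<in> borel_measurable (borel \<Otimes>\<^sub>M count_space UNIV)"
      by (rule measurable_compose[OF measurable_fst]) simp
    have "(\<integral>\<^sup>+e. ennreal (exponential_density \<mu> e) * indicator {t - s} e \<partial>lborel) = 0"
    proof (subst nn_integral_0_iff_AE)
      show "AE e in lborel. ennreal (exponential_density \<mu> e) * indicator {t - s} e = 0"
        using AE_lborel_singleton[of "t - s"] by eventually_elim auto
    qed auto
    then show ?thesis by (subst nn_integral_gap) auto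
  qed
  interpret pair_sigma_finite gap_meas seq.S by unfold_locales
  have [measurable]: "{a. psum a (Suc m) = t} \<in> sets seq.S"
  proof -
    have "{a \<in> space seq.S. psum a (Suc m) = t} \<in> sets seq.S" by measurable
    then show ?thesis by simp
  qed
  have [measurable]: "(\<lambda>(x, a). indicator {a. psum a (Suc m) = t} (case_nat x a) :: ennreal)
      \<in> borel_measurable (gap_meas \<Otimes>\<^sub>M seq.S)" by measurable
  have "emeasure seq.S {a. psum a (Suc m) = t}
      = (\<integral>\<^sup>+x. \<integral>\<^sup>+a. indicator {a. psum a (Suc m) = t} (case_nat x a) \<partial>seq.S \<partial>gap_meas)"
    by (subst nn_integral_seq_iter[symmetric]) auto
  also have "\<dots> = (\<integral>\<^sup>+a. \<integral>\<^sup>+x. indicator {a. psum a (Suc m) = t} (case_nat x a) \<partial>gap_meas \<partial>seq.S)"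
    by (rule Fubini'[symmetric]) measurable
  also have "\<dots> = (\<integral>\<^sup>+a. \<integral>\<^sup>+x. indicator {t - psum a m} (fst x) \<partial>gap_meas \<partial>seq.S)"
    by (intro nn_integral_cong) (auto simp: psum_case_nat split: split_indicator)
  also have "\<dots> = 0" by (simp add: eq)
  finally show ?thesis by (intro AE_I'[where N="{a. psum a (Suc m) = t}"]) auto
qed

definition cnt :: "(nat \<Rightarrow> real \<times> 'm) \<Rightarrow> real \<Rightarrow> nat" where
  "cnt a t = (LEAST m. t < psum a (Suc m))"

definition word_in :: "(nat \<Rightarrow> real \<times> 'm) \<Rightarrow> real \<Rightarrow> real \<Rightarrow> 'm list" where
  "word_in a s t = map (\<lambda>i. snd (a i)) [cnt a s..<cnt a t]"

lemma cnt_eqI: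
  assumes "good_seq a" "psum a m \<le> t" "t < psum a (Suc m)"
  shows "cnt a t = m"
  unfolding cnt_def
proof (rule Least_equality)
  fix y assume "t < psum a (Suc y)"
  with assms(2) have "psum a m < psum a (Suc y)" by simp
  with psum_strict_mono[OF assms(1)] show "m \<le> y" by (simp add: strict_mono_less)
qed fact

lemma cnt_props:
  assumes g: "good_seq a" and t: "0 \<le> t"
  shows "psum a (cnt a t) \<le> t" "t < psum a (Suc (cnt a t))"
proof -
  obtain m where m: "t < psum a m" using good_seq_unbounded[OF g] by blast
  with t obtain m' where "m = Suc m'" by (cases m) auto
  with m have ex: "t < psum a (Suc m')" by simp
  then show "t < psum a (Suc (cnt a t))" unfolding cnt_def by (rule LeastI)
  show "psum a (cnt a t) \<le> t"
  proof (cases "cnt a t")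
    case (Suc j)
    then have "\<not> t < psum a (Suc j)" unfolding cnt_def by (intro not_less_Least) simp
    with Suc show ?thesis by simp
  qed (use t in simp)
qed

lemma cnt_iff:
  assumes "good_seq a" "0 \<le> t"
  shows "cnt a t = m \<longleftrightarrow> psum a m \<le> t \<and> t < psum a (Suc m)"
  using assms cnt_eqI cnt_props by blast

lemma word_in_0_iff:
  assumes g: "good_seq a" and t: "0 \<le> t"
  shows "word_in a 0 t = w \<longleftrightarrow> word_at t w a"
proof -
  have "cnt a 0 = 0" using g by (intro cnt_eqI) (auto simp: psum_def good_seq_def)
  then have "word_in a 0 t = w \<longleftrightarrow> cnt a t = length w \<and> (\<forall>i<length w. snd (a i) = w ! i)"
    unfolding word_in_def by (auto simp: list_eq_iff_nth_eq)
  then show ?thesis using cnt_iff[OF g t] by (auto simp: word_at_def)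
qed

lemma psum_shift: "psum (shift t m a) (Suc j) = psum a (Suc m + j) - t"
proof (induction j)
  case 0
  then show ?case by (simp add: psum_def shift_def)
next
  case (Suc j)
  have "psum (shift t m a) (Suc (Suc j)) = psum (shift t m a) (Suc j) + fst (a (Suc m + j))"
    by (simp add: psum_def shift_def)
  also have "\<dots> = psum a (Suc m + Suc j) - t" unfolding Suc by (simp add: psum_def)
  finally show ?case .
qed

lemma good_seq_shift:
  assumes g: "good_seq a" and "t < psum a (Suc m)"
  shows "good_seq (shift t m a)"
  unfolding good_seq_def
proof safe
  show "0 < fst (shift t m a i)" for i
    using assms by (cases i) (auto simp: shift_def good_seq_def)
  fix x :: nat
  obtain j where j: "real x + t < psum a j" using good_seq_unbounded[OF g] by blast
  have "psum a j \<le> psum a (Suc m + j)"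
    using psum_strict_mono[OF g] by (simp add: strict_mono_less_eq)
  with j have "real x < psum (shift t m a) (Suc j)" by (simp add: psum_shift)
  then show "\<exists>m'. real x < psum (shift t m a) m'" by blast
qed

lemma cnt_shift:
  assumes g: "good_seq a" and t: "0 \<le> t" and s: "0 \<le> s" and m: "m = cnt a t"
  shows "cnt a (t + s) = m + cnt (shift t m a) s"
proof (rule cnt_eqI[OF g])
  have g': "good_seq (shift t m a)" using good_seq_shift[OF g cnt_props(2)[OF g t]] m by simp
  let ?j = "cnt (shift t m a) s"
  show "t + s < psum a (Suc (m + ?j))"
    using cnt_props(2)[OF g' s] by (simp add: psum_shift)
  show "psum a (m + ?j) \<le> t + s"
  proof (cases ?j)
    case 0
    then show ?thesis using cnt_props(1)[OF g t] s m by simp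
  next
    case (Suc j)
    then show ?thesis using cnt_props(1)[OF g' s] by (simp add: psum_shift)
  qed
qed

lemma word_in_shift:
  assumes g: "good_seq a" and t: "0 \<le> t" and s: "0 \<le> s" "s \<le> s'" and m: "m = cnt a t"
  shows "word_in (shift t m a) s s' = word_in a (t + s) (t + s')"
proof -
  have *: "snd (shift t m a i) = snd (a (m + i))" for i
    by (cases i) (auto simp: shift_def)
  have "[m + p..<m + q] = map (\<lambda>i. m + i) [p..<q]" for p q
    by (auto simp: list_eq_iff_nth_eq)
  then show ?thesis
    using assms by (simp add: word_in_def cnt_shift *[unfolded m] o_def)
qed

lemma cnt_measurable[measurable]: "(\<lambda>a. cnt a t) \<in> measurable seq.S (count_space UNIV)"
  unfolding cnt_def by measurable

lemma word_in_eq_iff: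
  "word_in a s t = w \<longleftrightarrow> (\<exists>p q. cnt a s = p \<and> cnt a t = q \<and> q - p = length w
      \<and> (\<forall>i<length w. snd (a (p + i)) = w ! i))"
  unfolding word_in_def by (auto simp: list_eq_iff_nth_eq)

lemma word_in_measurable[measurable]: "Measurable.pred seq.S (\<lambda>a. word_in a s t = w)"
  unfolding word_in_eq_iff by measurable

theorem word_in_law:
  assumes "s 0 = 0" "\<And>q. q < m \<Longrightarrow> s q \<le> s (Suc q)"
  shows "emeasure seq.S {a. \<forall>q<m. word_in a (s q) (s (Suc q)) = w q}
    = ennreal (\<Prod>q<m. word_prob (s (Suc q) - s q) (w q))"
  using assms
proof (induction m arbitrary: s w)
  case 0
  then show ?case by (simp add: seq.emeasure_space_1[simplified])
next
  case (Suc m)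
  define s' where "s' q = s (Suc q) - s 1" for q
  define w' where "w' q = w (Suc q)" for q
  have s1: "0 \<le> s 1" using Suc.prems(2)[of 0] Suc.prems(1) by simp
  have mono: "s 1 \<le> s (Suc q)" if "q \<le> m" for q
    using that
  proof (induction q)
    case (Suc q)
    then show ?case using Suc.prems \<open>\<And>q. q < Suc m \<Longrightarrow> s q \<le> s (Suc q)\<close>[of "Suc q"] by simp
  qed simp
  let ?C = "{a. \<forall>q<m. word_in a (s' q) (s' (Suc q)) = w' q}"
  have C[measurable]: "?C \<in> sets seq.S"
  proof -
    have "{a \<in> space seq.S. \<forall>q<m. word_in a (s' q) (s' (Suc q)) = w' q} \<in> sets seq.S" by measurable
    then show ?thesis by simp
  qed
  have "emeasure seq.S {a. \<forall>q<Suc m. word_in a (s q) (s (Suc q)) = w q}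
      = (\<integral>\<^sup>+a. indicator {a. \<forall>q<Suc m. word_in a (s q) (s (Suc q)) = w q} a \<partial>seq.S)"
  proof -
    have "{a \<in> space seq.S. \<forall>q<Suc m. word_in a (s q) (s (Suc q)) = w q} \<in> sets seq.S" by measurable
    then show ?thesis by simp
  qed
  also have "\<dots> = (\<integral>\<^sup>+a. indicator {a. word_at (s 1) (w 0) a} a * indicator ?C (shift (s 1) (length (w 0)) a) \<partial>seq.S)"
  proof (rule nn_integral_cong_AE)
    show "AE a in seq.S. indicator {a. \<forall>q<Suc m. word_in a (s q) (s (Suc q)) = w q} a
       = (indicator {a. word_at (s 1) (w 0) a} a * indicator ?C (shift (s 1) (length (w 0)) a) :: ennreal)"
      using AE_good_seq
    proof eventually_elim
      case (elim a)
      have "(\<forall>q<Suc m. word_in a (s q) (s (Suc q)) = w q)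
         \<longleftrightarrow> word_at (s 1) (w 0) a \<and> shift (s 1) (length (w 0)) a \<in> ?C"
      proof (cases "word_at (s 1) (w 0) a")
        case True
        then have c: "length (w 0) = cnt a (s 1)"
          using cnt_iff[OF elim s1, of "length (w 0)"] by (simp add: word_at_def)
        have "word_in (shift (s 1) (length (w 0)) a) (s' q) (s' (Suc q)) = word_in a (s (Suc q)) (s (Suc (Suc q)))"
          if "q < m" for q
          using word_in_shift[OF elim s1, of "s' q" "s' (Suc q)", OF _ _ c] that mono[of q] Suc.prems(2)[of "Suc q"]
          by (simp add: s'_def)
        moreover have "word_in a (s 0) (s (Suc 0)) = w 0"
          using True word_in_0_iff[OF elim s1] Suc.prems(1) by simp
        ultimately show ?thesis using True
          unfolding All_less_Suc2 w'_def mem_Collect_eq by simp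
      next
        case False
        then have "word_in a (s 0) (s (Suc 0)) \<noteq> w 0"
          using word_in_0_iff[OF elim s1] Suc.prems(1) by simp
        then show ?thesis using False by auto
      qed
      then show ?case by (auto split: split_indicator)
    qed
  qed
  also have "\<dots> = ennreal (word_prob (s 1) (w 0)) * emeasure seq.S ?C"
    by (subst renewal) auto
  also have "emeasure seq.S ?C = ennreal (\<Prod>q<m. word_prob (s' (Suc q) - s' q) (w' q))"
    by (rule Suc.IH) (use Suc.prems in \<open>auto simp: s'_def\<close>)
  also have "ennreal (word_prob (s 1) (w 0)) * \<dots> = ennreal (\<Prod>q<Suc m. word_prob (s (Suc q) - s q) (w q))"
    using Suc.prems(1) by (subst prod.lessThan_Suc_shift)
      (simp add: s'_def w'_def ennreal_mult'[symmetric] word_prob_nonneg)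
  finally show ?case .
qed

end

section \<open>Mark words of the two-sided process\<close>

definition ev_word :: "smg_omega \<Rightarrow> real \<Rightarrow> real \<Rightarrow> (nat \<times> nat) list" where
  "ev_word \<omega> s t = map (\<lambda>m. snd (fst \<omega> m)) (sorted_list_of_set {m. s < ev_time \<omega> m \<and> ev_time \<omega> m \<le> t})"

definition replace_slot :: "nat \<times> nat \<Rightarrow> nat \<Rightarrow> nat" where
  "replace_slot p y = (if y = fst p then snd p else y)"

lemma anc_eq_foldr: "anc \<omega> x t s = foldr replace_slot (ev_word \<omega> s t) x"
  unfolding anc_def ev_word_def foldr_map
  by (intro foldr_cong) (auto simp: replace_slot_def ev_death_def ev_birth_def o_def)

context moran begin

definition glue :: "(nat \<Rightarrow> 'x) \<Rightarrow> (nat \<Rightarrow> 'x) \<Rightarrow> int \<Rightarrow> 'x" where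
  "glue a b m = (if 1 \<le> m then a (nat (m - 1)) else b (nat (- m)))"

sublocale ints: product_prob_space "\<lambda>_::int. gap_meas" UNIV
  by unfold_locales

abbreviation slot_pmf :: "nat pmf" where "slot_pmf \<equiv> pmf_of_set {..<n}"

abbreviation slotsM :: "(nat \<Rightarrow> nat) measure" where
  "slotsM \<equiv> \<Pi>\<^sub>M i\<in>(UNIV::nat set). measure_pmf slot_pmf"

sublocale slots: product_prob_space "\<lambda>_::nat. measure_pmf slot_pmf" UNIV
  by unfold_locales

lemma glue_measurable[measurable]:
  "(\<lambda>p. glue (fst p) (snd p)) \<in> measurable (seq.S \<Otimes>\<^sub>M seq.S) (PiM UNIV (\<lambda>_::int. gap_meas))"
proof (rule measurable_PiM_single')
  fix i :: int
  show "(\<lambda>p. glue (fst p) (snd p) i) \<in> measurable (seq.S \<Otimes>\<^sub>M seq.S) gap_meas"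
    by (cases "1 \<le> i") (simp_all add: glue_def)
qed simp

lemma distr_glue:
  "distr (seq.S \<Otimes>\<^sub>M seq.S) (PiM UNIV (\<lambda>_::int. gap_meas)) (\<lambda>p. glue (fst p) (snd p))
    = PiM UNIV (\<lambda>_::int. gap_meas)" (is "?D = _")
proof (rule ints.PiM_eq)
  fix J :: "int set" and E assume J: "finite J" "J \<subseteq> UNIV" "\<And>j. j \<in> J \<Longrightarrow> E j \<in> sets gap_meas"
  let ?X = "prod_emb UNIV (\<lambda>_. gap_meas) J (\<Pi>\<^sub>E j\<in>J. E j)"
  let ?p = "\<lambda>i::nat. int i + 1" and ?q = "\<lambda>i::nat. - int i"
  let ?P = "?p -` J" and ?Q = "?q -` J"
  have fin: "finite ?P" "finite ?Q" using J(1) by (auto intro!: finite_vimageI simp: inj_on_def)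
  have eq: "(\<lambda>p. glue (fst p) (snd p)) -` ?X \<inter> space (seq.S \<Otimes>\<^sub>M seq.S)
     = prod_emb UNIV (\<lambda>_. gap_meas) ?P (\<Pi>\<^sub>E i\<in>?P. E (?p i)) \<times> prod_emb UNIV (\<lambda>_. gap_meas) ?Q (\<Pi>\<^sub>E i\<in>?Q. E (?q i))"
  proof -
    have E: "(\<forall>j\<in>J. glue a b j \<in> E j) \<longleftrightarrow> (\<forall>i\<in>?P. a i \<in> E (?p i)) \<and> (\<forall>i\<in>?Q. b i \<in> E (?q i))" for a b
    proof safe
      fix i assume *: "\<forall>j\<in>J. glue a b j \<in> E j" 
      show "a i \<in> E (?p i)" if "?p i \<in> J" using *[rule_format, OF that] by (simp add: glue_def)
      show "b i \<in> E (?q i)" if "?q i \<in> J" using *[rule_format, OF that] by (simp add: glue_def)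
    next
      fix j assume 1: "\<forall>i\<in>?P. a i \<in> E (?p i)" and 2: "\<forall>i\<in>?Q. b i \<in> E (?q i)" and j: "j \<in> J"
      show "glue a b j \<in> E j"
      proof (cases "1 \<le> j")
        case True
        then show ?thesis using 1[rule_format, of "nat (j - 1)"] j by (simp add: glue_def)
      next
        case False
        then show ?thesis using 2[rule_format, of "nat (- j)"] j by (simp add: glue_def)
      qed
    qed
    show ?thesis
    proof (rule set_eqI)
      fix p :: "(nat \<Rightarrow> real \<times> nat \<times> nat) \<times> (nat \<Rightarrow> real \<times> nat \<times> nat)"
      show "p \<in> (\<lambda>p. glue (fst p) (snd p)) -` ?X \<inter> space (seq.S \<Otimes>\<^sub>M seq.S)
        \<longleftrightarrow> p \<in> prod_emb UNIV (\<lambda>_. gap_meas) ?P (\<Pi>\<^sub>E i\<in>?P. E (?p i)) \<times> prod_emb UNIV (\<lambda>_. gap_meas) ?Q (\<Pi>\<^sub>E i\<in>?Q. E (?q i))"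
        using E[of "fst p" "snd p"]
        by (simp add: prod_emb_def space_pair_measure restrict_PiE_iff Pi_iff mem_Times_iff)
    qed
  qed
  have "emeasure ?D ?X = emeasure (seq.S \<Otimes>\<^sub>M seq.S)
      (prod_emb UNIV (\<lambda>_. gap_meas) ?P (\<Pi>\<^sub>E i\<in>?P. E (?p i)) \<times> prod_emb UNIV (\<lambda>_. gap_meas) ?Q (\<Pi>\<^sub>E i\<in>?Q. E (?q i)))"
    using J by (subst emeasure_distr) (auto simp: eq intro!: sets_PiM_I)
  also have "\<dots> = emeasure seq.S (prod_emb UNIV (\<lambda>_. gap_meas) ?P (\<Pi>\<^sub>E i\<in>?P. E (?p i)))
      * emeasure seq.S (prod_emb UNIV (\<lambda>_. gap_meas) ?Q (\<Pi>\<^sub>E i\<in>?Q. E (?q i)))"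
    using J fin by (intro seq.P.emeasure_pair_measure_Times) (auto intro!: sets_PiM_I)
  also have "\<dots> = (\<Prod>i\<in>?P. emeasure gap_meas (E (?p i))) * (\<Prod>i\<in>?Q. emeasure gap_meas (E (?q i)))"
    using J fin by (subst (1 2) seq.emeasure_PiM_emb) auto
  also have "(\<Prod>i\<in>?P. emeasure gap_meas (E (?p i))) = (\<Prod>j\<in>{j\<in>J. 1 \<le> j}. emeasure gap_meas (E j))"
    by (rule prod.reindex_bij_witness[of _ "\<lambda>j. nat (j - 1)" "\<lambda>i. int i + 1"]) auto
  also have "(\<Prod>i\<in>?Q. emeasure gap_meas (E (?q i))) = (\<Prod>j\<in>{j\<in>J. \<not> 1 \<le> j}. emeasure gap_meas (E j))"
    by (rule prod.reindex_bij_witness[of _ "\<lambda>j. nat (- j)" "\<lambda>i. - int i"]) auto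
  also have "(\<Prod>j\<in>{j\<in>J. 1 \<le> j}. emeasure gap_meas (E j)) * \<dots> = (\<Prod>j\<in>J. emeasure gap_meas (E j))"
    using J(1) by (subst prod.union_disjoint[symmetric]) (auto intro!: prod.cong)
  finally show "emeasure ?D ?X = (\<Prod>j\<in>J. emeasure gap_meas (E j))" .
qed simp

definition mk_omega :: "((nat \<Rightarrow> real \<times> nat \<times> nat) \<times> (nat \<Rightarrow> real \<times> nat \<times> nat)) \<times> (nat \<Rightarrow> nat) \<Rightarrow> smg_omega" where
  "mk_omega p = (glue (fst (fst p)) (snd (fst p)), snd p)"

lemma smg_space_eq: "smg_space n \<mu> = PiM UNIV (\<lambda>_::int. gap_meas) \<Otimes>\<^sub>M slotsM"
  unfolding smg_space_def gap_meas_def ..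

lemma prob_space_smg: "prob_space (smg_space n \<mu>)"
  unfolding smg_space_eq by (intro prob_space_pair ints.P.prob_space_axioms slots.P.prob_space_axioms)

sublocale smg: prob_space "smg_space n \<mu>"
  by (rule prob_space_smg)

lemma space_smg[simp]: "space (smg_space n \<mu>) = UNIV"
  unfolding smg_space_eq by (simp add: space_pair_measure space_PiM)

lemma mk_omega_measurable[measurable]:
  "mk_omega \<in> measurable ((seq.S \<Otimes>\<^sub>M seq.S) \<Otimes>\<^sub>M slotsM) (smg_space n \<mu>)"
  unfolding mk_omega_def smg_space_eq
  by (intro measurable_Pair measurable_compose[OF measurable_fst glue_measurable] measurable_snd)

lemma distr_mk_omega: "distr ((seq.S \<Otimes>\<^sub>M seq.S) \<Otimes>\<^sub>M slotsM) (smg_space n \<mu>) mk_omega = smg_space n \<mu>"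
proof -
  have "smg_space n \<mu> = distr (seq.S \<Otimes>\<^sub>M seq.S) (PiM UNIV (\<lambda>_::int. gap_meas)) (\<lambda>p. glue (fst p) (snd p))
      \<Otimes>\<^sub>M distr slotsM slotsM (\<lambda>x. x)"
    unfolding smg_space_eq distr_glue by (simp add: distr_id2)
  also have "\<dots> = distr ((seq.S \<Otimes>\<^sub>M seq.S) \<Otimes>\<^sub>M slotsM) (PiM UNIV (\<lambda>_::int. gap_meas) \<Otimes>\<^sub>M slotsM)
      (\<lambda>(p, u). (glue (fst p) (snd p), u))"
  proof (rule pair_measure_distr)
    have "distr slotsM slotsM (\<lambda>x. x) = slotsM" by (simp add: distr_id2)
    then show "sigma_finite_measure (distr slotsM slotsM (\<lambda>x. x))"
      using slots.P.sigma_finite_measure_axioms by simp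
  qed measurable
  finally have "smg_space n \<mu> = distr ((seq.S \<Otimes>\<^sub>M seq.S) \<Otimes>\<^sub>M slotsM) (smg_space n \<mu>) (\<lambda>(p, u). (glue (fst p) (snd p), u))"
    by (simp only: smg_space_eq)
  moreover have "mk_omega = (\<lambda>(p, u). (glue (fst p) (snd p), u))"
    by (auto simp: mk_omega_def fun_eq_iff)
  ultimately show ?thesis by (simp only:)
qed

lemma ev_time_mk_omega:
  "ev_time (mk_omega ((a, b), u)) m = (if 1 \<le> m then psum a (nat m) else - psum b (nat (1 - m)))"
proof (cases "1 \<le> m")
  case True
  have "(\<Sum>i\<in>{1..m}. fst (glue a b i)) = (\<Sum>i<nat m. fst (a i))"
  proof (rule sum.reindex_cong[of "\<lambda>i. int i + 1"])
    show "{1..m} = (\<lambda>i. int i + 1) ` {..<nat m}"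
    proof safe
      fix x assume "x \<in> {1..m}"
      then show "x \<in> (\<lambda>i. int i + 1) ` {..<nat m}" by (intro image_eqI[of _ _ "nat (x - 1)"]) auto
    qed auto
  qed (auto simp: inj_on_def glue_def)
  with True show ?thesis by (simp add: ev_time_def mk_omega_def psum_def)
next
  case False
  have "(\<Sum>i\<in>{m..0}. fst (glue a b i)) = (\<Sum>i<nat (1 - m). fst (b i))"
  proof (rule sum.reindex_cong[of "\<lambda>i. - int i"])
    show "{m..0} = (\<lambda>i. - int i) ` {..<nat (1 - m)}"
    proof safe
      fix x assume "x \<in> {m..0}"
      then show "x \<in> (\<lambda>i. - int i) ` {..<nat (1 - m)}" by (intro image_eqI[of _ _ "nat (- x)"]) auto
    qed auto
  qed (auto simp: inj_on_def glue_def)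
  with False show ?thesis by (simp add: ev_time_def mk_omega_def psum_def)
qed

lemma sorted_list_of_set_eqI:
  fixes l :: "'b::linorder list"
  assumes "sorted_wrt (<) l" "set l = A"
  shows "sorted_list_of_set A = l"
  using assms by (metis sorted_list_of_set.idem_if_sorted_distinct strict_sorted_iff)

lemma psum_less_iff:
  assumes g: "good_seq a" and t: "0 \<le> t"
  shows "t < psum a (Suc i) \<longleftrightarrow> cnt a t \<le> i"
proof -
  have "t < psum a (Suc i) \<Longrightarrow> psum a (cnt a t) < psum a (Suc i)"
    using cnt_props(1)[OF g t] by simp
  moreover have "cnt a t \<le> i \<Longrightarrow> psum a (Suc (cnt a t)) \<le> psum a (Suc i)"
    using psum_strict_mono[OF g] by (simp add: strict_mono_less_eq)
  ultimately show ?thesis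
    using cnt_props(2)[OF g t] psum_strict_mono[OF g] by (force simp: strict_mono_less)
qed

lemma psum_nonneg: "good_seq a \<Longrightarrow> 0 \<le> psum a m"
  unfolding psum_def good_seq_def by (intro sum_nonneg) (auto simp: less_imp_le)

lemma psum_pos: "good_seq a \<Longrightarrow> 0 < psum a (Suc m)"
  using psum_strict_mono[of a] by (metis psum_0 strict_mono_less zero_less_Suc)

lemma ev_word_pos:
  assumes a: "good_seq a" and b: "good_seq b" and "0 \<le> s" "s \<le> t"
  shows "ev_word (mk_omega ((a, b), u)) s t = word_in a s t"
proof -
  let ?w = "mk_omega ((a, b), u)"
  have mem: "s < ev_time ?w m \<and> ev_time ?w m \<le> t \<longleftrightarrow> (\<exists>i\<in>{cnt a s..<cnt a t}. m = int i + 1)" for m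
  proof (cases "1 \<le> m")
    case True
    define i where "i = nat (m - 1)"
    have m: "m = int i + 1" "nat m = Suc i" using True by (auto simp: i_def)
    have "s < psum a (Suc i) \<and> psum a (Suc i) \<le> t \<longleftrightarrow> cnt a s \<le> i \<and> i < cnt a t"
      using psum_less_iff[OF a, of s i] psum_less_iff[OF a, of t i] assms by auto
    then show ?thesis using True m by (auto simp: ev_time_mk_omega)
  next
    case False
    have "- psum b (nat (1 - m)) \<le> 0" using psum_nonneg[OF b] by simp
    with False \<open>0 \<le> s\<close> show ?thesis by (auto simp: ev_time_mk_omega)
  qed
  have "sorted_list_of_set {m. s < ev_time ?w m \<and> ev_time ?w m \<le> t} = map (\<lambda>i. int i + 1) [cnt a s..<cnt a t]"
    unfolding mem by (rule sorted_list_of_set_eqI)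
      (auto simp: sorted_wrt_map image_iff intro!: sorted_wrt_mono_rel[OF _ sorted_wrt_upt])
  then show ?thesis by (simp add: ev_word_def word_in_def mk_omega_def glue_def o_def)
qed

lemma ev_word_neg:
  assumes a: "good_seq a" and b: "good_seq b" and "s \<le> t" "t \<le> 0"
    and ne: "\<And>i. psum b (Suc i) \<noteq> - t" "\<And>i. psum b (Suc i) \<noteq> - s"
  shows "ev_word (mk_omega ((a, b), u)) s t = rev (word_in b (- t) (- s))"
proof -
  let ?w = "mk_omega ((a, b), u)"
  have mem: "s < ev_time ?w m \<and> ev_time ?w m \<le> t \<longleftrightarrow> (\<exists>i\<in>{cnt b (- t)..<cnt b (- s)}. m = - int i)" for m
  proof (cases "1 \<le> m")
    case True
    define i where "i = nat (m - 1)"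
    have m: "m = int i + 1" "nat m = Suc i" using True by (auto simp: i_def)
    show ?thesis using psum_pos[OF a, of i] True m assms(4) by (auto simp: ev_time_mk_omega)
  next
    case False
    define i where "i = nat (- m)"
    have m: "m = - int i" "nat (1 - m) = Suc i" using False by (auto simp: i_def)
    have "s < - psum b (Suc i) \<and> - psum b (Suc i) \<le> t \<longleftrightarrow> cnt b (- t) \<le> i \<and> i < cnt b (- s)"
      using psum_less_iff[OF b, of "- s" i] psum_less_iff[OF b, of "- t" i] assms(3,4) ne[of i] by auto
    then show ?thesis using False m by (auto simp: ev_time_mk_omega)
  qed
  have "sorted_list_of_set {m. s < ev_time ?w m \<and> ev_time ?w m \<le> t} = rev (map (\<lambda>i. - int i) [cnt b (- t)..<cnt b (- s)])"
    unfolding mem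
    by (rule sorted_list_of_set_eqI)
      (auto simp: sorted_wrt_map sorted_wrt_rev image_iff intro!: sorted_wrt_mono_rel[OF _ sorted_wrt_upt])
  then show ?thesis by (simp add: ev_word_def word_in_def mk_omega_def glue_def o_def rev_map)
qed

lemma word_prob_rev: "word_prob d (rev w) = word_prob d w"
  by (simp add: word_prob_def rev_map[symmetric] prod_list.rev)

lemma smg_AE_I:
  assumes "AE p in (seq.S \<Otimes>\<^sub>M seq.S) \<Otimes>\<^sub>M slotsM. P (mk_omega p)" "Measurable.pred (smg_space n \<mu>) P"
  shows "AE \<omega> in smg_space n \<mu>. P \<omega>"
proof -
  have "AE \<omega> in distr ((seq.S \<Otimes>\<^sub>M seq.S) \<Otimes>\<^sub>M slotsM) (smg_space n \<mu>) mk_omega. P \<omega>"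
    using assms by (subst AE_distr_iff) (auto simp: pred_def)
  then show ?thesis by (simp only: distr_mk_omega)
qed

lemma AE_halves:
  assumes "AE a in seq.S. P a" "AE b in seq.S. Q b" "AE u in slotsM. R u"
  shows "AE p in (seq.S \<Otimes>\<^sub>M seq.S) \<Otimes>\<^sub>M slotsM. P (fst (fst p)) \<and> Q (snd (fst p)) \<and> R (snd p)"
proof -
  interpret SS: prob_space "seq.S \<Otimes>\<^sub>M seq.S"
    by (intro prob_space_pair seq.P.prob_space_axioms)
  have snd: "distr (M \<Otimes>\<^sub>M N) N snd = N" if "prob_space M" "prob_space N" for M :: "'i measure" and N :: "'j measure"
  proof (rule measure_eqI)
    interpret M: prob_space M by fact
    interpret N: prob_space N by fact
    fix A assume "A \<in> sets (distr (M \<Otimes>\<^sub>M N) N snd)"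
    then have A: "A \<in> sets N" by simp
    have "snd -` A \<inter> space (M \<Otimes>\<^sub>M N) = space M \<times> A"
      using sets.sets_into_space[OF A] by (auto simp: space_pair_measure)
    then show "emeasure (distr (M \<Otimes>\<^sub>M N) N snd) A = emeasure N A"
      using M.emeasure_space_1 A by (subst emeasure_distr) (auto simp: N.emeasure_pair_measure_Times)
  qed simp
  have 1: "AE p in seq.S \<Otimes>\<^sub>M seq.S. P (fst p)"
    by (rule AE_distrD[OF measurable_fst]) (simp only: seq.P.distr_pair_fst assms)
  have 2: "AE p in seq.S \<Otimes>\<^sub>M seq.S. Q (snd p)"
    by (rule AE_distrD[OF measurable_snd]) (simp only: snd[OF seq.P.prob_space_axioms seq.P.prob_space_axioms] assms)
  from 1 2 have 3: "AE p in seq.S \<Otimes>\<^sub>M seq.S. P (fst p) \<and> Q (snd p)" by eventually_elim auto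
  have 4: "AE p in (seq.S \<Otimes>\<^sub>M seq.S) \<Otimes>\<^sub>M slotsM. P (fst (fst p)) \<and> Q (snd (fst p))"
    by (rule AE_distrD[OF measurable_fst]) (simp only: slots.P.distr_pair_fst 3)
  have 5: "AE p in (seq.S \<Otimes>\<^sub>M seq.S) \<Otimes>\<^sub>M slotsM. R (snd p)"
    by (rule AE_distrD[OF measurable_snd]) (simp only: snd[OF SS.prob_space_axioms slots.P.prob_space_axioms] assms)
  from 4 5 show ?thesis by eventually_elim auto
qed

lemma emeasure_slots:
  "emeasure slotsM {u. \<forall>i\<in>{1..k}. u i = v i} = ennreal (\<Prod>i\<in>{1..k}. pmf slot_pmf (v i))"
proof -
  have "{u. \<forall>i\<in>{1..k}. u i = v i} = prod_emb UNIV (\<lambda>_. measure_pmf slot_pmf) {1..k} (\<Pi>\<^sub>E i\<in>{1..k}. {v i})"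
    by (auto simp: prod_emb_def PiE_iff space_PiM)
  then show ?thesis
    by (simp add: slots.emeasure_PiM_emb emeasure_pmf_single prod_ennreal)
qed

lemma ev_time_measurable[measurable]: "(\<lambda>\<omega>. ev_time \<omega> m) \<in> borel_measurable (smg_space n \<mu>)"
  unfolding ev_time_def smg_space_eq by measurable

lemma ev_mark_measurable[measurable]:
  "(\<lambda>\<omega>. snd (fst \<omega> m)) \<in> measurable (smg_space n \<mu>) (count_space UNIV)"
  unfolding smg_space_eq by measurable

lemma slot_measurable[measurable]: "(\<lambda>\<omega>. snd \<omega> i) \<in> measurable (smg_space n \<mu>) (count_space UNIV)"
proof -
  have "(\<lambda>\<omega>. snd \<omega> i) \<in> measurable (smg_space n \<mu>) (measure_pmf slot_pmf)"
    unfolding smg_space_eq by measurable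
  then show ?thesis by simp
qed

lemma ev_word_eq_iff:
  "ev_word \<omega> s t = w \<longleftrightarrow>
    (if finite {m. s < ev_time \<omega> m \<and> ev_time \<omega> m \<le> t}
     then \<exists>l. sorted_wrt (<) l \<and> (\<forall>m. (s < ev_time \<omega> m \<and> ev_time \<omega> m \<le> t) \<longleftrightarrow> m \<in> set l)
        \<and> length l = length w \<and> (\<forall>i<length w. snd (fst \<omega> (l ! i)) = w ! i)
     else w = [])"
proof (cases "finite {m. s < ev_time \<omega> m \<and> ev_time \<omega> m \<le> t}")
  case True
  let ?A = "{m. s < ev_time \<omega> m \<and> ev_time \<omega> m \<le> t}"
  have 1: "sorted_list_of_set ?A = l" if "sorted_wrt (<) l" "\<forall>m. (s < ev_time \<omega> m \<and> ev_time \<omega> m \<le> t) \<longleftrightarrow> m \<in> set l" for l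
    using that by (intro sorted_list_of_set_eqI) auto
  have "ev_word \<omega> s t = w \<longleftrightarrow> (\<exists>l. l = sorted_list_of_set ?A \<and> length l = length w \<and> (\<forall>i<length w. snd (fst \<omega> (l ! i)) = w ! i))"
    unfolding ev_word_def by (auto simp: list_eq_iff_nth_eq[where ys=w])
  also have "\<dots> \<longleftrightarrow> (\<exists>l. sorted_wrt (<) l \<and> (\<forall>m. (s < ev_time \<omega> m \<and> ev_time \<omega> m \<le> t) \<longleftrightarrow> m \<in> set l)
        \<and> length l = length w \<and> (\<forall>i<length w. snd (fst \<omega> (l ! i)) = w ! i))"
    using 1 True by (intro ex_cong1) (auto simp: strict_sorted_list_of_set)
  finally show ?thesis using True by simp
qed (auto simp: ev_word_def sorted_list_of_set.fold_insort_key.infinite)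

lemma finite_int_iff: "finite (A :: int set) \<longleftrightarrow> (\<exists>N. \<forall>m. m \<in> A \<longrightarrow> \<bar>m\<bar> \<le> N)"
proof
  assume "finite A"
  then show "\<exists>N. \<forall>m. m \<in> A \<longrightarrow> \<bar>m\<bar> \<le> N"
    by (intro exI[of _ "Max (insert 0 (abs ` A))"]) auto
next
  assume "\<exists>N. \<forall>m. m \<in> A \<longrightarrow> \<bar>m\<bar> \<le> N"
  then obtain N where "A \<subseteq> {-N..N}" by (force simp: abs_le_iff)
  then show "finite A" by (rule finite_subset) simp
qed

lemma finite_events_measurable[measurable]:
  assumes [measurable]: "S \<in> borel_measurable (smg_space n \<mu>)"
  shows "Measurable.pred (smg_space n \<mu>) (\<lambda>\<omega>. finite {m. S \<omega> < ev_time \<omega> m \<and> ev_time \<omega> m \<le> t})"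
  unfolding finite_int_iff mem_Collect_eq by measurable

lemma ev_word_measurable[measurable]:
  assumes [measurable]: "S \<in> borel_measurable (smg_space n \<mu>)"
  shows "(\<lambda>\<omega>. ev_word \<omega> (S \<omega>) t) \<in> measurable (smg_space n \<mu>) (count_space UNIV)"
proof (subst measurable_count_space_eq_countable)
  have "Measurable.pred (smg_space n \<mu>) (\<lambda>\<omega>. ev_word \<omega> (S \<omega>) t = w)" for w
    unfolding ev_word_eq_iff by measurable
  then show "(\<lambda>\<omega>. ev_word \<omega> (S \<omega>) t) \<in> space (smg_space n \<mu>) \<rightarrow> UNIV \<and>
     (\<forall>w\<in>UNIV. (\<lambda>\<omega>. ev_word \<omega> (S \<omega>) t) -` {w} \<inter> space (smg_space n \<mu>) \<in> sets (smg_space n \<mu>))"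
    by (auto simp: pred_def vimage_def)
qed simp

theorem ev_word_law:
  assumes dec: "\<And>q. q < m \<Longrightarrow> c (Suc q) \<le> c q" and z: "z \<le> m" "c z = 0"
  shows "emeasure (smg_space n \<mu>)
      {\<omega>. (\<forall>q<m. ev_word \<omega> (c (Suc q)) (c q) = w q) \<and> (\<forall>i\<in>{1..k}. snd \<omega> i = u i)}
    = ennreal ((\<Prod>q<m. word_prob (c q - c (Suc q)) (w q)) * (\<Prod>i\<in>{1..k}. pmf slot_pmf (u i)))"
proof -
  let ?E = "{\<omega>. (\<forall>q<m. ev_word \<omega> (c (Suc q)) (c q) = w q) \<and> (\<forall>i\<in>{1..k}. snd \<omega> i = u i)}"
  define sa where "sa q = c (z - q)" for q
  define wa where "wa q = w (z - Suc q)" for q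
  define sb where "sb q = - c (z + q)" for q
  define wb where "wb q = rev (w (z + q))" for q
  let ?A = "{a. \<forall>q<z. word_in a (sa q) (sa (Suc q)) = wa q}"
  let ?B = "{b. \<forall>q<m - z. word_in b (sb q) (sb (Suc q)) = wb q}"
  let ?C = "{v. \<forall>i\<in>{1..k}. v i = u i}"
  have E[measurable]: "?E \<in> sets (smg_space n \<mu>)"
  proof -
    have "{\<omega> \<in> space (smg_space n \<mu>). (\<forall>q<m. ev_word \<omega> (c (Suc q)) (c q) = w q) \<and> (\<forall>i\<in>{1..k}. snd \<omega> i = u i)}
      \<in> sets (smg_space n \<mu>)" by measurable
    then show ?thesis by simp
  qed
  have AB[measurable]: "?A \<in> sets seq.S" "?B \<in> sets seq.S"
  proof -
    have "{a \<in> space seq.S. \<forall>q<z. word_in a (sa q) (sa (Suc q)) = wa q} \<in> sets seq.S"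
      "{a \<in> space seq.S. \<forall>q<m - z. word_in a (sb q) (sb (Suc q)) = wb q} \<in> sets seq.S" by measurable
    then show "?A \<in> sets seq.S" "?B \<in> sets seq.S" by simp_all
  qed
  have C[measurable]: "?C \<in> sets slotsM"
  proof -
    have "{v \<in> space slotsM. \<forall>i\<in>{1..k}. v i = u i} \<in> sets slotsM" by measurable
    then show ?thesis by (simp add: space_PiM)
  qed
  have mono: "c q' \<le> c q" if "q \<le> q'" "q' \<le> m" for q q'
    using that
  proof (induction q' rule: dec_induct)
    case (step j)
    then show ?case using dec[of j] by simp
  qed simp
  have pos: "0 \<le> c q" if "q \<le> z" for q using mono[of q z] that z by simp
  have neg: "c q \<le> 0" if "z \<le> q" "q \<le> m" for q using mono[of z q] that z by simp
  have AEp: "AE p in (seq.S \<Otimes>\<^sub>M seq.S) \<Otimes>\<^sub>M slotsM. good_seq (fst (fst p)) \<and>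
      (good_seq (snd (fst p)) \<and> (\<forall>q i. psum (snd (fst p)) (Suc i) \<noteq> - c q)) \<and> True"
  proof (rule AE_halves)
    have "AE b in seq.S. \<forall>q i. psum b (Suc i) \<noteq> - c q"
      using AE_psum_neq by (simp add: AE_all_countable)
    with AE_good_seq show "AE b in seq.S. good_seq b \<and> (\<forall>q i. psum b (Suc i) \<noteq> - c q)"
      by eventually_elim auto
  qed (simp_all add: AE_good_seq)
  have "emeasure (smg_space n \<mu>) ?E = emeasure ((seq.S \<Otimes>\<^sub>M seq.S) \<Otimes>\<^sub>M slotsM)
     (mk_omega -` ?E \<inter> space ((seq.S \<Otimes>\<^sub>M seq.S) \<Otimes>\<^sub>M slotsM))"
    using emeasure_distr[OF mk_omega_measurable E] by (simp only: distr_mk_omega)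
  also have "\<dots> = emeasure ((seq.S \<Otimes>\<^sub>M seq.S) \<Otimes>\<^sub>M slotsM) ((?A \<times> ?B) \<times> ?C)"
  proof (rule emeasure_eq_AE)
    show "AE p in (seq.S \<Otimes>\<^sub>M seq.S) \<Otimes>\<^sub>M slotsM.
      p \<in> mk_omega -` ?E \<inter> space ((seq.S \<Otimes>\<^sub>M seq.S) \<Otimes>\<^sub>M slotsM) \<longleftrightarrow> p \<in> (?A \<times> ?B) \<times> ?C"
      using AEp
    proof eventually_elim
      case (elim p)
      obtain a b v where p: "p = ((a, b), v)" by (metis prod.exhaust)
      from elim p have a: "good_seq a" and b: "good_seq b" and ne: "\<And>q i. psum b (Suc i) \<noteq> - c q" by auto
      have "(\<forall>q<m. ev_word (mk_omega p) (c (Suc q)) (c q) = w q)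
        \<longleftrightarrow> (\<forall>q<z. ev_word (mk_omega p) (c (Suc q)) (c q) = w q) \<and> (\<forall>q\<in>{z..<m}. ev_word (mk_omega p) (c (Suc q)) (c q) = w q)"
        using z(1) by (metis atLeastLessThan_iff leI order_less_le_trans)
      also have "(\<forall>q<z. ev_word (mk_omega p) (c (Suc q)) (c q) = w q) \<longleftrightarrow> a \<in> ?A"
      proof -
        have *: "ev_word (mk_omega p) (c (Suc q)) (c q) = word_in a (c (Suc q)) (c q)" if "q < z" for q
          unfolding p using that z(1) by (intro ev_word_pos a b pos dec) auto
        have "(\<forall>q<z. word_in a (c (Suc q)) (c q) = w q) \<longleftrightarrow>
          (\<forall>q<z. word_in a (c (Suc (z - Suc q))) (c (z - Suc q)) = w (z - Suc q))"
        proof safe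
          fix q assume H: "\<forall>q<z. word_in a (c (Suc (z - Suc q))) (c (z - Suc q)) = w (z - Suc q)" and q: "q < z"
          from H[rule_format, of "z - Suc q"] q show "word_in a (c (Suc q)) (c q) = w q" by (simp add: Suc_diff_Suc)
        qed auto
        also have "\<dots> \<longleftrightarrow> a \<in> ?A" by (auto simp: sa_def wa_def Suc_diff_Suc)
        finally show ?thesis using * by simp
      qed
      also have "(\<forall>q\<in>{z..<m}. ev_word (mk_omega p) (c (Suc q)) (c q) = w q) \<longleftrightarrow> b \<in> ?B"
      proof -
        have *: "ev_word (mk_omega p) (c (Suc q)) (c q) = rev (word_in b (- c q) (- c (Suc q)))" if "q \<in> {z..<m}" for q
          unfolding p using that z(1) by (intro ev_word_neg a b neg dec ne) auto
        have "(\<forall>q\<in>{z..<m}. rev (word_in b (- c q) (- c (Suc q))) = w q) \<longleftrightarrow>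
          (\<forall>q<m - z. rev (word_in b (- c (z + q)) (- c (Suc (z + q)))) = w (z + q))"
        proof safe
          fix q assume H: "\<forall>q<m - z. rev (word_in b (- c (z + q)) (- c (Suc (z + q)))) = w (z + q)" and q: "q \<in> {z..<m}"
          have "q - z < m - z" using q by auto
          from H[rule_format, OF this] q show "rev (word_in b (- c q) (- c (Suc q))) = w q" by simp
        qed auto
        also have "\<dots> \<longleftrightarrow> b \<in> ?B" by (auto simp: sb_def wb_def rev_swap)
        finally show ?thesis using * by simp
      qed
      finally show ?case by (auto simp: p mk_omega_def space_pair_measure space_PiM)
    qed
  qed (intro measurable_sets[OF mk_omega_measurable] E pair_measureI AB C)+
  also have "\<dots> = emeasure seq.S ?A * emeasure seq.S ?B * emeasure slotsM ?C"
    by (simp only: slots.P.emeasure_pair_measure_Times[OF pair_measureI[OF AB] C]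
        seq.P.emeasure_pair_measure_Times[OF AB])
  also have "emeasure seq.S ?A = ennreal (\<Prod>q<z. word_prob (sa (Suc q) - sa q) (wa q))"
    using z by (intro word_in_law) (auto simp: sa_def intro!: mono)
  also have "emeasure seq.S ?B = ennreal (\<Prod>q<m - z. word_prob (sb (Suc q) - sb q) (wb q))"
    using z by (intro word_in_law) (auto simp: sb_def intro!: mono)
  also have "emeasure slotsM ?C = ennreal (\<Prod>i\<in>{1..k}. pmf slot_pmf (u i))"
    by (rule emeasure_slots)
  also have "(\<Prod>q<z. word_prob (sa (Suc q) - sa q) (wa q)) = (\<Prod>q<z. word_prob (c q - c (Suc q)) (w q))"
    by (rule prod.reindex_bij_witness[of _ "\<lambda>q. z - Suc q" "\<lambda>q. z - Suc q"])
      (auto simp: sa_def wa_def Suc_diff_Suc)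
  also have "(\<Prod>q<m - z. word_prob (sb (Suc q) - sb q) (wb q)) = (\<Prod>q\<in>{z..<m}. word_prob (c q - c (Suc q)) (w q))"
    by (rule prod.reindex_bij_witness[of _ "\<lambda>q. q - z" "\<lambda>q. z + q"])
      (auto simp: sb_def wb_def word_prob_rev)
  finally have "emeasure (smg_space n \<mu>) ?E = ennreal (((\<Prod>q<z. word_prob (c q - c (Suc q)) (w q))
      * (\<Prod>q\<in>{z..<m}. word_prob (c q - c (Suc q)) (w q))) * (\<Prod>i\<in>{1..k}. pmf slot_pmf (u i)))"
    by (simp add: ennreal_mult' ennreal_mult'' word_prob_nonneg prod_nonneg)
  also have "(\<Prod>q<z. word_prob (c q - c (Suc q)) (w q)) * (\<Prod>q\<in>{z..<m}. word_prob (c q - c (Suc q)) (w q))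
      = (\<Prod>q<m. word_prob (c q - c (Suc q)) (w q))"
    using z(1) by (subst prod.union_disjoint[symmetric]) (auto intro!: prod.cong)
  finally show ?thesis .
qed

end

section \<open>Coalescence under a random word\<close>

lemma measure_bind_pmf_eq:
  "measure_pmf.prob (bind_pmf M f) X = measure_pmf.expectation M (\<lambda>x. measure_pmf.prob (f x) X)"
proof -
  have int: "integrable (measure_pmf M) (\<lambda>x. measure_pmf.prob (f x) X)"
    by (rule measure_pmf.integrable_const_bound[where B=1]) auto
  have "ennreal (measure_pmf.prob (bind_pmf M f) X) = emeasure (measure_pmf (bind_pmf M f)) X"
    by (simp only: measure_pmf.emeasure_eq_measure)
  also have "\<dots> = (\<integral>\<^sup>+x. ennreal (measure_pmf.prob (f x) X) \<partial>M)"
    by (simp add: measure_pmf.emeasure_eq_measure[symmetric])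
  also have "\<dots> = ennreal (measure_pmf.expectation M (\<lambda>x. measure_pmf.prob (f x) X))"
    by (rule nn_integral_eq_integral[OF int]) simp
  finally show ?thesis by (subst (asm) ennreal_inj) (auto intro!: integral_nonneg_AE)
qed

lemma measure_bind_pmf_cases:
  assumes "\<And>x. x \<in> set_pmf M \<Longrightarrow> measure_pmf.prob (f x) X = (if x \<in> A then a else 0) + (if x \<in> B then b else 0)"
  shows "measure_pmf.prob (bind_pmf M f) X = a * measure_pmf.prob M A + b * measure_pmf.prob M B"
proof -
  have "measure_pmf.prob (bind_pmf M f) X = measure_pmf.expectation M (\<lambda>x. a * indicator A x + b * indicator B x)"
    unfolding measure_bind_pmf_eq
    by (rule integral_cong_AE) (auto simp: AE_measure_pmf_iff assms indicator_def)
  also have "\<dots> = a * measure_pmf.prob M A + b * measure_pmf.prob M B"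
  proof -
    have "integrable (measure_pmf M) (indicator C :: _ \<Rightarrow> real)" for C
      by (rule measure_pmf.integrable_const_bound[where B=1]) auto
    then show ?thesis by (subst Bochner_Integration.integral_add) auto
  qed
  finally show ?thesis .
qed

lemma expectation_poisson_power:
  fixes x r :: real
  assumes r: "0 < r"
  shows "measure_pmf.expectation (poisson_pmf r) (\<lambda>m. x ^ m) = exp (r * (x - 1))"
    and "integrable (measure_pmf (poisson_pmf r)) (\<lambda>m. x ^ m)"
proof -
  have s: "(\<lambda>m. (r * x) ^ m / fact m * exp (- r)) sums (exp (r * x) * exp (- r))"
    using exp_converges[of "r * x"] by (intro sums_mult2) (simp add: divide_inverse mult.commute)
  have eq: "pmf (poisson_pmf r) m *\<^sub>R x ^ m = (r * x) ^ m / fact m * exp (- r)" for m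
    using r by (simp add: power_mult_distrib)
  have int: "integrable (count_space UNIV) (\<lambda>m. pmf (poisson_pmf r) m *\<^sub>R x ^ m)"
  proof (subst integrable_count_space_nat_iff)
    have "summable (\<lambda>m. (r * \<bar>x\<bar>) ^ m / fact m * exp (- r))"
      using summable_exp[of "r * \<bar>x\<bar>"] by (intro summable_mult2) (simp add: divide_inverse mult.commute)
    then show "summable (\<lambda>m. norm (pmf (poisson_pmf r) m *\<^sub>R x ^ m))"
      unfolding eq using r by (simp add: abs_mult power_abs)
  qed
  show "integrable (measure_pmf (poisson_pmf r)) (\<lambda>m. x ^ m)"
    unfolding measure_pmf_eq_density using int by (subst integrable_density) auto
  have "measure_pmf.expectation (poisson_pmf r) (\<lambda>m. x ^ m) = (\<integral>m. pmf (poisson_pmf r) m *\<^sub>R x ^ m \<partial>count_space UNIV)"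
    unfolding measure_pmf_eq_density by (subst integral_density) auto
  also have "\<dots> = exp (r * x) * exp (- r)"
    using sums_unique2[OF sums_integral_count_space_nat[OF int]] s unfolding eq by simp
  finally show "measure_pmf.expectation (poisson_pmf r) (\<lambda>m. x ^ m) = exp (r * (x - 1))"
    by (simp add: mult_exp_exp algebra_simps)
qed

lemma pmf_replicate_pmf:
  "pmf (replicate_pmf m p) w = (if length w = m then prod_list (map (pmf p) w) else 0)"
proof (induction m arbitrary: w)
  case 0
  then show ?case by (auto simp: pmf_return)
next
  case (Suc m)
  have "replicate_pmf (Suc m) p = map_pmf (\<lambda>(x, xs). x # xs) (pair_pmf p (replicate_pmf m p))"
    by (simp add: map_pmf_def pair_pmf_def bind_assoc_pmf bind_return_pmf)
  moreover have "pmf (map_pmf (\<lambda>(x, xs). x # xs) (pair_pmf p (replicate_pmf m p))) (x # xs)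
      = pmf (pair_pmf p (replicate_pmf m p)) (x, xs)" for x xs
    using pmf_map_inj'[of "\<lambda>(x, xs). x # xs" "pair_pmf p (replicate_pmf m p)" "(x, xs)"]
    by (simp add: inj_on_def)
  moreover have "pmf (replicate_pmf (Suc m) p) [] = 0"
    by (auto simp: set_pmf_eq[symmetric] pmf_eq_0_set_pmf)
  ultimately show ?case by (cases w) (auto simp: pmf_pair Suc.IH)
qed

definition merges_only :: "('x \<Rightarrow> 'y) \<Rightarrow> 'x set \<Rightarrow> 'x \<Rightarrow> 'x \<Rightarrow> bool" where
  "merges_only f A a b \<longleftrightarrow> (\<forall>x\<in>A. \<forall>y\<in>A. f x = f y \<longleftrightarrow> x = y \<or> x = a \<and> y = b \<or> x = b \<and> y = a)"

lemma merges_only_comp: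
  assumes "a \<in> A" "b \<in> A" "a \<noteq> b"
  shows "merges_only (g \<circ> f) A a b \<longleftrightarrow>
    (inj_on f A \<and> merges_only g (f ` A) (f a) (f b)) \<or> (merges_only f A a b \<and> inj_on g (f ` A))"
proof
  assume m: "merges_only (g \<circ> f) A a b"
  show "(inj_on f A \<and> merges_only g (f ` A) (f a) (f b)) \<or> (merges_only f A a b \<and> inj_on g (f ` A))"
  proof (cases "inj_on f A")
    case True
    have "merges_only g (f ` A) (f a) (f b)"
      unfolding merges_only_def
    proof (intro ballI)
      fix u v assume "u \<in> f ` A" "v \<in> f ` A"
      then obtain x y where xy: "x \<in> A" "y \<in> A" "u = f x" "v = f y" by auto
      have "g u = g v \<longleftrightarrow> x = y \<or> x = a \<and> y = b \<or> x = b \<and> y = a" using m xy by (auto simp: merges_only_def)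
      also have "\<dots> \<longleftrightarrow> u = v \<or> u = f a \<and> v = f b \<or> u = f b \<and> v = f a"
        using True xy assms by (auto simp: inj_on_eq_iff)
      finally show "g u = g v \<longleftrightarrow> u = v \<or> u = f a \<and> v = f b \<or> u = f b \<and> v = f a" .
    qed
    with True show ?thesis by blast
  next
    case False
    then obtain x y where "x \<in> A" "y \<in> A" "x \<noteq> y" "f x = f y" by (auto simp: inj_on_def)
    with m have "x = a \<and> y = b \<or> x = b \<and> y = a" unfolding merges_only_def comp_def by metis
    with \<open>f x = f y\<close> have fab: "f a = f b" by auto
    have "merges_only f A a b"
      unfolding merges_only_def using m fab unfolding merges_only_def comp_def by metis
    moreover have "inj_on g (f ` A)"
    proof (rule inj_onI)
      fix u v assume "u \<in> f ` A" "v \<in> f ` A" "g u = g v"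
      then obtain x y where "x \<in> A" "y \<in> A" "u = f x" "v = f y" "g (f x) = g (f y)" by auto
      then show "u = v" using m fab unfolding merges_only_def comp_def by metis
    qed
    ultimately show ?thesis by blast
  qed
next
  assume "(inj_on f A \<and> merges_only g (f ` A) (f a) (f b)) \<or> (merges_only f A a b \<and> inj_on g (f ` A))"
  then show "merges_only (g \<circ> f) A a b"
  proof
    assume *: "inj_on f A \<and> merges_only g (f ` A) (f a) (f b)"
    show ?thesis unfolding merges_only_def
    proof (intro ballI)
      fix x y assume xy: "x \<in> A" "y \<in> A"
      have "(g \<circ> f) x = (g \<circ> f) y \<longleftrightarrow> f x = f y \<or> f x = f a \<and> f y = f b \<or> f x = f b \<and> f y = f a"
        using * xy by (auto simp: merges_only_def)
      also have "\<dots> \<longleftrightarrow> x = y \<or> x = a \<and> y = b \<or> x = b \<and> y = a"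
        using * xy assms by (auto simp: inj_on_eq_iff)
      finally show "(g \<circ> f) x = (g \<circ> f) y \<longleftrightarrow> x = y \<or> x = a \<and> y = b \<or> x = b \<and> y = a" .
    qed
  next
    assume "merges_only f A a b \<and> inj_on g (f ` A)"
    then show ?thesis by (auto simp: merges_only_def inj_on_eq_iff)
  qed
qed

lemma card_merges_only:
  assumes m: "merges_only f A a b" and "finite A" "a \<in> A" "b \<in> A" "a \<noteq> b"
  shows "card (f ` A) = card A - 1"
proof -
  have "f a = f b" using m assms by (auto simp: merges_only_def)
  then have "f ` A = f ` (A - {b})"
    using assms(3-5) by (metis image_insert insertE insert_Diff insert_absorb insert_iff imageI)
  moreover have "inj_on f (A - {b})" using m by (auto simp: merges_only_def inj_on_def)
  ultimately show ?thesis using assms by (simp add: card_image)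
qed

lemma inj_on_comp_iff: "inj_on (g \<circ> f) A \<longleftrightarrow> inj_on f A \<and> inj_on g (f ` A)"
  by (metis comp_inj_on inj_on_imageI inj_on_imageI2)

context moran begin

definition pair_rate :: "real \<Rightarrow> real" where
  "pair_rate x = x * (x - 1) / (real n * (real n - 1))"

lemma pair_rate_diff: "pair_rate x - pair_rate (x - 1) = 2 * (x - 1) / (real n * (real n - 1))"
  by (simp add: pair_rate_def diff_divide_distrib[symmetric] algebra_simps)

lemma n_choose_2: "real (n choose 2) = real n * (real n - 1) / 2"
  using n2 by (simp add: choose_two real_of_nat_div of_nat_diff)

abbreviation act :: "(nat \<times> nat) list \<Rightarrow> nat \<Rightarrow> nat" where
  "act w \<equiv> foldr replace_slot w"

lemma prob_slot_pairs:
  assumes "B \<subseteq> slot_pairs" "\<And>p. p \<in> slot_pairs \<Longrightarrow> p \<in> X \<longleftrightarrow> p \<in> B"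
  shows "measure_pmf.prob pair_pmf_n X = real (card B) / (real n * (real n - 1))"
proof -
  have "slot_pairs \<inter> X = B" using assms by blast
  then show ?thesis
    using measure_pmf_of_set[OF slot_pairs_nonempty finite_slot_pairs, of X] n2
    by (simp add: card_slot_pairs of_nat_diff)
qed

lemma prob_replace_inj:
  assumes A: "A \<subseteq> {..<n}"
  shows "measure_pmf.prob pair_pmf_n {p. inj_on (replace_slot p) A} = 1 - pair_rate (card A)"
proof -
  have fin: "finite A" using A by (rule finite_subset) simp
  have eq: "inj_on (replace_slot p) A \<longleftrightarrow> \<not> (fst p \<in> A \<and> snd p \<in> A)" if "p \<in> slot_pairs" for p
    using that by (auto simp: inj_on_def replace_slot_def split: if_splits)
  define B where "B = (SIGMA d:A. A - {d})"
  have B: "B \<subseteq> slot_pairs" using A by (auto simp: B_def)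
  have "card B = card A * (card A - 1)" using fin by (simp add: B_def card_SigmaI)
  then have cB: "real (card B) = real (card A) * (real (card A) - 1)"
    by (cases "card A") (auto simp: algebra_simps)
  have "measure_pmf.prob pair_pmf_n {p. \<not> inj_on (replace_slot p) A} = real (card B) / (real n * (real n - 1))"
    by (rule prob_slot_pairs[OF B]) (auto simp: eq B_def)
  moreover have "measure_pmf.prob pair_pmf_n {p. inj_on (replace_slot p) A}
      = 1 - measure_pmf.prob pair_pmf_n {p. \<not> inj_on (replace_slot p) A}"
    using measure_pmf.prob_compl[of "{p. \<not> inj_on (replace_slot p) A}" pair_pmf_n]
    by (simp add: Collect_neg_eq[symmetric] Compl_eq_Diff_UNIV[symmetric])
  ultimately show ?thesis by (simp add: cB pair_rate_def)
qed

lemma prob_replace_merges: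
  assumes A: "A \<subseteq> {..<n}" and ab: "a \<in> A" "b \<in> A" "a \<noteq> b"
  shows "measure_pmf.prob pair_pmf_n {p. merges_only (replace_slot p) A a b} = 2 / (real n * (real n - 1))"
proof -
  have eq: "merges_only (replace_slot p) A a b \<longleftrightarrow> p \<in> {(a, b), (b, a)}" if p: "p \<in> slot_pairs" for p
  proof
    assume m: "merges_only (replace_slot p) A a b"
    have "replace_slot p a = replace_slot p b" using m ab by (auto simp: merges_only_def)
    then show "p \<in> {(a, b), (b, a)}" using ab p by (cases p) (auto simp: replace_slot_def split: if_splits)
  next
    assume "p \<in> {(a, b), (b, a)}"
    then show "merges_only (replace_slot p) A a b"
      using ab by (auto simp: merges_only_def replace_slot_def)
  qed
  have "measure_pmf.prob pair_pmf_n {p. merges_only (replace_slot p) A a b}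
      = real (card {(a, b), (b, a)}) / (real n * (real n - 1))"
    using A ab by (intro prob_slot_pairs) (auto simp: eq)
  then show ?thesis using ab by simp
qed

lemma act_range:
  assumes "set w \<subseteq> slot_pairs" "x < n"
  shows "act w x < n"
  using assms by (induction w) (auto simp: replace_slot_def)

lemma act_image_range:
  assumes "w \<in> set_pmf (replicate_pmf m pair_pmf_n)" "A \<subseteq> {..<n}"
  shows "act w ` A \<subseteq> {..<n}"
  using assms act_range[of w] finite_slot_pairs slot_pairs_nonempty
  by (auto simp: set_replicate_pmf subset_eq in_lists_conv_set)

lemma replicate_pmf_Suc_bind:
  "replicate_pmf (Suc m) p = bind_pmf (replicate_pmf m p) (\<lambda>xs. map_pmf (\<lambda>x. x # xs) p)"
  unfolding replicate_pmf.simps map_pmf_def by (rule bind_commute_pmf)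

lemma act_Cons: "act (x # xs) = replace_slot x \<circ> act xs"
  by (simp add: fun_eq_iff)

lemma prob_replicate_inj:
  assumes A: "A \<subseteq> {..<n}"
  shows "measure_pmf.prob (replicate_pmf m pair_pmf_n) {w. inj_on (act w) A} = (1 - pair_rate (card A)) ^ m"
proof (induction m)
  case 0
  then show ?case by (simp add: inj_on_def)
next
  case (Suc m)
  have "measure_pmf.prob (replicate_pmf (Suc m) pair_pmf_n) {w. inj_on (act w) A}
    = (1 - pair_rate (card A)) * measure_pmf.prob (replicate_pmf m pair_pmf_n) {w. inj_on (act w) A}
      + 0 * measure_pmf.prob (replicate_pmf m pair_pmf_n) {}"
    unfolding replicate_pmf_Suc_bind
  proof (rule measure_bind_pmf_cases)
    fix xs assume xs: "xs \<in> set_pmf (replicate_pmf m pair_pmf_n)"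
    have "measure_pmf.prob (map_pmf (\<lambda>x. x # xs) pair_pmf_n) {w. inj_on (act w) A}
        = measure_pmf.prob pair_pmf_n {x. inj_on (act xs) A \<and> inj_on (replace_slot x) (act xs ` A)}"
      by (simp add: vimage_def act_Cons inj_on_comp_iff del: foldr.simps)
    also have "\<dots> = (if inj_on (act xs) A then 1 - pair_rate (card A) else 0)"
      using prob_replace_inj[OF act_image_range[OF xs A]] by (auto simp: card_image)
    finally show "measure_pmf.prob (map_pmf (\<lambda>x. x # xs) pair_pmf_n) {w. inj_on (act w) A}
      = (if xs \<in> {w. inj_on (act w) A} then 1 - pair_rate (card A) else 0) + (if xs \<in> {} then 0 else 0)"
      by simp
  qed
  then show ?case by (simp add: Suc.IH)
qed

lemma prob_replicate_merges:
  assumes A: "A \<subseteq> {..<n}" and ab: "a \<in> A" "b \<in> A" "a \<noteq> b"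
  shows "measure_pmf.prob (replicate_pmf m pair_pmf_n) {w. merges_only (act w) A a b}
    = ((1 - pair_rate (real (card A) - 1)) ^ m - (1 - pair_rate (card A)) ^ m) / (real (card A) - 1)"
proof (induction m)
  case 0
  have "\<not> merges_only (act []) A a b" using ab by (auto simp: merges_only_def)
  then show ?case by (simp add: indicator_def)
next
  case (Suc m)
  have fin: "finite A" using A by (rule finite_subset) simp
  have c2: "2 \<le> card A" using card_mono[of A "{a, b}"] ab fin by auto
  let ?I = "{w. inj_on (act w) A}" and ?M = "{w. merges_only (act w) A a b}"
  let ?R = "replicate_pmf m pair_pmf_n"
  have disj: "\<not> (inj_on (act w) A \<and> merges_only (act w) A a b)" for w
    using ab by (auto simp: inj_on_def merges_only_def)
  have "measure_pmf.prob (replicate_pmf (Suc m) pair_pmf_n) ?M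
    = 2 / (real n * (real n - 1)) * measure_pmf.prob ?R ?I
      + (1 - pair_rate (real (card A) - 1)) * measure_pmf.prob ?R ?M"
    unfolding replicate_pmf_Suc_bind
  proof (rule measure_bind_pmf_cases)
    fix xs assume xs: "xs \<in> set_pmf ?R"
    note ran = act_image_range[OF xs A]
    have "measure_pmf.prob (map_pmf (\<lambda>x. x # xs) pair_pmf_n) ?M
        = measure_pmf.prob pair_pmf_n {x. (inj_on (act xs) A \<and> merges_only (replace_slot x) (act xs ` A) (act xs a) (act xs b))
             \<or> (merges_only (act xs) A a b \<and> inj_on (replace_slot x) (act xs ` A))}"
      by (simp add: vimage_def act_Cons merges_only_comp[OF ab] del: foldr.simps)
    also have "\<dots> = (if xs \<in> ?I then 2 / (real n * (real n - 1)) else 0) + (if xs \<in> ?M then 1 - pair_rate (real (card A) - 1) else 0)"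
    proof -
      consider "inj_on (act xs) A" "\<not> merges_only (act xs) A a b" | "\<not> inj_on (act xs) A" "merges_only (act xs) A a b"
        | "\<not> inj_on (act xs) A" "\<not> merges_only (act xs) A a b" using disj by blast
      then show ?thesis
      proof cases
        case 1
        then have "act xs a \<noteq> act xs b" using ab by (auto simp: inj_on_eq_iff)
        then show ?thesis using 1 prob_replace_merges[OF ran, of "act xs a" "act xs b"] ab by simp
      next
        case 2
        then show ?thesis using prob_replace_inj[OF ran] card_merges_only[OF 2(2) fin ab] c2
          by (simp add: of_nat_diff)
      qed simp
    qed
    finally show "measure_pmf.prob (map_pmf (\<lambda>x. x # xs) pair_pmf_n) ?M
      = (if xs \<in> ?I then 2 / (real n * (real n - 1)) else 0) + (if xs \<in> ?M then 1 - pair_rate (real (card A) - 1) else 0)" .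
  qed
  also have "\<dots> = 2 / (real n * (real n - 1)) * (1 - pair_rate (card A)) ^ m
      + (1 - pair_rate (real (card A) - 1)) * (((1 - pair_rate (real (card A) - 1)) ^ m - (1 - pair_rate (card A)) ^ m) / (real (card A) - 1))"
    by (simp only: Suc.IH prob_replicate_inj[OF A])
  also have "2 / (real n * (real n - 1)) = (pair_rate (card A) - pair_rate (real (card A) - 1)) / (real (card A) - 1)"
  proof -
    have nz: "real (card A) - 1 \<noteq> 0" using c2 by simp
    have "2 * X / N / X = 2 / N" if "X \<noteq> 0" for X N :: real using that by simp
    from this[OF nz] show ?thesis by (simp only: pair_rate_diff)
  qed
  finally show ?case by (simp add: add_divide_distrib[symmetric] algebra_simps)
qed

definition word_pmf :: "real \<Rightarrow> (nat \<times> nat) list pmf" where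
  "word_pmf d = bind_pmf (poisson_pmf (\<mu> * d)) (\<lambda>m. replicate_pmf m pair_pmf_n)"

lemma pmf_word_pmf:
  assumes d: "0 < d"
  shows "pmf (word_pmf d) w = word_prob d w"
proof -
  have r: "0 < \<mu> * d" using mu d by simp
  have "pmf (word_pmf d) w = measure_pmf.expectation (poisson_pmf (\<mu> * d))
      (\<lambda>m. prod_list (map (pmf pair_pmf_n) w) * indicator {length w} m)"
    unfolding word_pmf_def pmf_bind pmf_replicate_pmf
    by (rule Bochner_Integration.integral_cong) (auto simp: indicator_def)
  also have "\<dots> = prod_list (map (pmf pair_pmf_n) w) * pmf (poisson_pmf (\<mu> * d)) (length w)"
    by (simp add: measure_pmf_single)
  finally show ?thesis using r d by (simp add: word_prob_def)
qed

lemma set_word_pmf: "w \<in> set_pmf (word_pmf d) \<Longrightarrow> set w \<subseteq> slot_pairs"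
  using finite_slot_pairs slot_pairs_nonempty by (auto simp: word_pmf_def set_replicate_pmf in_lists_conv_set)

lemma prob_word_inj:
  assumes d: "0 < d" and A: "A \<subseteq> {..<n}"
  shows "measure_pmf.prob (word_pmf d) {w. inj_on (act w) A} = exp (- \<mu> * pair_rate (card A) * d)"
proof -
  have r: "0 < \<mu> * d" using mu d by simp
  show ?thesis
    unfolding word_pmf_def measure_bind_pmf_eq prob_replicate_inj[OF A] expectation_poisson_power(1)[OF r]
    by (simp add: algebra_simps)
qed

lemma prob_word_merges:
  assumes d: "0 < d" and A: "A \<subseteq> {..<n}" and ab: "a \<in> A" "b \<in> A" "a \<noteq> b"
  shows "measure_pmf.prob (word_pmf d) {w. merges_only (act w) A a b}
    = (exp (- \<mu> * pair_rate (real (card A) - 1) * d) - exp (- \<mu> * pair_rate (card A) * d)) / (real (card A) - 1)"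
proof -
  have r: "0 < \<mu> * d" using mu d by simp
  show ?thesis
    unfolding word_pmf_def measure_bind_pmf_eq prob_replicate_merges[OF A ab]
    using expectation_poisson_power[OF r]
    by (simp add: algebra_simps)
qed

end

primrec seq_pmf :: "(nat \<Rightarrow> 'z pmf) \<Rightarrow> nat \<Rightarrow> nat \<Rightarrow> 'z list pmf" where
  "seq_pmf p 0 q = return_pmf []"
| "seq_pmf p (Suc r) q = bind_pmf (p q) (\<lambda>z. map_pmf (\<lambda>zs. z # zs) (seq_pmf p r (Suc q)))"

lemma pmf_seq_pmf:
  "pmf (seq_pmf p r q) zs = (if length zs = r then \<Prod>i<r. pmf (p (q + i)) (zs ! i) else 0)"
proof (induction r arbitrary: q zs)
  case 0
  then show ?case by (auto simp: pmf_return)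
next
  case (Suc r)
  have "seq_pmf p (Suc r) q = map_pmf (\<lambda>(x, xs). x # xs) (pair_pmf (p q) (seq_pmf p r (Suc q)))"
    by (simp add: map_pmf_def pair_pmf_def bind_assoc_pmf bind_return_pmf)
  moreover have "pmf (map_pmf (\<lambda>(x, xs). x # xs) (pair_pmf (p q) (seq_pmf p r (Suc q)))) (x # xs)
      = pmf (pair_pmf (p q) (seq_pmf p r (Suc q))) (x, xs)" for x xs
    using pmf_map_inj'[of "\<lambda>(x, xs). x # xs" "pair_pmf (p q) (seq_pmf p r (Suc q))" "(x, xs)"]
    by (simp add: inj_on_def)
  moreover have "pmf (seq_pmf p (Suc r) q) [] = 0"
    by (auto simp: set_pmf_eq[symmetric] pmf_eq_0_set_pmf)
  ultimately show ?case
    by (cases zs) (auto simp: pmf_pair Suc.IH prod.lessThan_Suc_shift simp del: seq_pmf.simps prod.lessThan_Suc)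
qed

context moran begin

theorem step_law:
  assumes dec: "\<And>q. q < m \<Longrightarrow> c (Suc q) < c q" and z: "z \<le> m" "c z = 0"
    and K: "K \<subseteq> {..<m}" and bij: "bij_betw sample_at K {1..k}"
  defines "Z \<equiv> \<lambda>q \<omega>. (ev_word \<omega> (c (Suc q)) (c q), if q \<in> K then snd \<omega> (sample_at q) else 0)"
    and "step_pmf \<equiv> \<lambda>q. pair_pmf (word_pmf (c q - c (Suc q))) (if q \<in> K then slot_pmf else return_pmf 0)"
  shows "smg.prob {\<omega>. map (\<lambda>q. Z q \<omega>) [0..<m] \<in> S} = measure_pmf.prob (seq_pmf step_pmf m 0) S"
proof -
  define L where "L \<omega> = map (\<lambda>q. Z q \<omega>) [0..<m]" for \<omega>
  have Lm[measurable]: "L \<in> measurable (smg_space n \<mu>) (count_space UNIV)"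
  proof (subst measurable_count_space_eq_countable, safe)
    fix zs :: "((nat \<times> nat) list \<times> nat) list"
    have "L \<omega> = zs \<longleftrightarrow> length zs = m \<and> (\<forall>q<m. ev_word \<omega> (c (Suc q)) (c q) = fst (zs ! q)
        \<and> (q \<in> K \<longrightarrow> snd \<omega> (sample_at q) = snd (zs ! q)) \<and> (q \<notin> K \<longrightarrow> 0 = snd (zs ! q)))" for \<omega>
      unfolding L_def by (auto simp: list_eq_iff_nth_eq[where ys=zs] Z_def prod_eq_iff)
    then have "L -` {zs} \<inter> space (smg_space n \<mu>)
        = {\<omega> \<in> space (smg_space n \<mu>). length zs = m \<and> (\<forall>q<m. ev_word \<omega> (c (Suc q)) (c q) = fst (zs ! q)
        \<and> (q \<in> K \<longrightarrow> snd \<omega> (sample_at q) = snd (zs ! q)) \<and> (q \<notin> K \<longrightarrow> 0 = snd (zs ! q)))}"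
      by blast
    also have "\<dots> \<in> smg.events" by measurable
    finally show "L -` {zs} \<inter> space (smg_space n \<mu>) \<in> smg.events" .
  qed auto
  have sing: "emeasure (smg_space n \<mu>) {\<omega>. L \<omega> = zs} = ennreal (pmf (seq_pmf step_pmf m 0) zs)" for zs
  proof (cases "length zs = m \<and> (\<forall>q<m. q \<notin> K \<longrightarrow> snd (zs ! q) = 0)")
    case True
    define u where "u i = snd (zs ! (the_inv_into K sample_at i))" for i
    have inj: "inj_on sample_at K" and im: "sample_at ` K = {1..k}" using bij by (auto simp: bij_betw_def)
    have "L \<omega> = zs \<longleftrightarrow> (\<forall>q<m. ev_word \<omega> (c (Suc q)) (c q) = fst (zs ! q)) \<and> (\<forall>i\<in>{1..k}. snd \<omega> i = u i)" for \<omega>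
    proof -
      have "L \<omega> = zs \<longleftrightarrow> (\<forall>q<m. Z q \<omega> = zs ! q)"
        unfolding L_def using True by (auto simp: list_eq_iff_nth_eq[where ys=zs])
      also have "\<dots> \<longleftrightarrow> (\<forall>q<m. ev_word \<omega> (c (Suc q)) (c q) = fst (zs ! q)) \<and> (\<forall>q\<in>K. snd \<omega> (sample_at q) = snd (zs ! q))"
        using True K by (auto simp: Z_def prod_eq_iff)
      also have "(\<forall>q\<in>K. snd \<omega> (sample_at q) = snd (zs ! q)) \<longleftrightarrow> (\<forall>i\<in>{1..k}. snd \<omega> i = u i)"
        unfolding im[symmetric] u_def using the_inv_into_f_f[OF inj] by auto
      finally show ?thesis .
    qed
    then have "emeasure (smg_space n \<mu>) {\<omega>. L \<omega> = zs}
      = ennreal ((\<Prod>q<m. word_prob (c q - c (Suc q)) (fst (zs ! q))) * (\<Prod>i\<in>{1..k}. pmf slot_pmf (u i)))"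
      using ev_word_law[of m c z "\<lambda>q. fst (zs ! q)" k u] dec z by (simp add: less_imp_le)
    also have "(\<Prod>i\<in>{1..k}. pmf slot_pmf (u i)) = (\<Prod>q\<in>K. pmf slot_pmf (snd (zs ! q)))"
      by (rule prod.reindex_bij_betw[OF bij, symmetric, THEN trans])
        (auto intro!: prod.cong simp: u_def the_inv_into_f_f[OF inj])
    also have "\<dots> = (\<Prod>q<m. if q \<in> K then pmf slot_pmf (snd (zs ! q)) else 1)"
      using K by (subst prod.inter_restrict[symmetric]) (auto simp: Int_absorb1)
    also have "(\<Prod>q<m. word_prob (c q - c (Suc q)) (fst (zs ! q))) * \<dots>
       = (\<Prod>q<m. pmf (step_pmf q) (zs ! q))"
      unfolding prod.distrib[symmetric]
    proof (rule prod.cong)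
      fix q assume "q \<in> {..<m}"
      then show "word_prob (c q - c (Suc q)) (fst (zs ! q)) * (if q \<in> K then pmf slot_pmf (snd (zs ! q)) else 1) = pmf (step_pmf q) (zs ! q)"
        using True dec[of q] by (cases "zs ! q") (auto simp: step_pmf_def pmf_pair pmf_word_pmf)
    qed simp
    finally show ?thesis using True by (simp add: pmf_seq_pmf)
  next
    case False
    have "L \<omega> \<noteq> zs" for \<omega> using False by (auto simp: L_def Z_def)
    moreover have "pmf (seq_pmf step_pmf m 0) zs = 0"
    proof (cases "length zs = m")
      case True
      with False obtain q where "q < m" "q \<notin> K" "snd (zs ! q) \<noteq> 0" by auto
      then have "pmf (step_pmf q) (zs ! q) = 0" by (cases "zs ! q") (auto simp: step_pmf_def pmf_pair pmf_return)
      with \<open>q < m\<close> True show ?thesis by (auto simp: pmf_seq_pmf)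
    qed (simp add: pmf_seq_pmf)
    ultimately show ?thesis by simp
  qed
  have "distr (smg_space n \<mu>) (count_space UNIV) L = measure_pmf (seq_pmf step_pmf m 0)"
  proof (rule measure_eqI_countable[where A=UNIV])
    fix zs :: "((nat \<times> nat) list \<times> nat) list"
    show "emeasure (distr (smg_space n \<mu>) (count_space UNIV) L) {zs} = emeasure (measure_pmf (seq_pmf step_pmf m 0)) {zs}"
      using sing[of zs] by (subst emeasure_distr) (auto simp: emeasure_pmf_single vimage_def)
  qed auto
  then have "measure_pmf.prob (seq_pmf step_pmf m 0) S = measure (distr (smg_space n \<mu>) (count_space UNIV) L) S"
    by simp
  also have "\<dots> = smg.prob {\<omega>. L \<omega> \<in> S}"
    by (subst measure_distr) (auto simp: vimage_def)
  finally show ?thesis by (simp add: L_def)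
qed

lemma prob_not_coalesced:
  assumes "s0 < 0" "0 < N"
  shows "smg.prob {\<omega>. \<not> (\<forall>y<n. \<forall>y'<n. act (ev_word \<omega> (s0 - N) s0) y = act (ev_word \<omega> (s0 - N) s0) y')}
    \<le> real n * real n * exp (- \<mu> * pair_rate 2 * N)"
proof -
  define c where "c q = (if q = 0 then 0 else if q = 1 then s0 else s0 - N)" for q :: nat
  let ?step_pmf = "\<lambda>q. pair_pmf (word_pmf (c q - c (Suc q))) (if q \<in> {} then slot_pmf else return_pmf 0)"
  let ?bad = "\<lambda>w. \<not> (\<forall>y<n. \<forall>y'<n. act w y = act w y')"
  have "smg.prob {\<omega>. map (\<lambda>q. (ev_word \<omega> (c (Suc q)) (c q), if q \<in> {} then snd \<omega> (undefined q) else 0)) [0..<2]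
       \<in> {zs. ?bad (fst (zs ! 1))}} = measure_pmf.prob (seq_pmf ?step_pmf 2 0) {zs. ?bad (fst (zs ! 1))}"
    using assms by (intro step_law[where z=0 and k=0]) (auto simp: c_def bij_betw_def)
  also have "\<dots> = measure_pmf.prob (map_pmf (\<lambda>zs. fst (zs ! 1)) (seq_pmf ?step_pmf 2 0)) {w. ?bad w}"
    by (simp add: vimage_def)
  also have "map_pmf (\<lambda>zs. fst (zs ! 1)) (seq_pmf ?step_pmf 2 0) = word_pmf N"
    by (simp add: numeral_2_eq_2 map_bind_pmf pmf.map_comp o_def c_def map_fst_pair_pmf flip: map_pmf_def)
  finally have eq: "smg.prob {\<omega>. ?bad (ev_word \<omega> (s0 - N) s0)} = measure_pmf.prob (word_pmf N) {w. ?bad w}"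
    by (simp add: c_def upt_rec numeral_2_eq_2)
  have "measure_pmf.prob (word_pmf N) {w. ?bad w}
      \<le> measure_pmf.prob (word_pmf N) (\<Union>p\<in>slot_pairs. {w. inj_on (act w) {fst p, snd p}})"
  proof (rule measure_pmf.finite_measure_mono)
    show "{w. ?bad w} \<subseteq> (\<Union>p\<in>slot_pairs. {w. inj_on (act w) {fst p, snd p}})"
    proof
      fix w assume "w \<in> {w. ?bad w}"
      then obtain y y' where "y < n" "y' < n" "act w y \<noteq> act w y'" by auto
      then show "w \<in> (\<Union>p\<in>slot_pairs. {w. inj_on (act w) {fst p, snd p}})"
        by (intro UN_I[of "(y, y')"]) auto
    qed
  qed simp
  also have "\<dots> \<le> (\<Sum>p\<in>slot_pairs. measure_pmf.prob (word_pmf N) {w. inj_on (act w) {fst p, snd p}})"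
    using finite_slot_pairs by (intro measure_pmf.finite_measure_subadditive_finite) auto
  also have "\<dots> = (\<Sum>p\<in>slot_pairs. exp (- \<mu> * pair_rate 2 * N))"
  proof (rule sum.cong)
    fix p assume "p \<in> slot_pairs"
    then have "{fst p, snd p} \<subseteq> {..<n}" "card {fst p, snd p} = 2" by auto
    then show "measure_pmf.prob (word_pmf N) {w. inj_on (act w) {fst p, snd p}} = exp (- \<mu> * pair_rate 2 * N)"
      using prob_word_inj[OF assms(2), of "{fst p, snd p}"] by (simp only: of_nat_numeral)
  qed simp
  also have "\<dots> = real (n * (n - 1)) * exp (- \<mu> * pair_rate 2 * N)"
    by (simp add: card_slot_pairs)
  also have "\<dots> \<le> real n * real n * exp (- \<mu> * pair_rate 2 * N)"
    by (intro mult_right_mono) (auto simp: mult_left_mono)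
  finally show ?thesis using eq by simp
qed

end

section \<open>Genealogies of regular sample points\<close>

locale moran_samples = moran +
  fixes t :: "nat \<Rightarrow> real"
  assumes t_mono: "strict_mono t"
begin

definition base :: real where "base = min 0 (t 1) - 1"

definition nice :: "smg_omega \<Rightarrow> bool" where
  "nice \<omega> \<longleftrightarrow> (\<forall>m m'. m < m' \<longrightarrow> ev_time \<omega> m < ev_time \<omega> m')
    \<and> (\<forall>N::nat. finite {m. - real N < ev_time \<omega> m \<and> ev_time \<omega> m \<le> real N})
    \<and> (\<forall>i m. ev_time \<omega> m \<noteq> t i) \<and> (\<forall>m. ev_time \<omega> m \<noteq> 0)
    \<and> (\<forall>m. snd (fst \<omega> m) \<in> slot_pairs) \<and> (\<forall>i. snd \<omega> i < n)
    \<and> (\<exists>N::nat. 0 < N \<and> (\<forall>y<n. \<forall>y'<n. act (ev_word \<omega> (base - real N) base) y = act (ev_word \<omega> (base - real N) base) y'))"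

lemma nice_measurable[measurable]: "Measurable.pred (smg_space n \<mu>) nice"
proof -
  have [measurable]: "Measurable.pred (smg_space n \<mu>) (\<lambda>\<omega>. ev_word \<omega> s u \<in> X)" for s u X
    by (rule measurable_compose[OF ev_word_measurable]) auto
  have [measurable]: "Measurable.pred (smg_space n \<mu>) (\<lambda>\<omega>. snd (fst \<omega> m) \<in> X)" for m X
    by (rule measurable_compose[OF ev_mark_measurable]) auto
  have [measurable]: "Measurable.pred (smg_space n \<mu>) (\<lambda>\<omega>. snd \<omega> m \<in> X)" for m X
    by (rule measurable_compose[OF slot_measurable]) auto
  define X where "X = {w. \<forall>y<n. \<forall>y'<n. act w y = act w y'}"
  have "nice = (\<lambda>\<omega>. (\<forall>m m'. m < m' \<longrightarrow> ev_time \<omega> m < ev_time \<omega> m')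
    \<and> (\<forall>N::nat. finite {m. - real N < ev_time \<omega> m \<and> ev_time \<omega> m \<le> real N})
    \<and> (\<forall>i m. ev_time \<omega> m \<noteq> t i) \<and> (\<forall>m. ev_time \<omega> m \<noteq> 0)
    \<and> (\<forall>m. snd (fst \<omega> m) \<in> slot_pairs) \<and> (\<forall>i. snd \<omega> i \<in> {..<n})
    \<and> (\<exists>N::nat. 0 < N \<and> ev_word \<omega> (base - real N) base \<in> X))"
    unfolding nice_def X_def fun_eq_iff by simp
  then show ?thesis by simp measurable
qed

lemma AE_coalesce: "AE \<omega> in smg_space n \<mu>. \<exists>N::nat. 0 < N \<and>
    (\<forall>y<n. \<forall>y'<n. act (ev_word \<omega> (base - real N) base) y = act (ev_word \<omega> (base - real N) base) y')"
proof -
  define good where "good N \<omega> \<longleftrightarrow> (\<forall>y<n. \<forall>y'<n. act (ev_word \<omega> (base - real N) base) y = act (ev_word \<omega> (base - real N) base) y')" for N :: nat and \<omega>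
  have ms: "{\<omega>. \<not> good N \<omega>} \<in> smg.events" for N
  proof -
    have "(\<lambda>\<omega>. ev_word \<omega> (base - real N) base) -` {w. \<not> (\<forall>y<n. \<forall>y'<n. act w y = act w y')} \<inter> space (smg_space n \<mu>) \<in> smg.events"
      by (rule measurable_sets[OF ev_word_measurable]) auto
    then show ?thesis by (simp add: vimage_def good_def)
  qed
  define A where "A = (\<Inter>N\<in>{0<..}. {\<omega>. \<not> good N \<omega>})"
  have A[measurable]: "A \<in> smg.events" unfolding A_def using ms by (intro sets.countable_INT') auto
  have le: "smg.prob A \<le> real n * real n * exp (- \<mu> * pair_rate 2) ^ Suc N" for N
  proof -
    have "smg.prob A \<le> smg.prob {\<omega>. \<not> good (Suc N) \<omega>}"
      by (rule smg.finite_measure_mono[OF _ ms]) (unfold A_def, rule INT_lower, simp)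
    also have "\<dots> \<le> real n * real n * exp (- \<mu> * pair_rate 2 * real (Suc N))"
      unfolding good_def by (rule prob_not_coalesced) (auto simp: base_def min_def)
    also have "exp (- \<mu> * pair_rate 2 * real (Suc N)) = exp (- \<mu> * pair_rate 2) ^ Suc N"
      by (subst exp_of_nat_mult[symmetric]) (simp add: algebra_simps)
    finally show ?thesis .
  qed
  have "0 < pair_rate 2" using n2 by (simp add: pair_rate_def)
  then have "exp (- \<mu> * pair_rate 2) < 1" using mu by simp
  then have "(\<lambda>N. real n * real n * exp (- \<mu> * pair_rate 2) ^ Suc N) \<longlonglongrightarrow> real n * real n * 0"
    by (intro tendsto_mult tendsto_const LIMSEQ_Suc LIMSEQ_power_zero) auto
  then have "smg.prob A \<le> real n * real n * 0"
    by (rule LIMSEQ_le_const) (use le in auto)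
  then have "smg.prob A = 0" using measure_nonneg[of "smg_space n \<mu>" A] by simp
  then have "A \<in> null_sets (smg_space n \<mu>)" by (auto simp: smg.emeasure_eq_measure)
  then show ?thesis by (rule AE_I') (auto simp: A_def good_def[symmetric], metis less_irrefl)
qed

lemma AE_nice: "AE \<omega> in smg_space n \<mu>. nice \<omega>"
proof -
  let ?P = "\<lambda>\<omega>. (\<forall>m m'. m < m' \<longrightarrow> ev_time \<omega> m < ev_time \<omega> m')
    \<and> (\<forall>N::nat. finite {m. - real N < ev_time \<omega> m \<and> ev_time \<omega> m \<le> real N})
    \<and> (\<forall>i m. ev_time \<omega> m \<noteq> t i) \<and> (\<forall>m. ev_time \<omega> m \<noteq> 0)
    \<and> (\<forall>m. snd (fst \<omega> m) \<in> slot_pairs) \<and> (\<forall>i. snd \<omega> i \<in> {..<n})"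
  have [measurable]: "Measurable.pred (smg_space n \<mu>) (\<lambda>\<omega>. snd (fst \<omega> m) \<in> X)" for m X
    by (rule measurable_compose[OF ev_mark_measurable]) auto
  have [measurable]: "Measurable.pred (smg_space n \<mu>) (\<lambda>\<omega>. snd \<omega> m \<in> X)" for m X
    by (rule measurable_compose[OF slot_measurable]) auto
  let ?G = "\<lambda>a. good_seq a \<and> (\<forall>i. snd (a i) \<in> slot_pairs) \<and> (\<forall>i j. psum a (Suc j) \<noteq> t i \<and> psum a (Suc j) \<noteq> - t i)"
  have G: "AE a in seq.S. ?G a"
  proof -
    have "AE a in seq.S. \<forall>i j. psum a (Suc j) \<noteq> t i" "AE a in seq.S. \<forall>i j. psum a (Suc j) \<noteq> - t i"
      using AE_psum_neq by (simp_all add: AE_all_countable)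
    with AE_good_seq AE_seq_marks show ?thesis by eventually_elim auto
  qed
  have U: "AE u in slotsM. \<forall>i. u i \<in> {..<n}"
    unfolding AE_all_countable
  proof
    fix i
    have "0 \<in> {..<n}" using n2 by simp
    then have "{..<n} \<noteq> {}" by blast
    then show "AE u in slotsM. u i \<in> {..<n}"
      by (intro slots.AE_component) (auto simp: AE_measure_pmf_iff)
  qed
  have "AE \<omega> in smg_space n \<mu>. ?P \<omega>"
  proof (rule smg_AE_I)
    show "AE p in (seq.S \<Otimes>\<^sub>M seq.S) \<Otimes>\<^sub>M slotsM. ?P (mk_omega p)"
      using AE_halves[OF G G U]
    proof eventually_elim
      case (elim p)
      obtain a b u where p: "p = ((a, b), u)" by (metis prod.exhaust)
      from elim p have a: "?G a" and b: "?G b" and u: "\<forall>i. u i \<in> {..<n}" by auto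
      note tm = ev_time_mk_omega[of a b u]
      have A: "ev_time (mk_omega p) m < ev_time (mk_omega p) m'" if "m < m'" for m m'
      proof -
        consider "1 \<le> m" | "m' < 1" | "m < 1" "1 \<le> m'" by linarith
        then show ?thesis
        proof cases
          case 1
          then show ?thesis using that psum_strict_mono[of a] a unfolding p tm by (simp add: strict_mono_less)
        next
          case 2
          then show ?thesis using that psum_strict_mono[of b] b unfolding p tm by (simp add: strict_mono_less)
        next
          case 3
          have "0 < psum a (nat m')" "0 \<le> psum b (nat (1 - m))"
            using psum_pos[of a "nat m' - 1"] psum_nonneg[of b] a b 3 by auto
          then show ?thesis using 3 unfolding p tm by simp
        qed
      qed
      have B: "finite {m. - real N < ev_time (mk_omega p) m \<and> ev_time (mk_omega p) m \<le> real N}" for N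
      proof (rule finite_subset)
        show "finite {- int (cnt b (real N))..int (cnt a (real N))}" by simp
        show "{m. - real N < ev_time (mk_omega p) m \<and> ev_time (mk_omega p) m \<le> real N} \<subseteq> {- int (cnt b (real N))..int (cnt a (real N))}"
        proof
          fix m assume m: "m \<in> {m. - real N < ev_time (mk_omega p) m \<and> ev_time (mk_omega p) m \<le> real N}"
          show "m \<in> {- int (cnt b (real N))..int (cnt a (real N))}"
          proof (cases "1 \<le> m")
            case True
            define i where "i = nat (m - 1)"
            have i: "m = int i + 1" using True by (simp add: i_def)
            then have "nat m = Suc i" by simp
            then have "\<not> real N < psum a (Suc i)" using m True unfolding p tm by simp
            then show ?thesis using psum_less_iff[of a "real N" i] a i by auto
          next
            case False
            define i where "i = nat (- m)"
            have i: "m = - int i" using False by (simp add: i_def)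
            then have "nat (1 - m) = Suc i" by simp
            then have "psum b (Suc i) < real N" using m False unfolding p tm by simp
            then show ?thesis using psum_less_iff[of b "real N" i] b i by auto
          qed
        qed
      qed
      have CD: "ev_time (mk_omega p) m \<noteq> t i \<and> ev_time (mk_omega p) m \<noteq> 0" for m i
      proof (cases "1 \<le> m")
        case True
        then have "nat m = Suc (nat m - 1)" by simp
        then have "ev_time (mk_omega p) m = psum a (Suc (nat m - 1))" using True unfolding p tm by simp
        moreover have "psum a (Suc (nat m - 1)) \<noteq> t i" "0 < psum a (Suc (nat m - 1))"
          using a psum_pos by blast+
        ultimately show ?thesis by simp
      next
        case False
        then have "nat (1 - m) = Suc (nat (- m))" by simp
        then have "ev_time (mk_omega p) m = - psum b (Suc (nat (- m)))" using False unfolding p tm by simp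
        moreover have "psum b (Suc (nat (- m))) \<noteq> - t i" "0 < psum b (Suc (nat (- m)))"
          using b psum_pos by blast+
        ultimately show ?thesis by auto
      qed
      have E: "snd (fst (mk_omega p) m) \<in> slot_pairs" for m
        using a b by (auto simp: p mk_omega_def glue_def)
      have F: "snd (mk_omega p) i \<in> {..<n}" for i using u by (simp add: p mk_omega_def)
      show ?case by (intro conjI allI impI A B CD[THEN conjunct1] CD[THEN conjunct2] E F)
    qed
  qed measurable
  with AE_coalesce show ?thesis by eventually_elim (auto simp: nice_def)
qed

end

definition gen_ok :: "(nat \<Rightarrow> real) \<Rightarrow> nat \<Rightarrow> gmat \<Rightarrow> bool" where
  "gen_ok t k g \<longleftrightarrow> valid_gen t k g \<and> inj_on (g_attach g) {2..k}"

lemma g_attach_props: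
  assumes "2 \<le> j"
  shows "\<exists>i. 1 \<le> i \<and> i < j \<and> g (i, j) = g_attach g j"
    and "1 \<le> i \<Longrightarrow> i < j \<Longrightarrow> g (i, j) \<le> g_attach g j"
proof -
  have eq: "{g (i, j) | i. 1 \<le> i \<and> i < j} = (\<lambda>i. g (i, j)) ` {1..<j}" by auto
  have ne: "{1..<j} \<noteq> {}" using assms by auto
  have "g_attach g j \<in> (\<lambda>i. g (i, j)) ` {1..<j}"
    unfolding g_attach_def eq using ne by (intro Max_in) auto
  then show "\<exists>i. 1 \<le> i \<and> i < j \<and> g (i, j) = g_attach g j" by auto
  show "1 \<le> i \<Longrightarrow> i < j \<Longrightarrow> g (i, j) \<le> g_attach g j"
    unfolding g_attach_def eq by (intro Max_ge) auto
qed

lemma g_attach_eqI: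
  assumes "\<exists>i. 1 \<le> i \<and> i < j \<and> g (i, j) = x" "\<And>i. 1 \<le> i \<Longrightarrow> i < j \<Longrightarrow> g (i, j) \<le> x"
  shows "g_attach g j = x"
proof -
  have j: "2 \<le> j" using assms(1) by auto
  show ?thesis using g_attach_props(1)[OF j, of g] g_attach_props(2)[OF j, of _ g] assms by (metis order_antisym)
qed

context moran_samples begin

lemma t_less[simp]: "t i < t j \<longleftrightarrow> i < j"
  using t_mono by (rule strict_mono_less)

lemma t_le[simp]: "t i \<le> t j \<longleftrightarrow> i \<le> j"
  using t_mono by (rule strict_mono_less_eq)

lemma t_eq[simp]: "t i = t j \<longleftrightarrow> i = j"
  using t_mono by (rule strict_mono_eq)

abbreviation X :: "smg_omega \<Rightarrow> nat \<Rightarrow> real \<Rightarrow> nat" where "X \<omega> i s \<equiv> samp_anc t \<omega> i s"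

lemma X_eq: "X \<omega> i s = act (ev_word \<omega> s (t i)) (snd \<omega> i)"
  by (simp add: samp_anc_def anc_eq_foldr)

context
  fixes \<omega> :: smg_omega
  assumes nice: "nice \<omega>"
begin

lemma nice_mono: "m < m' \<Longrightarrow> ev_time \<omega> m < ev_time \<omega> m'"
  by (rule nice[unfolded nice_def, THEN conjunct1, rule_format])

lemma nice_finite: "finite {m. - real N < ev_time \<omega> m \<and> ev_time \<omega> m \<le> real N}"
  by (rule nice[unfolded nice_def, THEN conjunct2, THEN conjunct1, THEN spec])

lemma nice_mark: "snd (fst \<omega> m) \<in> slot_pairs"
  by (rule nice[unfolded nice_def, THEN conjunct2, THEN conjunct2, THEN conjunct2, THEN conjunct2, THEN conjunct1, THEN spec])

lemma nice_slot: "snd \<omega> i < n"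
  by (rule nice[unfolded nice_def, THEN conjunct2, THEN conjunct2, THEN conjunct2, THEN conjunct2, THEN conjunct2, THEN conjunct1, THEN spec])

lemma ev_time_less: "ev_time \<omega> m < ev_time \<omega> m' \<longleftrightarrow> m < m'"
  using nice_mono[of m m'] nice_mono[of m' m] by (cases m m' rule: linorder_cases) auto

lemma finite_events: "finite {m. s < ev_time \<omega> m \<and> ev_time \<omega> m \<le> u}"
proof -
  obtain N :: nat where N: "max \<bar>s\<bar> \<bar>u\<bar> < real N" using reals_Archimedean2 by blast
  have "{m. s < ev_time \<omega> m \<and> ev_time \<omega> m \<le> u} \<subseteq> {m. - real N < ev_time \<omega> m \<and> ev_time \<omega> m \<le> real N}"
    using N by auto
  then show ?thesis using nice_finite by (rule finite_subset)
qed

lemma ev_time_neq: "ev_time \<omega> m \<noteq> t i" "ev_time \<omega> m \<noteq> 0"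
  by (rule nice[unfolded nice_def, THEN conjunct2, THEN conjunct2, THEN conjunct1, THEN spec, THEN spec])
    (rule nice[unfolded nice_def, THEN conjunct2, THEN conjunct2, THEN conjunct2, THEN conjunct1, THEN spec])

lemma ev_word_append:
  assumes "s \<le> u" "u \<le> v"
  shows "ev_word \<omega> s v = ev_word \<omega> s u @ ev_word \<omega> u v"
proof -
  let ?A = "\<lambda>s u. {m. s < ev_time \<omega> m \<and> ev_time \<omega> m \<le> u}"
  have "sorted_list_of_set (?A s v) = sorted_list_of_set (?A s u) @ sorted_list_of_set (?A u v)"
  proof (rule sorted_list_of_set_eqI)
    show "sorted_wrt (<) (sorted_list_of_set (?A s u) @ sorted_list_of_set (?A u v))"
      unfolding sorted_wrt_append
    proof (intro conjI ballI)
      fix m m' assume "m \<in> set (sorted_list_of_set (?A s u))" "m' \<in> set (sorted_list_of_set (?A u v))"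
      then have "ev_time \<omega> m < ev_time \<omega> m'" using finite_events by auto
      then show "m < m'" by (simp add: ev_time_less)
    qed (simp_all add: strict_sorted_list_of_set)
    show "set (sorted_list_of_set (?A s u) @ sorted_list_of_set (?A u v)) = ?A s v"
      using assms finite_events by auto
  qed
  then show ?thesis by (simp add: ev_word_def)
qed

lemma ev_word_empty:
  assumes "\<And>m. \<not> (s < ev_time \<omega> m \<and> ev_time \<omega> m \<le> u)"
  shows "ev_word \<omega> s u = []"
proof -
  have "{m. s < ev_time \<omega> m \<and> ev_time \<omega> m \<le> u} = {}" using assms by blast
  then show ?thesis by (simp only: ev_word_def sorted_list_of_set_empty list.map)
qed

lemma ev_word_right:
  assumes "s < u"
  shows "\<exists>s'. s < s' \<and> s' \<le> u \<and> ev_word \<omega> s s' = []"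
proof -
  let ?A = "{m. s < ev_time \<omega> m \<and> ev_time \<omega> m \<le> u}"
  define x where "x = Min (insert u (ev_time \<omega> ` ?A))"
  have fin: "finite (insert u (ev_time \<omega> ` ?A))" using finite_events by simp
  have x: "s < x" "x \<le> u" unfolding x_def using fin assms by (auto simp: Min_gr_iff)
  have "ev_word \<omega> s ((s + x) / 2) = []"
  proof (rule ev_word_empty)
    fix m
    show "\<not> (s < ev_time \<omega> m \<and> ev_time \<omega> m \<le> (s + x) / 2)"
    proof
      assume *: "s < ev_time \<omega> m \<and> ev_time \<omega> m \<le> (s + x) / 2"
      then have "ev_time \<omega> m < x" using x by (auto simp: field_simps)
      moreover have "x \<le> ev_time \<omega> m" unfolding x_def
        using * x fin calculation by (intro Min_le) auto
      ultimately show False by simp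
    qed
  qed
  then show ?thesis using x by (intro exI[of _ "(s + x) / 2"]) (auto simp: field_simps)
qed

lemma events_left:
  "\<exists>s<u. \<forall>m. s < ev_time \<omega> m \<and> ev_time \<omega> m \<le> u \<longrightarrow> ev_time \<omega> m = u"
proof -
  let ?A = "{m. u - 1 < ev_time \<omega> m \<and> ev_time \<omega> m \<le> u \<and> ev_time \<omega> m \<noteq> u}"
  define s where "s = Max (insert (u - 1) (ev_time \<omega> ` ?A))"
  have fin: "finite (insert (u - 1) (ev_time \<omega> ` ?A))"
    using finite_subset[OF _ finite_events[of "u - 1" u], of ?A] by auto
  have s: "u - 1 \<le> s" "s < u" unfolding s_def using fin by (auto simp: Max_less_iff)
  have "ev_time \<omega> m = u" if "s < ev_time \<omega> m" "ev_time \<omega> m \<le> u" for m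
  proof (rule ccontr)
    assume "ev_time \<omega> m \<noteq> u"
    then have "ev_time \<omega> m \<le> s" unfolding s_def using that s fin by (intro Max_ge) auto
    then show False using that by simp
  qed
  then show ?thesis using s by auto
qed

lemma ev_word_left:
  assumes "\<And>m. ev_time \<omega> m \<noteq> u"
  shows "\<exists>s<u. ev_word \<omega> s u = []"
  using events_left[of u] assms ev_word_empty by metis

lemma ev_word_left_event:
  assumes "ev_time \<omega> m = u"
  shows "\<exists>s<u. ev_word \<omega> s u = [snd (fst \<omega> m)]"
proof -
  obtain s where s: "s < u" "\<forall>m. s < ev_time \<omega> m \<and> ev_time \<omega> m \<le> u \<longrightarrow> ev_time \<omega> m = u"
    using events_left by blast
  have "{m. s < ev_time \<omega> m \<and> ev_time \<omega> m \<le> u} = {m}"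
  proof safe
    fix m' assume "s < ev_time \<omega> m'" "ev_time \<omega> m' \<le> u"
    then have "ev_time \<omega> m' = ev_time \<omega> m" using s assms by simp
    then show "m' = m" by (metis ev_time_less less_irrefl linorder_neqE_linordered_idom)
  qed (use assms s in auto)
  then have "ev_word \<omega> s u = [snd (fst \<omega> m)]" by (simp only: ev_word_def) simp
  with s show ?thesis by blast
qed

lemma X_flow: "s \<le> u \<Longrightarrow> u \<le> t i \<Longrightarrow> X \<omega> i s = act (ev_word \<omega> s u) (X \<omega> i u)"
  using ev_word_append[of s u "t i"] by (simp add: X_eq)

lemma set_ev_word: "set (ev_word \<omega> s u) \<subseteq> slot_pairs"
  unfolding ev_word_def set_map by (rule image_subsetI) (rule nice_mark)

lemma X_less: "X \<omega> i s < n"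
  unfolding X_eq by (intro act_range set_ev_word nice_slot)

lemma X_self: "X \<omega> i (t i) = snd \<omega> i"
  by (simp add: X_eq ev_word_empty[of "t i" "t i"])

lemma X_eq_down:
  "X \<omega> i u = X \<omega> j u \<Longrightarrow> s \<le> u \<Longrightarrow> u \<le> t i \<Longrightarrow> u \<le> t j \<Longrightarrow> X \<omega> i s = X \<omega> j s"
  using X_flow[of s u i] X_flow[of s u j] by simp

lemma X_coalesced: "\<exists>s<base. \<forall>i\<ge>1. \<forall>j\<ge>1. X \<omega> i s = X \<omega> j s"
proof -
  obtain N :: nat where N: "0 < N"
    "\<forall>y<n. \<forall>y'<n. act (ev_word \<omega> (base - real N) base) y = act (ev_word \<omega> (base - real N) base) y'"
    using nice[unfolded nice_def, THEN conjunct2, THEN conjunct2, THEN conjunct2, THEN conjunct2, THEN conjunct2, THEN conjunct2]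
    by (elim exE conjE) (rule that)
  have eq: "X \<omega> i (base - real N) = X \<omega> j (base - real N)" if "1 \<le> i" "1 \<le> j" for i j
  proof -
    have "base \<le> t 1" "t 1 \<le> t i" "t 1 \<le> t j" using that by (auto simp: base_def min_def)
    then have "base \<le> t i" "base \<le> t j" by linarith+
    then show ?thesis
      using X_flow[of "base - real N" base i] X_flow[of "base - real N" base j]
        N(2)[rule_format, OF X_less[of i base] X_less[of j base]] by simp
  qed
  show ?thesis
  proof (intro exI[of _ "base - real N"] conjI allI impI)
    show "base - real N < base" using N(1) by simp
  qed (rule eq)
qed

abbreviation "G i j \<equiv> merge_time t \<omega> i j"

context
  fixes i j :: nat
  assumes i1: "1 \<le> i" and ij: "i < j"
begin

lemma ti_tj: "t i < t j"
  using ij by simp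

lemma merge_set_nonempty: "{s. s \<le> t i \<and> X \<omega> j s = X \<omega> i s} \<noteq> {}"
proof -
  obtain s where s0: "s < base \<and> (\<forall>i\<ge>1. \<forall>j\<ge>1. X \<omega> i s = X \<omega> j s)" using X_coalesced ..
  note s = conjunct1[OF s0] conjunct2[OF s0]
  have "base \<le> t 1" "t 1 \<le> t i" using i1 by (auto simp: base_def min_def)
  then have "s \<le> t i" using s(1) by linarith
  moreover have "X \<omega> j s = X \<omega> i s" using i1 ij by (intro s(2)[rule_format]) auto
  ultimately show ?thesis by blast
qed

lemma merge_set_bdd: "bdd_above {s. s \<le> t i \<and> X \<omega> j s = X \<omega> i s}"
  by (rule bdd_aboveI[of _ "t i"]) auto

lemma merge_le: "G i j \<le> t i"
  unfolding merge_time_def using merge_set_nonempty by (rule cSup_least) auto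

lemma merge_eq_below: "s < G i j \<Longrightarrow> X \<omega> j s = X \<omega> i s"
proof -
  assume s: "s < G i j"
  then obtain s' where s': "s' \<le> t i" "X \<omega> j s' = X \<omega> i s'" "s < s'"
    unfolding merge_time_def using less_cSup_iff[OF merge_set_nonempty merge_set_bdd] by auto
  then show ?thesis using X_eq_down[of j s' i s] ti_tj by linarith
qed

lemma merge_ge: "s \<le> t i \<Longrightarrow> X \<omega> j s = X \<omega> i s \<Longrightarrow> s \<le> G i j"
  unfolding merge_time_def using merge_set_bdd by (intro cSup_upper) auto

lemma merge_iff:
  assumes s: "s \<le> t i"
  shows "X \<omega> j s = X \<omega> i s \<longleftrightarrow> s < G i j \<or> (s = t i \<and> G i j = t i)"
proof
  assume eq: "X \<omega> j s = X \<omega> i s"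
  show "s < G i j \<or> (s = t i \<and> G i j = t i)"
  proof (cases "s = t i")
    case True
    then show ?thesis using merge_ge[OF s eq] merge_le by auto
  next
    case False
    with s have "s < t i" by simp
    from ev_word_right[OF this] obtain s' where s': "s < s'" "s' \<le> t i" "ev_word \<omega> s s' = []" by blast
    have "s' \<le> t j" using s' ij ti_tj by linarith
    then have "X \<omega> j s' = X \<omega> i s'" using X_flow[of s s' i] X_flow[of s s' j] s' eq by simp
    then have "s' \<le> G i j" using merge_ge s' by blast
    then show ?thesis using s' by simp
  qed
next
  assume "s < G i j \<or> (s = t i \<and> G i j = t i)"
  then show "X \<omega> j s = X \<omega> i s"
  proof
    assume *: "s = t i \<and> G i j = t i"
    obtain s' where s': "s' < t i" "ev_word \<omega> s' (t i) = []" using ev_word_left[OF ev_time_neq(1)] by blast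
    have "X \<omega> j s' = X \<omega> i s'" using s' * by (intro merge_eq_below) simp
    moreover have "X \<omega> i s' = X \<omega> i (t i)"
      using X_flow[of s' "t i" i, OF less_imp_le[OF s'(1)] order_refl] by (simp add: s'(2))
    moreover have "X \<omega> j s' = X \<omega> j (t i)"
      using X_flow[of s' "t i" j, OF less_imp_le[OF s'(1)] less_imp_le[OF ti_tj]] by (simp add: s'(2))
    ultimately have "X \<omega> j (t i) = X \<omega> i (t i)" by (simp only:)
    then show ?thesis by (simp only: *)
  next
    assume "s < G i j"
    then show ?thesis by (rule merge_eq_below)
  qed
qed

lemma merge_event:
  assumes "G i j < t i"
  shows "\<exists>m. ev_time \<omega> m = G i j"
proof (rule ccontr)
  assume "\<not> (\<exists>m. ev_time \<omega> m = G i j)"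
  then have "\<And>m. ev_time \<omega> m \<noteq> G i j" by simp
  from ev_word_left[OF this] obtain s where s: "s < G i j" "ev_word \<omega> s (G i j) = []" by (elim exE conjE)
  have le: "G i j \<le> t j" using assms ij ti_tj by linarith
  have "X \<omega> j s = X \<omega> i s" by (rule merge_eq_below[OF s(1)])
  then have "X \<omega> j (G i j) = X \<omega> i (G i j)"
    using X_flow[OF less_imp_le[OF s(1)] less_imp_le[OF assms]] X_flow[OF less_imp_le[OF s(1)] le]
    by (simp add: s(2))
  then show False using merge_iff[of "G i j"] assms by simp
qed

lemma merge_eq_t: "G i j = t l \<Longrightarrow> i = l"
  using merge_event ev_time_neq(1)[of _ l] merge_le by (metis order_le_less t_eq)

lemma merge_eq_0: "G i j = 0 \<Longrightarrow> t i = 0"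
  using merge_event ev_time_neq(2) merge_le by (metis order_le_less)

end

lemma merge_last:
  assumes "1 \<le> i" "i < j" "j < j'" "G i j = t i" "G i j' = t i"
  shows "t i < G j j'"
proof -
  have "X \<omega> j (t i) = X \<omega> i (t i)" "X \<omega> j' (t i) = X \<omega> i (t i)"
    using merge_iff[of i j "t i"] merge_iff[of i j' "t i"] assms by auto
  then have eq: "X \<omega> j' (t i) = X \<omega> j (t i)" by simp
  then show ?thesis using merge_iff[of j j' "t i"] assms by auto
qed

definition Gs :: "nat \<Rightarrow> nat \<Rightarrow> real" where "Gs i j = merge_time t \<omega> (min i j) (max i j)"

lemma Gs_below:
  assumes "1 \<le> i" "1 \<le> j" "i \<noteq> j" "s < Gs i j"
  shows "X \<omega> i s = X \<omega> j s" "s \<le> t i" "s \<le> t j"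
proof -
  have m: "1 \<le> min i j" "min i j < max i j" using assms by auto
  have "s < t (min i j)" "t (min i j) \<le> t i" "t (min i j) \<le> t j"
    using merge_le[OF m] assms(4) by (auto simp: Gs_def)
  then show "s \<le> t i" "s \<le> t j" by linarith+
  show "X \<omega> i s = X \<omega> j s"
    using merge_eq_below[OF m, of s] assms by (cases "i < j") (auto simp: Gs_def min_def max_def)
qed

lemma Gs_ge:
  assumes "1 \<le> i" "1 \<le> j" "i \<noteq> j" "s \<le> t i" "s \<le> t j" "X \<omega> i s = X \<omega> j s"
  shows "s \<le> Gs i j"
proof (cases "i < j")
  case True
  then show ?thesis using merge_ge[of i j s] assms by (simp add: Gs_def min_def max_def)
next
  case False
  then show ?thesis using merge_ge[of j i s] assms by (simp add: Gs_def min_def max_def)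
qed

lemma Gs_ultra:
  assumes "1 \<le> i" "1 \<le> j" "1 \<le> l" "i \<noteq> j" "i \<noteq> l" "j \<noteq> l"
  shows "min (Gs i j) (Gs i l) \<le> Gs j l"
proof (rule dense_le)
  fix s assume "s < min (Gs i j) (Gs i l)"
  then have "X \<omega> i s = X \<omega> j s" "X \<omega> i s = X \<omega> l s" "s \<le> t j" "s \<le> t l"
    using Gs_below[of i j s] Gs_below[of i l s] assms by auto
  then show "s \<le> Gs j l" using assms by (intro Gs_ge) auto
qed

lemma genealogy_apply: "1 \<le> i \<Longrightarrow> i < j \<Longrightarrow> j \<le> k \<Longrightarrow> genealogy t k \<omega> (i, j) = G i j"
  by (simp add: genealogy_def trunc_def)

lemma attach_merge:
  assumes "j \<in> {2..k}"
  shows "\<exists>i. 1 \<le> i \<and> i < j \<and> G i j = g_attach (genealogy t k \<omega>) j"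
    "1 \<le> i \<Longrightarrow> i < j \<Longrightarrow> G i j \<le> g_attach (genealogy t k \<omega>) j"
proof -
  have j: "2 \<le> j" using assms by simp
  obtain l where l: "1 \<le> l" "l < j" "genealogy t k \<omega> (l, j) = g_attach (genealogy t k \<omega>) j"
    using g_attach_props(1)[OF j] by blast
  then show "\<exists>i. 1 \<le> i \<and> i < j \<and> G i j = g_attach (genealogy t k \<omega>) j"
    using genealogy_apply[of l j k] assms by auto
  show "1 \<le> i \<Longrightarrow> i < j \<Longrightarrow> G i j \<le> g_attach (genealogy t k \<omega>) j"
    using g_attach_props(2)[OF j, of i "genealogy t k \<omega>"] genealogy_apply[of i j k] assms by simp
qed

lemma attach_eq_t:
  assumes j: "j \<in> {2..k}" and l: "1 \<le> l" and eq: "g_attach (genealogy t k \<omega>) j = t l"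
  shows "l < j \<and> G l j = t l"
proof -
  obtain i where i: "1 \<le> i" "i < j" "G i j = t l" using attach_merge(1)[OF j] eq by auto
  with merge_eq_t[OF i(1,2,3)] show ?thesis by simp
qed

lemma valid_genealogy: "valid_gen t k (genealogy t k \<omega>)"
proof -
  have gs: "gsym (genealogy t k \<omega>) i j = Gs i j" if "i \<in> {1..k}" "j \<in> {1..k}" "i \<noteq> j" for i j
    using that by (auto simp: gsym_def Gs_def intro!: genealogy_apply)
  show ?thesis
    unfolding valid_gen_def
  proof (intro conjI allI impI ballI)
    show "trunc k (genealogy t k \<omega>) = genealogy t k \<omega>"
      by (auto simp: trunc_def genealogy_def fun_eq_iff)
  next
    fix i j assume "1 \<le> i \<and> i < j \<and> j \<le> k"
    then show "genealogy t k \<omega> (i, j) \<le> t i" by (simp add: genealogy_apply merge_le)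
  next
    fix i j l assume "i \<in> {1..k}" "j \<in> {1..k}" "l \<in> {1..k}" "i \<noteq> j \<and> i \<noteq> l \<and> j \<noteq> l"
    then show "min (gsym (genealogy t k \<omega>) i j) (gsym (genealogy t k \<omega>) i l) \<le> gsym (genealogy t k \<omega>) j l"
      using Gs_ultra[of i j l] by (simp add: gs)
  next
    fix j l assume "j \<in> {2..k}" "1 \<le> l" "g_attach (genealogy t k \<omega>) j = t l"
    note * = attach_eq_t[OF this]
    then show "l < j" by simp
    show "genealogy t k \<omega> (l, j) = t l" using * \<open>1 \<le> l\<close> \<open>j \<in> {2..k}\<close> by (simp add: genealogy_apply)
  next
    fix i j j' assume "1 \<le> i \<and> i < j \<and> j < j' \<and> j' \<le> k \<and> genealogy t k \<omega> (i, j) = t i \<and> genealogy t k \<omega> (i, j') = t i"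
    moreover from this have "genealogy t k \<omega> (i, j) = G i j" "genealogy t k \<omega> (i, j') = G i j'"
        "genealogy t k \<omega> (j, j') = G j j'" by (intro genealogy_apply; simp)+
    ultimately show "t i < genealogy t k \<omega> (j, j')" using merge_last[of i j j'] by auto
  qed
qed

lemma distinct_attach_aux:
  assumes j: "j \<in> {2..k}" and j': "j' \<in> {2..k}" and less: "j < j'"
  shows "g_attach (genealogy t k \<omega>) j \<noteq> g_attach (genealogy t k \<omega>) j'"
proof
  define v where "v = g_attach (genealogy t k \<omega>) j"
  assume "g_attach (genealogy t k \<omega>) j = g_attach (genealogy t k \<omega>) j'"
  then have v': "g_attach (genealogy t k \<omega>) j' = v" by (simp add: v_def)
  obtain i where i: "1 \<le> i" "i < j" "G i j = v" using attach_merge(1)[OF j] v_def by auto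
  obtain i' where i': "1 \<le> i'" "i' < j'" "G i' j' = v" using attach_merge(1)[OF j'] v' by auto
  have le: "G l j' \<le> v" if "1 \<le> l" "l < j'" for l using attach_merge(2)[OF j', of l] v' that by simp
  have nt: "v \<noteq> t l" if "1 \<le> l" for l
  proof
    assume vt: "v = t l"
    have "G l j = t l" "l < j" using attach_eq_t[OF j that] vt v_def by auto
    moreover have "G l j' = t l" using attach_eq_t[OF j' that] vt v' by auto
    ultimately have "t l < G j j'" using merge_last that less by blast
    moreover have "G j j' \<le> v" using le[of j] j less by simp
    ultimately show False using vt by simp
  qed
  have vi: "v < t i" using merge_le[OF i(1,2)] i(3) nt[OF i(1)] by simp
  have vi': "v < t i'" using merge_le[OF i'(1,2)] i'(3) nt[OF i'(1)] by simp
  have "t i < t j" "t i < t j'" using i less by auto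
  then have vj: "v < t j" "v < t j'" using vi by linarith+
  obtain m where m: "ev_time \<omega> m = v" using merge_event[OF i(1,2)] i(3) vi by auto
  obtain s where s: "s < v" "ev_word \<omega> s v = [snd (fst \<omega> m)]" using ev_word_left_event[OF m] by blast
  define p where "p = snd (fst \<omega> m)"
  have step: "X \<omega> l s = replace_slot p (X \<omega> l v)" if "v < t l" for l
    using X_flow[of s v l] s that by (simp add: p_def)
  have ne1: "X \<omega> j v \<noteq> X \<omega> i v" using merge_iff[OF i(1,2), of v] i(3) vi by simp
  have ne2: "X \<omega> j' v \<noteq> X \<omega> i' v" using merge_iff[OF i'(1,2), of v] i'(3) vi' by simp
  have ne3: "X \<omega> j' v \<noteq> X \<omega> i v" using merge_iff[of i j' v] le[of i] i vi less by simp
  have ne4: "X \<omega> j' v \<noteq> X \<omega> j v" using merge_iff[of j j' v] le[of j] j vj less by simp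
  have "X \<omega> j s = X \<omega> i s" using merge_eq_below[OF i(1,2), of s] i(3) s by simp
  then have e1: "replace_slot p (X \<omega> j v) = replace_slot p (X \<omega> i v)" using step vi vj by simp
  have "X \<omega> j' s = X \<omega> i' s" using merge_eq_below[OF i'(1,2), of s] i'(3) s by simp
  then have e2: "replace_slot p (X \<omega> j' v) = replace_slot p (X \<omega> i' v)" using step vi' vj by simp
  show False using e1 e2 ne1 ne2 ne3 ne4 by (auto simp: replace_slot_def split: if_splits)
qed

lemma gen_ok_genealogy: "gen_ok t k (genealogy t k \<omega>)"
  unfolding gen_ok_def using valid_genealogy distinct_attach_aux
  by (auto simp: inj_on_def) (metis atLeastAtMost_iff linorder_neqE_nat)

lemma attach_eq_0:
  assumes "j \<in> {2..k}" "g_attach (genealogy t k \<omega>) j = 0"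
  shows "0 \<in> t ` {1..k}"
proof -
  obtain i where i: "1 \<le> i" "i < j" "G i j = 0" using attach_merge(1)[OF assms(1)] assms(2) by auto
  then have "t i = 0" using merge_eq_0 by blast
  then show ?thesis using i assms(1) by (intro image_eqI[of _ _ i]) auto
qed

end
end

section \<open>Tree shapes\<close>

definition pairs_upto :: "nat \<Rightarrow> (nat \<times> nat) set" where
  "pairs_upto k = {(i, j). 1 \<le> i \<and> i < j \<and> j \<le> k}"

text \<open>A genealogy is encoded by its attachment times \<open>a\<close> and a shape \<open>f\<close>: samples \<open>i < j\<close> merge at the
  attachment time of sample \<open>f (i, j)\<close>.\<close>

definition gen_of :: "nat \<Rightarrow> (nat \<times> nat \<Rightarrow> nat) \<Rightarrow> (nat \<Rightarrow> real) \<Rightarrow> gmat" where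
  "gen_of k f a = (\<lambda>p. if p \<in> pairs_upto k then a (f p) else 0)"

definition usym :: "(nat \<times> nat \<Rightarrow> 'x) \<Rightarrow> nat \<Rightarrow> nat \<Rightarrow> 'x" where
  "usym f i j = f (min i j, max i j)"

definition shape_ok :: "(nat \<Rightarrow> real) \<Rightarrow> nat \<Rightarrow> (nat \<times> nat \<Rightarrow> nat) \<Rightarrow> (nat \<Rightarrow> real) \<Rightarrow> bool" where
  "shape_ok t k f a \<longleftrightarrow>
     (\<forall>p\<in>pairs_upto k. f p \<in> {2..k}) \<and>
     (\<forall>(i, j)\<in>pairs_upto k. a (f (i, j)) \<le> t i) \<and>
     (\<forall>i\<in>{1..k}. \<forall>j\<in>{1..k}. \<forall>l\<in>{1..k}. i \<noteq> j \<and> i \<noteq> l \<and> j \<noteq> l \<longrightarrow>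
        min (a (usym f i j)) (a (usym f i l)) \<le> a (usym f j l)) \<and>
     (\<forall>j\<in>{2..k}. \<exists>i\<in>{1..<j}. f (i, j) = j) \<and>
     (\<forall>(i, j)\<in>pairs_upto k. a (f (i, j)) \<le> a j) \<and>
     (\<forall>j\<in>{2..k}. \<forall>l\<in>{1..k}. a j = t l \<longrightarrow> l < j \<and> f (l, j) = j) \<and>
     (\<forall>i\<in>{1..k}. \<forall>j\<in>{i<..k}. \<forall>j'\<in>{j<..k}. a (f (i, j)) = t i \<and> a (f (i, j')) = t i \<longrightarrow> t i < a (f (j, j'))) \<and>
     (\<forall>j\<in>{2..k}. \<forall>j'\<in>{2..k}. a j = a j' \<longrightarrow> j = j')"

lemma usym_commute: "usym f i j = usym f j i"
  by (simp add: usym_def min.commute max.commute)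

lemma usym_less: "i < j \<Longrightarrow> usym f i j = f (i, j)"
  by (simp add: usym_def)

lemma usym_pairs: "i \<in> {1..k} \<Longrightarrow> j \<in> {1..k} \<Longrightarrow> i \<noteq> j \<Longrightarrow> (min i j, max i j) \<in> pairs_upto k"
  by (auto simp: pairs_upto_def)

context
  fixes t :: "nat \<Rightarrow> real" and k :: nat and f :: "nat \<times> nat \<Rightarrow> nat" and a :: "nat \<Rightarrow> real"
  assumes sh: "shape_ok t k f a"
begin

lemma shape_range: "p \<in> pairs_upto k \<Longrightarrow> f p \<in> {2..k}"
  by (rule sh[unfolded shape_ok_def, THEN conjunct1, rule_format])

lemma shape_le_t: "1 \<le> i \<Longrightarrow> i < j \<Longrightarrow> j \<le> k \<Longrightarrow> a (f (i, j)) \<le> t i"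
  using sh[unfolded shape_ok_def, THEN conjunct2, THEN conjunct1, THEN bspec, of "(i, j)"] by (simp add: pairs_upto_def)

lemma shape_ultra:
  "i \<in> {1..k} \<Longrightarrow> j \<in> {1..k} \<Longrightarrow> l \<in> {1..k} \<Longrightarrow> i \<noteq> j \<Longrightarrow> i \<noteq> l \<Longrightarrow> j \<noteq> l \<Longrightarrow>
    min (a (usym f i j)) (a (usym f i l)) \<le> a (usym f j l)"
  by (rule sh[unfolded shape_ok_def, THEN conjunct2, THEN conjunct2, THEN conjunct1, rule_format]) simp_all

lemma shape_parent: "j \<in> {2..k} \<Longrightarrow> \<exists>i\<in>{1..<j}. f (i, j) = j"
  by (rule sh[unfolded shape_ok_def, THEN conjunct2, THEN conjunct2, THEN conjunct2, THEN conjunct1, rule_format])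

lemma shape_le_a: "1 \<le> i \<Longrightarrow> i < j \<Longrightarrow> j \<le> k \<Longrightarrow> a (f (i, j)) \<le> a j"
  using sh[unfolded shape_ok_def, THEN conjunct2, THEN conjunct2, THEN conjunct2, THEN conjunct2, THEN conjunct1, THEN bspec, of "(i, j)"] by (simp add: pairs_upto_def)

lemma shape_direct: "j \<in> {2..k} \<Longrightarrow> l \<in> {1..k} \<Longrightarrow> a j = t l \<Longrightarrow> l < j \<and> f (l, j) = j"
  by (rule sh[unfolded shape_ok_def, THEN conjunct2, THEN conjunct2, THEN conjunct2, THEN conjunct2, THEN conjunct2, THEN conjunct1, THEN bspec, THEN bspec, THEN mp])

lemma shape_last:
  "1 \<le> i \<Longrightarrow> i < j \<Longrightarrow> j < j' \<Longrightarrow> j' \<le> k \<Longrightarrow> a (f (i, j)) = t i \<Longrightarrow> a (f (i, j')) = t i \<Longrightarrow> t i < a (f (j, j'))"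
proof -
  have *: "\<forall>i\<in>{1..k}. \<forall>j\<in>{i<..k}. \<forall>j'\<in>{j<..k}. a (f (i, j)) = t i \<and> a (f (i, j')) = t i \<longrightarrow> t i < a (f (j, j'))"
    by (rule sh[unfolded shape_ok_def, THEN conjunct2, THEN conjunct2, THEN conjunct2, THEN conjunct2, THEN conjunct2, THEN conjunct2, THEN conjunct1])
  assume "1 \<le> i" "i < j" "j < j'" "j' \<le> k" "a (f (i, j)) = t i" "a (f (i, j')) = t i"
  then show ?thesis by (intro *[rule_format]) auto
qed

lemma shape_inj: "j \<in> {2..k} \<Longrightarrow> j' \<in> {2..k} \<Longrightarrow> a j = a j' \<Longrightarrow> j = j'"
  by (rule sh[unfolded shape_ok_def, THEN conjunct2, THEN conjunct2, THEN conjunct2, THEN conjunct2, THEN conjunct2, THEN conjunct2, THEN conjunct2, rule_format])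

lemma shape_less_t:
  assumes "j \<in> {2..k}" shows "\<exists>i\<in>{1..<j}. a j \<le> t i"
proof -
  obtain i where "i \<in> {1..<j}" "f (i, j) = j" using shape_parent[OF assms] by blast
  with shape_le_t[of i j] assms show ?thesis by (intro bexI[of _ i]) auto
qed

lemma shape_reduce:
  assumes ij: "1 \<le> i" "i < j" "j \<le> k" and ne: "f (i, j) \<noteq> j"
    and p: "p \<in> {1..<j}" "f (p, j) = j"
  shows "i \<noteq> p" "a (usym f i p) = a (f (i, j))"
proof -
  show ip: "i \<noteq> p" using ne p by auto
  have "a (f (i, j)) \<noteq> a j"
    using shape_inj[of "f (i, j)" j] shape_range[of "(i, j)"] ij ne by (auto simp: pairs_upto_def)
  then have less: "a (f (i, j)) < a (f (p, j))" using shape_le_a[OF ij] p by simp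
  have 1: "min (a (usym f j i)) (a (usym f j p)) \<le> a (usym f i p)"
    using ij p ip by (intro shape_ultra) auto
  have 2: "min (a (usym f p i)) (a (usym f p j)) \<le> a (usym f i j)"
    using ij p ip by (intro shape_ultra) auto
  have "usym f j i = f (i, j)" "usym f j p = f (p, j)" "usym f p j = f (p, j)" "usym f i j = f (i, j)"
    "usym f p i = usym f i p"
    using ij p by (auto simp: usym_def min_def max_def)
  with 1 2 less show "a (usym f i p) = a (f (i, j))" by auto
qed

end

lemma (in moran_samples) shape_point:
  assumes sh: "shape_ok t k f a"
  shows "1 \<le> i \<Longrightarrow> i < j \<Longrightarrow> j \<le> k \<Longrightarrow> l \<in> {1..k} \<Longrightarrow> a (f (i, j)) = t l \<Longrightarrow> i = l"
proof (induction j arbitrary: i rule: less_induct)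
  case (less j)
  note ij = less.prems(1-3)
  have j2: "j \<in> {2..k}" using ij by auto
  show ?case
  proof (cases "f (i, j) = j")
    case True
    then have "a j = t l" using less.prems by simp
    from shape_direct[OF sh j2 less.prems(4) this] have l: "l < j" "f (l, j) = j" by auto
    show ?thesis
    proof (rule ccontr)
      assume il: "i \<noteq> l"
      have "min (a (usym f j i)) (a (usym f j l)) \<le> a (usym f i l)"
        using ij l il less.prems by (intro shape_ultra[OF sh]) auto
      moreover have "usym f j i = j" "usym f j l = j" using True l ij by (auto simp: usym_def min_def max_def)
      ultimately have ge: "t l \<le> a (usym f i l)" using \<open>a j = t l\<close> by simp
      show False
      proof (cases "i < l")
        case True
        then have "a (f (i, l)) \<le> t i" using ij less.prems l by (intro shape_le_t[OF sh]) auto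
        moreover have "t i < t l" using True by simp
        ultimately show False using ge unfolding usym_less[OF True] by linarith
      next
        case False
        with il have li: "l < i" by simp
        then have "a (f (l, i)) \<le> t l" using ij less.prems by (intro shape_le_t[OF sh]) auto
        with ge li have eq: "a (f (l, i)) = t l" by (simp add: usym_commute[of f i l] usym_less)
        have "t l < a (f (i, j))"
          using li ij less.prems eq l \<open>a j = t l\<close> by (intro shape_last[OF sh]) auto
        then show False using less.prems by simp
      qed
    qed
  next
    case False
    obtain p where p: "p \<in> {1..<j}" "f (p, j) = j" using shape_parent[OF sh j2] by blast
    note red = shape_reduce[OF sh ij False p]
    show ?thesis
    proof (cases "i < p")
      case True
      then have "a (f (i, p)) = t l" using red less.prems by (simp add: usym_less)
      then show ?thesis using less.IH[of p i] True ij p less.prems(4) by auto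
    next
      case pi: False
      then have "p < i" using red by simp
      then have "a (f (p, i)) = t l" using red less.prems by (simp add: usym_commute[of f i p] usym_less)
      then have "p = l" using less.IH[of i p] \<open>p < i\<close> ij p less.prems(4) by auto
      have "a (f (i, j)) \<noteq> a j"
        using shape_inj[OF sh, of "f (i, j)" j] shape_range[OF sh, of "(i, j)"] ij False by (auto simp: pairs_upto_def)
      then have "t l < a j" using shape_le_a[OF sh ij] less.prems by simp
      moreover have "a (f (p, j)) \<le> t p" using p ij by (intro shape_le_t[OF sh]) auto
      ultimately show ?thesis using p \<open>p = l\<close> by simp
    qed
  qed
qed

lemma shape_transfer:
  assumes sh: "shape_ok t k f a"
    and ab: "\<And>j j'. j \<in> {2..k} \<Longrightarrow> j' \<in> {2..k} \<Longrightarrow> a j < a j' \<longleftrightarrow> b j < b j'"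
    and at: "\<And>j i. j \<in> {2..k} \<Longrightarrow> i \<in> {1..k} \<Longrightarrow> (a j < t i \<longleftrightarrow> b j < t i) \<and> (a j = t i \<longleftrightarrow> b j = t i)"
  shows "shape_ok t k f b"
proof -
  note ran = shape_range[OF sh]
  have le: "a j \<le> a j' \<longleftrightarrow> b j \<le> b j'" if "j \<in> {2..k}" "j' \<in> {2..k}" for j j'
    using ab[OF that(2,1)] by (auto simp: not_less[symmetric])
  have eq: "a j = a j' \<longleftrightarrow> b j = b j'" if "j \<in> {2..k}" "j' \<in> {2..k}" for j j'
    using le[OF that] le[OF that(2,1)] by (auto simp: eq_iff)
  have letT: "a j \<le> t i \<longleftrightarrow> b j \<le> t i" if "j \<in> {2..k}" "i \<in> {1..k}" for j i
    using at[OF that] by (auto simp: le_less)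
  have ltt: "t i < a j \<longleftrightarrow> t i < b j" if "j \<in> {2..k}" "i \<in> {1..k}" for j i
    using letT[OF that] by (auto simp: not_le[symmetric])
  have us: "usym f i j \<in> {2..k}" if "i \<in> {1..k}" "j \<in> {1..k}" "i \<noteq> j" for i j
    unfolding usym_def by (rule ran[OF usym_pairs[OF that]])
  show ?thesis
    unfolding shape_ok_def
  proof (intro conjI ballI impI)
    fix p assume "p \<in> pairs_upto k" then show "f p \<in> {2..k}" by (rule ran)
  next
    fix p assume p: "p \<in> pairs_upto k"
    obtain i j where ij: "p = (i, j)" by (cases p)
    have "i \<in> {1..k}" "j \<in> {2..k}" using p ij by (auto simp: pairs_upto_def)
    then show "case p of (i, j) \<Rightarrow> b (f (i, j)) \<le> t i" "case p of (i, j) \<Rightarrow> b (f (i, j)) \<le> b j"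
      using letT[OF ran[OF p], of i] le[OF ran[OF p], of j] shape_le_t[OF sh, of i j] shape_le_a[OF sh, of i j] p
      unfolding ij by (auto simp: pairs_upto_def)
  next
    fix i j l assume H: "i \<in> {1..k}" "j \<in> {1..k}" "l \<in> {1..k}" "i \<noteq> j \<and> i \<noteq> l \<and> j \<noteq> l"
    then have "min (a (usym f i j)) (a (usym f i l)) \<le> a (usym f j l)" by (intro shape_ultra[OF sh]) auto
    then show "min (b (usym f i j)) (b (usym f i l)) \<le> b (usym f j l)"
      using le[OF us us, of i j j l] le[OF us us, of i l j l] H by (auto simp: min_le_iff_disj)
  next
    fix j assume "j \<in> {2..k}" then show "\<exists>i\<in>{1..<j}. f (i, j) = j" by (rule shape_parent[OF sh])
  next
    fix j l assume "j \<in> {2..k}" "l \<in> {1..k}" "b j = t l"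
    then show "l < j" "f (l, j) = j" using shape_direct[OF sh, of j l] at[of j l] by auto
  next
    fix i j j' assume H: "i \<in> {1..k}" "j \<in> {i<..k}" "j' \<in> {j<..k}" "b (f (i, j)) = t i \<and> b (f (i, j')) = t i"
    have P: "(i, j) \<in> pairs_upto k" "(i, j') \<in> pairs_upto k" "(j, j') \<in> pairs_upto k"
      using H by (auto simp: pairs_upto_def)
    have "t i < a (f (j, j'))"
      using H at[OF ran[OF P(1)] H(1)] at[OF ran[OF P(2)] H(1)] by (intro shape_last[OF sh]) auto
    then show "t i < b (f (j, j'))" using ltt[OF ran[OF P(3)] H(1)] by simp
  next
    fix j j' assume "j \<in> {2..k}" "j' \<in> {2..k}" "b j = b j'"
    then show "j = j'" using shape_inj[OF sh, of j j'] eq[of j j'] by auto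
  qed
qed

context moran_samples begin

lemma gen_of_apply: "1 \<le> i \<Longrightarrow> i < j \<Longrightarrow> j \<le> k \<Longrightarrow> gen_of k f a (i, j) = a (f (i, j))"
  by (simp add: gen_of_def pairs_upto_def)

lemma gen_of_gsym: "i \<in> {1..k} \<Longrightarrow> j \<in> {1..k} \<Longrightarrow> i \<noteq> j \<Longrightarrow> gsym (gen_of k f a) i j = a (usym f i j)"
  unfolding gsym_def usym_def by (intro gen_of_apply) auto

lemma g_attach_gen_of:
  assumes sh: "shape_ok t k f a" and j: "j \<in> {2..k}"
  shows "g_attach (gen_of k f a) j = a j"
proof (rule g_attach_eqI)
  obtain i where i: "i \<in> {1..<j}" "f (i, j) = j" using shape_parent[OF sh j] by blast
  then show "\<exists>i. 1 \<le> i \<and> i < j \<and> gen_of k f a (i, j) = a j"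
    using j by (intro exI[of _ i]) (auto simp: gen_of_apply)
  fix i assume "1 \<le> i" "i < j"
  then show "gen_of k f a (i, j) \<le> a j" using shape_le_a[OF sh, of i j] j by (simp add: gen_of_apply)
qed

lemma attach_vec_gen_of:
  assumes "shape_ok t k f a" "a \<in> extensional {2..k}"
  shows "attach_vec k (gen_of k f a) = a"
  unfolding attach_vec_def using assms g_attach_gen_of[OF assms(1)]
  by (auto simp: fun_eq_iff extensional_def restrict_def)

lemma gen_ok_gen_of:
  assumes sh: "shape_ok t k f a"
  shows "gen_ok t k (gen_of k f a)"
  unfolding gen_ok_def valid_gen_def
proof (intro conjI allI impI ballI)
  show "trunc k (gen_of k f a) = gen_of k f a"
    by (auto simp: trunc_def gen_of_def pairs_upto_def fun_eq_iff)
  show "inj_on (g_attach (gen_of k f a)) {2..k}"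
  proof (rule inj_onI)
    fix j j' assume "j \<in> {2..k}" "j' \<in> {2..k}" "g_attach (gen_of k f a) j = g_attach (gen_of k f a) j'"
    then show "j = j'" using shape_inj[OF sh, of j j'] g_attach_gen_of[OF sh, of j] g_attach_gen_of[OF sh, of j'] by simp
  qed
next
  fix i j assume "1 \<le> i \<and> i < j \<and> j \<le> k"
  then show "gen_of k f a (i, j) \<le> t i" using shape_le_t[OF sh] by (simp add: gen_of_apply)
next
  fix i j l assume "i \<in> {1..k}" "j \<in> {1..k}" "l \<in> {1..k}" "i \<noteq> j \<and> i \<noteq> l \<and> j \<noteq> l"
  then show "min (gsym (gen_of k f a) i j) (gsym (gen_of k f a) i l) \<le> gsym (gen_of k f a) j l"
    using shape_ultra[OF sh, of i j l] by (simp add: gen_of_gsym)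
next
  fix j l assume j: "j \<in> {2..k}" and l: "1 \<le> l" and "g_attach (gen_of k f a) j = t l"
  then have eq: "a j = t l" using g_attach_gen_of[OF sh j] by simp
  obtain i where i: "i \<in> {1..<j}" "a j \<le> t i" using shape_less_t[OF sh j] by blast
  then have "l \<le> i" using eq by simp
  then have "l \<in> {1..k}" using l i j by auto
  from shape_direct[OF sh j this eq] have *: "l < j" "f (l, j) = j" by auto
  then show "l < j" by simp
  show "gen_of k f a (l, j) = t l" using * l j eq by (simp add: gen_of_apply)
next
  fix i j j' assume H: "1 \<le> i \<and> i < j \<and> j < j' \<and> j' \<le> k \<and> gen_of k f a (i, j) = t i \<and> gen_of k f a (i, j') = t i"
  then have ij: "1 \<le> i" "i < j" "j < j'" "j' \<le> k" by simp_all
  have "a (f (i, j)) = t i" using H gen_of_apply[of i j k f a] ij by (metis le_trans less_imp_le)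
  moreover have "a (f (i, j')) = t i" using H gen_of_apply[of i j' k f a] ij by (metis less_trans)
  ultimately have "t i < a (f (j, j'))" by (intro shape_last[OF sh ij])
  then show "t i < gen_of k f a (j, j')" using gen_of_apply[of j j' k f a] ij by simp
qed

lemma gen_ok_attained:
  assumes ok: "gen_ok t k g"
  shows "1 \<le> i \<Longrightarrow> i < j \<Longrightarrow> j \<le> k \<Longrightarrow> \<exists>j'\<in>{2..k}. g (i, j) = g_attach g j'"
proof (induction j arbitrary: i rule: less_induct)
  case (less j)
  have j: "2 \<le> j" "j \<in> {2..k}" using less.prems by auto
  have v: "valid_gen t k g" using ok by (simp add: gen_ok_def)
  have ultra: "min (gsym g i j) (gsym g i l) \<le> gsym g j l"
    if "i \<in> {1..k}" "j \<in> {1..k}" "l \<in> {1..k}" "i \<noteq> j" "i \<noteq> l" "j \<noteq> l" for i j l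
    using that by (intro v[unfolded valid_gen_def, THEN conjunct2, THEN conjunct2, THEN conjunct1, rule_format]) simp_all
  obtain p where p: "1 \<le> p" "p < j" "g (p, j) = g_attach g j" using g_attach_props(1)[OF j(1)] by blast
  show ?case
  proof (cases "g (i, j) = g_attach g j")
    case True
    then show ?thesis using j by auto
  next
    case False
    then have less': "g (i, j) < g (p, j)" using g_attach_props(2)[OF j(1), of i g] less.prems p by simp
    then have ip: "i \<noteq> p" by auto
    have 1: "min (gsym g j i) (gsym g j p) \<le> gsym g i p" using less.prems p ip by (intro ultra) auto
    have 2: "min (gsym g p i) (gsym g p j) \<le> gsym g i j" using less.prems p ip by (intro ultra) auto
    have "gsym g j i = g (i, j)" "gsym g j p = g (p, j)" "gsym g p j = g (p, j)" "gsym g i j = g (i, j)"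
      "gsym g p i = gsym g i p"
      using less.prems p by (auto simp: gsym_def min_def max_def)
    with 1 2 less' have eq: "gsym g i p = g (i, j)" by auto
    show ?thesis
    proof (cases "i < p")
      case True
      then show ?thesis using less.IH[of p i] eq less.prems p by (auto simp: gsym_def)
    next
      case False
      then show ?thesis using less.IH[of i p] eq less.prems p ip by (auto simp: gsym_def)
    qed
  qed
qed

lemma gen_ok_shape:
  assumes ok: "gen_ok t k g"
  shows "\<exists>f\<in>PiE (pairs_upto k) (\<lambda>_. {2..k}). shape_ok t k f (attach_vec k g) \<and> gen_of k f (attach_vec k g) = g"
proof -
  define f where "f = (\<lambda>p\<in>pairs_upto k. SOME j'. j' \<in> {2..k} \<and> g p = g_attach g j')"
  define a where "a = attach_vec k g"
  have a: "a j = g_attach g j" if "j \<in> {2..k}" for j using that by (simp add: a_def attach_vec_def)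
  have f: "f p \<in> {2..k} \<and> g p = g_attach g (f p)" if "p \<in> pairs_upto k" for p
  proof -
    obtain i j where p: "p = (i, j)" by (cases p)
    have "\<exists>j'. j' \<in> {2..k} \<and> g p = g_attach g j'"
      using gen_ok_attained[OF ok, of i j] that by (auto simp: p pairs_upto_def)
    from someI_ex[OF this] show ?thesis using that by (simp add: f_def)
  qed
  have gf: "g p = a (f p)" if "p \<in> pairs_upto k" for p using f[OF that] a by simp
  have v: "valid_gen t k g" and inj: "inj_on (g_attach g) {2..k}" using ok by (auto simp: gen_ok_def)
  have gs: "gsym g i j = a (usym f i j)" if "i \<in> {1..k}" "j \<in> {1..k}" "i \<noteq> j" for i j
    unfolding gsym_def usym_def by (rule gf[OF usym_pairs[OF that]])
  have sh: "shape_ok t k f a"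
    unfolding shape_ok_def
  proof (intro conjI ballI impI)
    fix p assume "p \<in> pairs_upto k" then show "f p \<in> {2..k}" using f by blast
  next
    fix p assume p: "p \<in> pairs_upto k"
    obtain i j where ij: "p = (i, j)" by (cases p)
    have "g (i, j) \<le> t i" using v[unfolded valid_gen_def, THEN conjunct2, THEN conjunct1] p ij by (simp add: pairs_upto_def)
    then show "case p of (i, j) \<Rightarrow> a (f (i, j)) \<le> t i" using gf[OF p] ij by simp
    have "g (i, j) \<le> g_attach g j" "j \<in> {2..k}"
      using g_attach_props(2)[of j i g] p ij by (auto simp: pairs_upto_def)
    then show "case p of (i, j) \<Rightarrow> a (f (i, j)) \<le> a j" using gf[OF p] ij a by simp
  next
    fix i j l assume H: "i \<in> {1..k}" "j \<in> {1..k}" "l \<in> {1..k}" "i \<noteq> j \<and> i \<noteq> l \<and> j \<noteq> l"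
    then have "min (gsym g i j) (gsym g i l) \<le> gsym g j l"
      by (intro v[unfolded valid_gen_def, THEN conjunct2, THEN conjunct2, THEN conjunct1, rule_format]) simp_all
    then show "min (a (usym f i j)) (a (usym f i l)) \<le> a (usym f j l)" using gs H by simp
  next
    fix j assume j: "j \<in> {2..k}"
    then have "2 \<le> j" by simp
    then obtain i where i: "1 \<le> i" "i < j" "g (i, j) = g_attach g j" using g_attach_props(1) by blast
    then have p: "(i, j) \<in> pairs_upto k" using j by (auto simp: pairs_upto_def)
    have "f (i, j) = j" using f[OF p] i j inj by (auto simp: inj_on_def)
    then show "\<exists>i\<in>{1..<j}. f (i, j) = j" using i by auto
  next
    fix j l assume j: "j \<in> {2..k}" and l: "l \<in> {1..k}" and eq: "a j = t l"
    then have "g_attach g j = t l" using a by simp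
    then have *: "l < j" "g (l, j) = t l"
      using v[unfolded valid_gen_def, THEN conjunct2, THEN conjunct2, THEN conjunct2, THEN conjunct1, rule_format, of j l] j l by simp_all
    then show "l < j" by simp
    have p: "(l, j) \<in> pairs_upto k" using * j l by (auto simp: pairs_upto_def)
    show "f (l, j) = j" using f[OF p] * eq a j inj by (auto simp: inj_on_def)
  next
    fix i j j' assume H: "i \<in> {1..k}" "j \<in> {i<..k}" "j' \<in> {j<..k}" "a (f (i, j)) = t i \<and> a (f (i, j')) = t i"
    have P: "(i, j) \<in> pairs_upto k" "(i, j') \<in> pairs_upto k" "(j, j') \<in> pairs_upto k"
      using H by (auto simp: pairs_upto_def)
    have "t i < g (j, j')"
      using v[unfolded valid_gen_def, THEN conjunct2, THEN conjunct2, THEN conjunct2, THEN conjunct2, rule_format, of i j j'] H gf[OF P(1)] gf[OF P(2)] by simp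
    then show "t i < a (f (j, j'))" using gf[OF P(3)] by simp
  next
    fix j j' assume "j \<in> {2..k}" "j' \<in> {2..k}" "a j = a j'"
    then show "j = j'" using inj a by (auto simp: inj_on_def)
  qed
  have "gen_of k f a = g"
  proof
    fix p
    have "g p = trunc k g p" by (rule fun_cong[OF v[unfolded valid_gen_def, THEN conjunct1, symmetric]])
    also have "trunc k g p = (if p \<in> pairs_upto k then g p else 0)"
      by (cases p) (simp add: trunc_def pairs_upto_def)
    finally have "g p = 0" if "p \<notin> pairs_upto k" using that by simp
    then show "gen_of k f a p = g p" using gf by (auto simp: gen_of_def)
  qed
  moreover have "f \<in> PiE (pairs_upto k) (\<lambda>_. {2..k})" using f by (auto simp: f_def)
  ultimately show ?thesis using sh unfolding a_def by blast
qed

lemma gen_of_inj: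
  assumes "f \<in> PiE (pairs_upto k) (\<lambda>_. {2..k})" "f' \<in> PiE (pairs_upto k) (\<lambda>_. {2..k})"
    and sh: "shape_ok t k f a" and eq: "gen_of k f a = gen_of k f' a"
  shows "f = f'"
proof (rule PiE_ext[OF assms(1,2)])
  fix p assume p: "p \<in> pairs_upto k"
  have "a (f p) = a (f' p)" using fun_cong[OF eq, of p] p by (simp add: gen_of_def)
  then show "f p = f' p" using assms(1,2) p by (intro shape_inj[OF sh]) auto
qed

end

section \<open>Probability of a cell\<close>

text \<open>\<open>lo j = hi j\<close> encodes attachment at a sample time, \<open>lo j < hi j\<close> a branch point.\<close>

definition cell_set :: "(nat \<Rightarrow> real) \<Rightarrow> (nat \<Rightarrow> real) \<Rightarrow> nat \<Rightarrow> real set" where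
  "cell_set lo hi j = (if lo j < hi j then {lo j<..hi j} else {hi j})"

locale cell = moran_samples +
  fixes k :: nat and f :: "nat \<times> nat \<Rightarrow> nat" and lo hi a0 :: "nat \<Rightarrow> real"
  assumes k2: "2 \<le> k"
    and sh0: "shape_ok t k f a0"
    and lohi: "\<And>j. j \<in> {2..k} \<Longrightarrow> lo j \<le> hi j"
    and a0J: "\<And>j. j \<in> {2..k} \<Longrightarrow> a0 j \<in> cell_set lo hi j"
    and pt: "\<And>j. j \<in> {2..k} \<Longrightarrow> lo j = hi j \<Longrightarrow> lo j \<in> t ` {1..k}"
    and br: "\<And>j x. j \<in> {2..k} \<Longrightarrow> lo j < hi j \<Longrightarrow> lo j \<le> x \<Longrightarrow> x \<le> hi j \<Longrightarrow> x \<notin> insert 0 (t ` {1..k})"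
    and disj: "\<And>j j' x. j \<in> {2..k} \<Longrightarrow> j' \<in> {2..k} \<Longrightarrow> j \<noteq> j' \<Longrightarrow>
      lo j \<le> x \<Longrightarrow> x \<le> hi j \<Longrightarrow> lo j' \<le> x \<Longrightarrow> x \<le> hi j' \<Longrightarrow> False"
begin

definition in_box :: "(nat \<Rightarrow> real) \<Rightarrow> bool" where
  "in_box b \<longleftrightarrow> (\<forall>j\<in>{2..k}. b j \<in> cell_set lo hi j)"

lemma in_box_a0: "in_box a0"
  using a0J by (simp add: in_box_def)

lemma box_bounds:
  assumes "in_box b" "j \<in> {2..k}"
  shows "lo j \<le> b j" "b j \<le> hi j" "lo j < hi j \<Longrightarrow> lo j < b j"
proof -
  have "b j \<in> cell_set lo hi j" using assms by (simp add: in_box_def)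
  then show "lo j \<le> b j" "b j \<le> hi j" "lo j < hi j \<Longrightarrow> lo j < b j"
    using lohi[OF assms(2)] by (auto simp: cell_set_def split: if_splits)
qed

lemma cells_ordered:
  assumes "j \<in> {2..k}" "j' \<in> {2..k}" "j \<noteq> j'"
  shows "hi j < lo j' \<or> hi j' < lo j"
proof (rule ccontr)
  assume "\<not> ?thesis"
  then show False
    using disj[OF assms, of "max (lo j) (lo j')"] lohi[OF assms(1)] lohi[OF assms(2)] by auto
qed

lemma box_less_iff:
  assumes "in_box b" "j \<in> {2..k}" "j' \<in> {2..k}" "j \<noteq> j'"
  shows "b j < b j' \<longleftrightarrow> hi j < lo j'"
  using cells_ordered[OF assms(2-4)] box_bounds[OF assms(1,2)] box_bounds[OF assms(1,3)] by auto

lemma box_t: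
  assumes b: "in_box b" and j: "j \<in> {2..k}" and i: "i \<in> {1..k}"
  shows "(b j < t i \<longleftrightarrow> hi j < t i) \<and> (b j = t i \<longleftrightarrow> lo j = hi j \<and> hi j = t i)"
proof (cases "lo j < hi j")
  case True
  have "t i < lo j \<or> hi j < t i" using br[OF j True, of "t i"] i by force
  then show ?thesis using box_bounds[OF b j] True by auto
next
  case False
  then have "lo j = hi j" using lohi[OF j] by simp
  moreover from this have "b j = hi j" using box_bounds[OF b j] by simp
  ultimately have "b j = hi j" "lo j = hi j" by simp_all
  then show ?thesis by simp
qed

lemma box_shape: "in_box b \<Longrightarrow> shape_ok t k f b"
proof (rule shape_transfer[OF sh0])
  assume b: "in_box b"
  show "a0 j < a0 j' \<longleftrightarrow> b j < b j'" if "j \<in> {2..k}" "j' \<in> {2..k}" for j j'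
    using box_less_iff[OF in_box_a0 that] box_less_iff[OF b that] by (cases "j = j'") auto
  show "(a0 j < t i \<longleftrightarrow> b j < t i) \<and> (a0 j = t i \<longleftrightarrow> b j = t i)" if "j \<in> {2..k}" "i \<in> {1..k}" for j i
    using box_t[OF in_box_a0 that] box_t[OF b that] by simp
qed

lemma f_range: "1 \<le> i \<Longrightarrow> i < j \<Longrightarrow> j \<le> k \<Longrightarrow> f (i, j) \<in> {2..k}"
  using shape_range[OF sh0, of "(i, j)"] by (simp add: pairs_upto_def)

lemma usym_range: "i \<in> {1..k} \<Longrightarrow> j \<in> {1..k} \<Longrightarrow> i \<noteq> j \<Longrightarrow> usym f i j \<in> {2..k}"
  unfolding usym_def by (rule f_range) auto

lemma lo_mono:
  assumes "j \<in> {2..k}" "j' \<in> {2..k}" "a0 j \<le> a0 j'"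
  shows "lo j \<le> lo j'"
proof (cases "j = j'")
  case False
  then have "a0 j \<noteq> a0 j'" using shape_inj[OF sh0 assms(1,2)] by blast
  then have "hi j < lo j'" using box_less_iff[OF in_box_a0 assms(1,2) False] assms(3) by simp
  then show ?thesis using lohi[OF assms(1)] by simp
qed simp

lemma lo_inj: "j \<in> {2..k} \<Longrightarrow> j' \<in> {2..k} \<Longrightarrow> lo j = lo j' \<Longrightarrow> j = j'"
  using disj[of j j' "lo j"] lohi[of j] lohi[of j'] by (cases "j = j'") auto

lemma lo_le_t: "1 \<le> i \<Longrightarrow> i < j \<Longrightarrow> j \<le> k \<Longrightarrow> lo (f (i, j)) \<le> t i"
  using box_bounds(1)[OF in_box_a0 f_range, of i j] shape_le_t[OF sh0, of i j] by simp

lemma lo_le_lo: "1 \<le> i \<Longrightarrow> i < j \<Longrightarrow> j \<le> k \<Longrightarrow> lo (f (i, j)) \<le> lo j"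
  using shape_le_a[OF sh0, of i j] by (intro lo_mono f_range) auto

text \<open>Samples \<open>i\<close> and \<open>j\<close> have merged by (backward) time \<open>v\<close> in every genealogy of the cell.\<close>

definition conn :: "real \<Rightarrow> nat \<Rightarrow> nat \<Rightarrow> bool" where
  "conn v i j \<longleftrightarrow> i = j \<or> v \<le> lo (usym f i j)"

lemma conn_refl: "conn v i i"
  by (simp add: conn_def)

lemma conn_sym: "conn v i j \<longleftrightarrow> conn v j i"
  by (auto simp: conn_def usym_commute[of f i j])

lemma conn_trans:
  assumes ij: "conn v i j" and jl: "conn v j l" and r: "i \<in> {1..k}" "j \<in> {1..k}" "l \<in> {1..k}"
  shows "conn v i l"
proof -
  consider "i = j" | "j = l" | "i = l" | "i \<noteq> j" "j \<noteq> l" "i \<noteq> l" by blast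
  then show ?thesis
  proof cases
    case 4
    have *: "min (a0 (usym f j i)) (a0 (usym f j l)) \<le> a0 (usym f i l)"
      using r 4 by (intro shape_ultra[OF sh0]) auto
    have "min (lo (usym f j i)) (lo (usym f j l)) \<le> lo (usym f i l)"
    proof (cases "a0 (usym f j i) \<le> a0 (usym f j l)")
      case True
      then have "lo (usym f j i) \<le> lo (usym f i l)" using * r 4 by (intro lo_mono usym_range) auto
      then show ?thesis by simp
    next
      case False
      then have "lo (usym f j l) \<le> lo (usym f i l)" using * r 4 by (intro lo_mono usym_range) auto
      then show ?thesis by simp
    qed
    then show ?thesis using ij jl 4 by (auto simp: conn_def usym_commute[of f i j])
  qed (use ij jl in \<open>auto simp: conn_def\<close>)
qed

text \<open>The time axis is cut at \<open>c 0 > c 1 > \<dots> > c m\<close>. Time 0 has to be among them because the Poisson process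
  is built from two independent halves glued there.\<close>

definition crit0 :: "real set" where
  "crit0 = insert 0 (t ` {1..k}) \<union> lo ` {2..k} \<union> hi ` {2..k}"

definition top_time :: real where "top_time = Max crit0 + 1"

definition crit :: "real set" where "crit = insert top_time crit0"

definition m :: nat where "m = card crit - 1"

definition c :: "nat \<Rightarrow> real" where "c q = rev (sorted_list_of_set crit) ! q"

lemma finite_crit: "finite crit0" "finite crit"
  by (auto simp: crit0_def crit_def)

lemma crit0_less_top: "x \<in> crit0 \<Longrightarrow> x < top_time"
  using Max_ge[OF finite_crit(1), of x] by (simp add: top_time_def)

lemma card_crit: "card crit = Suc m"
  using finite_crit by (auto simp: m_def crit_def card_gt_0_iff)

lemma c_less: "q < q' \<Longrightarrow> q' \<le> m \<Longrightarrow> c q' < c q"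
proof -
  assume q: "q < q'" "q' \<le> m"
  have "sorted_wrt (>) (rev (sorted_list_of_set crit))"
    by (simp add: sorted_wrt_rev strict_sorted_list_of_set)
  from sorted_wrt_nth_less[OF this q(1)] show ?thesis
    using q finite_crit by (simp add: c_def card_crit)
qed

lemma c_image: "c ` {..m} = crit"
proof -
  let ?l = "rev (sorted_list_of_set crit)"
  have "crit = set ?l" using finite_crit by simp
  also have "\<dots> = (\<lambda>q. ?l ! q) ` {..<length ?l}" by (auto simp: set_conv_nth)
  also have "{..<length ?l} = {..m}" using finite_crit by (auto simp: card_crit)
  finally show ?thesis by (simp add: c_def)
qed

lemma c_in_crit: "q \<le> m \<Longrightarrow> c q \<in> crit"
  using c_image by auto

lemma crit_c: "x \<in> crit \<Longrightarrow> \<exists>q\<le>m. c q = x"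
  using c_image by force

lemma c_consec:
  assumes x: "x \<in> crit" and q: "q < m" and less: "c (Suc q) < x"
  shows "c q \<le> x"
proof -
  obtain q' where q': "q' \<le> m" "x = c q'" using crit_c[OF x] by auto
  have "q' \<le> q"
  proof (rule ccontr)
    assume "\<not> q' \<le> q"
    then have "Suc q = q' \<or> Suc q < q'" by auto
    then have "c q' \<le> c (Suc q)" using c_less[of "Suc q" q'] q' by auto
    then show False using less q' by simp
  qed
  then show ?thesis using c_less[of q q'] c_less[of q' q] q q' by (cases "q' = q") auto
qed

lemma c_squeeze:
  assumes "x \<in> crit" "q < m" "c (Suc q) \<le> x" "\<not> c q \<le> x"
  shows "x = c (Suc q)"
  using c_consec[OF assms(1,2)] assms(3,4) by (cases "c (Suc q) < x") auto

lemma c_0: "c 0 = top_time"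
proof -
  obtain q where q: "q \<le> m" "c q = top_time" using crit_c[of top_time] by (auto simp: crit_def)
  show ?thesis
  proof (rule ccontr)
    assume "c 0 \<noteq> top_time"
    then have "c 0 < top_time" using c_in_crit[of 0] crit0_less_top by (auto simp: crit_def)
    moreover have "0 < q" using q \<open>c 0 \<noteq> top_time\<close> by (cases q) auto
    ultimately show False using c_less[of 0 q] q by simp
  qed
qed

lemma crit_t: "i \<in> {1..k} \<Longrightarrow> t i \<in> crit"
  by (auto simp: crit_def crit0_def)

lemma crit_lo: "j \<in> {2..k} \<Longrightarrow> lo j \<in> crit"
  by (auto simp: crit_def crit0_def)

lemma crit_hi: "j \<in> {2..k} \<Longrightarrow> hi j \<in> crit"
  by (auto simp: crit_def crit0_def)

lemma crit_avoid:
  assumes x: "x \<in> crit" and j: "j \<in> {2..k}"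
  shows "x \<le> lo j \<or> hi j \<le> x"
proof (rule ccontr)
  assume "\<not> ?thesis"
  then have less: "lo j < x" "x < hi j" by auto
  then have lh: "lo j < hi j" by simp
  have "x \<noteq> top_time" using less crit0_less_top[of "hi j"] j by (auto simp: crit0_def)
  then have "x \<in> crit0" using x by (simp add: crit_def)
  moreover have "x \<notin> insert 0 (t ` {1..k})" using br[OF j lh, of x] less by simp
  ultimately obtain j' where j': "j' \<in> {2..k}" "x = lo j' \<or> x = hi j'" by (auto simp: crit0_def)
  then have "j' \<noteq> j" using less by auto
  moreover have "lo j' \<le> x" "x \<le> hi j'" using j' lohi[OF j'(1)] by auto
  ultimately show False using disj[OF j'(1) j, of x] less by simp
qed

definition I :: "nat \<Rightarrow> nat set" where "I q = {i\<in>{1..k}. c q \<le> t i}"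

lemma I_sub: "i \<in> I q \<Longrightarrow> i \<in> {1..k}"
  by (simp add: I_def)

lemma finite_I: "finite (I q)"
  by (simp add: I_def)

definition agree :: "nat \<Rightarrow> (nat \<Rightarrow> nat) \<Rightarrow> bool" where
  "agree q x \<longleftrightarrow> (\<forall>i\<in>I q. x i < n) \<and> (\<forall>i\<in>I q. \<forall>j\<in>I q. x i = x j \<longleftrightarrow> conn (c q) i j)"

lemma agree_conn: "agree q x \<Longrightarrow> i \<in> I q \<Longrightarrow> j \<in> I q \<Longrightarrow> x i = x j \<longleftrightarrow> conn (c q) i j"
  by (simp add: agree_def)

text \<open>Each block of merged lines is represented by its smallest sample.\<close>

definition roots :: "nat \<Rightarrow> nat set" where "roots q = {i\<in>I q. i = 1 \<or> lo i < c q}"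

lemma root_exists: "i \<in> I q \<Longrightarrow> \<exists>r\<in>roots q. r \<le> i \<and> conn (c q) r i"
proof (induction i rule: less_induct)
  case (less i)
  show ?case
  proof (cases "i \<in> roots q")
    case True
    then show ?thesis by (auto simp: conn_def)
  next
    case False
    then have i: "i \<in> {2..k}" "c q \<le> lo i" using less.prems by (auto simp: roots_def I_def)
    obtain p where p: "p \<in> {1..<i}" "f (p, i) = i" using shape_parent[OF sh0 i(1)] by blast
    have "lo i \<le> t p" using lo_le_t[of p i] p i by simp
    then have pI: "p \<in> I q" using i p by (auto simp: I_def)
    obtain r where r: "r \<in> roots q" "r \<le> p" "conn (c q) r p" using less.IH[of p] p pI by auto
    have "conn (c q) p i" using p i by (auto simp: conn_def usym_less)
    then have "conn (c q) r i"
      using r pI less.prems by (intro conn_trans[of "c q" r p i]) (auto simp: roots_def dest: I_sub)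
    then show ?thesis using r p by (intro bexI[of _ r]) auto
  qed
qed

lemma root_unique:
  assumes "r \<in> roots q" "s \<in> roots q" "conn (c q) r s"
  shows "r = s"
proof (rule ccontr)
  assume "r \<noteq> s"
  have *: False if "r \<in> roots q" "s \<in> roots q" "conn (c q) r s" "r < s" for r s
  proof -
    have rs: "1 \<le> r" "s \<le> k" using that by (auto simp: roots_def I_def)
    have "c q \<le> lo (f (r, s))" using that by (auto simp: conn_def usym_less)
    also have "\<dots> \<le> lo s" using lo_le_lo[of r s] rs that by simp
    finally show False using that rs by (auto simp: roots_def)
  qed
  show False using *[of r s] *[of s r] assms \<open>r \<noteq> s\<close> conn_sym[of "c q" r s] by (cases "r < s") auto
qed

lemma card_labels:
  assumes ag: "agree q x"
  shows "card (x ` I q) = card (roots q)"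
proof -
  have sub: "roots q \<subseteq> I q" by (auto simp: roots_def)
  have "x ` I q = x ` roots q"
  proof
    show "x ` I q \<subseteq> x ` roots q"
    proof
      fix y assume "y \<in> x ` I q"
      then obtain i where i: "i \<in> I q" "y = x i" by auto
      obtain r where r: "r \<in> roots q" "conn (c q) r i" using root_exists[OF i(1)] by blast
      then have "x r = x i" using agree_conn[OF ag, of r i] i sub by auto
      then show "y \<in> x ` roots q" using i r by (auto intro!: image_eqI[of _ _ r])
    qed
  qed (use sub in auto)
  moreover have "inj_on x (roots q)"
  proof (rule inj_onI)
    fix r s assume "r \<in> roots q" "s \<in> roots q" "x r = x s"
    then show "r = s" using root_unique[of r q s] agree_conn[OF ag, of r s] sub by auto
  qed
  ultimately show ?thesis by (simp add: card_image)
qed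

definition merge_step :: "nat \<Rightarrow> bool" where
  "merge_step q \<longleftrightarrow> (\<exists>j\<in>{2..k}. lo j < hi j \<and> lo j = c (Suc q))"

definition point_step :: "nat \<Rightarrow> bool" where
  "point_step q \<longleftrightarrow> (\<exists>j\<in>{2..k}. lo j = hi j \<and> lo j = c (Suc q))"

definition samp_step :: "nat \<Rightarrow> bool" where
  "samp_step q \<longleftrightarrow> c (Suc q) \<in> t ` {1..k}"

definition num_blocks :: "nat \<Rightarrow> nat" where "num_blocks q = card (roots q)"

definition flow_fac :: "nat \<Rightarrow> real" where
  "flow_fac q = (if merge_step q
     then (exp (- \<mu> * pair_rate (real (num_blocks q) - 1) * (c q - c (Suc q))) - exp (- \<mu> * pair_rate (num_blocks q) * (c q - c (Suc q))))
       / (real (num_blocks q) - 1)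
     else exp (- \<mu> * pair_rate (num_blocks q) * (c q - c (Suc q))))"

definition samp_fac :: "nat \<Rightarrow> real" where
  "samp_fac q = (if \<not> samp_step q then 1 else if point_step q then 1 / real n else 1 - real (num_blocks q) / real n)"

lemma no_merge_conn:
  assumes q: "q < m" and ij: "i \<in> I q" "j \<in> I q" "i \<noteq> j" and "conn (c (Suc q)) i j" "\<not> conn (c q) i j"
  shows "usym f i j \<in> {2..k} \<and> lo (usym f i j) < hi (usym f i j) \<and> lo (usym f i j) = c (Suc q)"
proof -
  let ?p = "usym f i j"
  have p: "?p \<in> {2..k}" using ij by (intro usym_range) (auto dest: I_sub)
  have "c (Suc q) \<le> lo ?p" "\<not> c q \<le> lo ?p" using assms(5,6) ij by (auto simp: conn_def)
  then have eq: "lo ?p = c (Suc q)" by (rule c_squeeze[OF crit_lo[OF p] q])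
  have "lo ?p \<noteq> hi ?p"
  proof
    assume lh: "lo ?p = hi ?p"
    then obtain l where l: "l \<in> {1..k}" "lo ?p = t l" using pt[OF p] by auto
    have "a0 ?p = t l" using box_bounds[OF in_box_a0 p] lh l by simp
    then have "min i j = l"
      using shape_point[OF sh0, of "min i j" "max i j" l] ij l by (auto simp: usym_def dest!: I_sub)
    then have "c q \<le> t l" using ij by (auto simp: I_def min_def split: if_splits)
    then show False using eq l c_less[of q "Suc q"] q by simp
  qed
  then show ?thesis using p eq lohi[OF p] by auto
qed

lemma no_merge_conn_iff:
  assumes q: "q < m" and nm: "\<not> merge_step q" and ij: "i \<in> I q" "j \<in> I q"
  shows "conn (c (Suc q)) i j \<longleftrightarrow> conn (c q) i j"
proof
  assume "conn (c (Suc q)) i j"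
  then show "conn (c q) i j"
    using no_merge_conn[OF q ij] nm unfolding merge_step_def by (metis conn_refl)
next
  assume "conn (c q) i j"
  then show "conn (c (Suc q)) i j" using c_less[of q "Suc q"] q by (auto simp: conn_def)
qed

lemma merge_two_roots:
  assumes q: "q < m" and js: "js \<in> {2..k}" "lo js = c (Suc q)"
    and r: "r \<in> roots q" "s \<in> roots q" "r \<noteq> s" and cn: "conn (c (Suc q)) r s"
  shows "max r s = js"
proof -
  have rs: "r \<in> I q" "s \<in> I q" using r by (auto simp: roots_def)
  then have rk: "r \<in> {1..k}" "s \<in> {1..k}" by (auto dest: I_sub)
  let ?R = "max r s"
  have R: "?R \<in> roots q" "?R \<in> {2..k}" using r rk by (auto simp: max_def)
  have "c (Suc q) \<le> lo (f (min r s, ?R))" using cn r by (simp add: conn_def usym_def)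
  also have "\<dots> \<le> lo ?R" using r rk by (intro lo_le_lo) auto
  finally have "c (Suc q) \<le> lo ?R" .
  moreover have "lo ?R < c q" using R by (auto simp: roots_def)
  ultimately have "lo ?R = c (Suc q)" by (intro c_squeeze[OF crit_lo[OF R(2)] q]) auto
  then show ?thesis using lo_inj[OF R(2) js(1)] js(2) by simp
qed

lemma merge_conn_iff:
  assumes q: "q < m" and js: "js \<in> {2..k}" "lo js < hi js" "lo js = c (Suc q)"
    and ag: "agree q x" and i0: "i0 \<in> {1..<js}" "f (i0, js) = js"
  shows "js \<in> I q" "i0 \<in> I q" "x js \<noteq> x i0"
    and "\<And>i j. i \<in> I q \<Longrightarrow> j \<in> I q \<Longrightarrow>
      conn (c (Suc q)) i j \<longleftrightarrow> x i = x j \<or> x i = x js \<and> x j = x i0 \<or> x i = x i0 \<and> x j = x js"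
proof -
  have cq: "c (Suc q) < c q" using c_less[of q "Suc q"] q by simp
  have "a0 js \<le> t i0" using shape_le_t[OF sh0, of i0 js] i0 js by simp
  then have "lo js < t i0" using box_bounds(3)[OF in_box_a0 js(1,2)] by simp
  then have "c q \<le> t i0" using c_consec[OF crit_t q, of i0] i0 js by auto
  then show i0I: "i0 \<in> I q" using i0 js by (auto simp: I_def)
  have "t i0 < t js" using i0 by simp
  then have "c q \<le> t js" using \<open>c q \<le> t i0\<close> by linarith
  then show jsI: "js \<in> I q" using js by (auto simp: I_def)
  have k: "js \<in> {1..k}" "i0 \<in> {1..k}" using jsI i0I by (auto dest: I_sub)
  have u: "usym f i0 js = js" using i0 by (simp add: usym_less)
  have "\<not> conn (c q) i0 js" using i0 u js cq by (simp add: conn_def)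
  then have next_slots: "\<not> conn (c q) js i0" by (simp add: conn_sym)
  then show ne: "x js \<noteq> x i0" using agree_conn[OF ag jsI i0I] by simp
  have c0: "conn (c (Suc q)) js i0" using u js i0 by (simp add: conn_def usym_commute[of f js])
  have up: "conn (c (Suc q)) i j" if "i \<in> I q" "j \<in> I q" "x i = x j" for i j
    using agree_conn[OF ag that(1,2)] that(3) cq by (auto simp: conn_def)
  have tr: "conn (c (Suc q)) i l" if "conn (c (Suc q)) i j" "conn (c (Suc q)) j l" "i \<in> I q" "j \<in> I q" "l \<in> I q" for i j l
    using that by (intro conn_trans[of _ i j l]) (auto dest: I_sub)
  have other: "x r = x i0" if r: "r \<in> roots q" "r < js" "conn (c (Suc q)) r js" for r
  proof -
    have rI: "r \<in> I q" using r by (simp add: roots_def)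
    obtain r0 where r0: "r0 \<in> roots q" "r0 \<le> i0" "conn (c q) r0 i0" using root_exists[OF i0I] by blast
    have r0I: "r0 \<in> I q" using r0 by (simp add: roots_def)
    have x0: "x r0 = x i0" using agree_conn[OF ag r0I i0I] r0 by simp
    have "conn (c (Suc q)) r i0" by (rule tr[OF r(3) c0 rI jsI i0I])
    then have "conn (c (Suc q)) r r0" using up[OF i0I r0I] x0 by (intro tr[OF _ _ rI i0I r0I]) auto
    moreover have "max r r0 < js" using r r0 i0 by simp
    ultimately have "r = r0" using merge_two_roots[OF q js(1,3) r(1) r0(1)] by (metis less_irrefl)
    then show ?thesis using x0 by simp
  qed
  fix i j assume ij: "i \<in> I q" "j \<in> I q"
  show "conn (c (Suc q)) i j \<longleftrightarrow> x i = x j \<or> x i = x js \<and> x j = x i0 \<or> x i = x i0 \<and> x j = x js"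
  proof
    assume cn: "conn (c (Suc q)) i j"
    obtain r where r: "r \<in> roots q" "conn (c q) r i" using root_exists[OF ij(1)] by blast
    obtain s where s: "s \<in> roots q" "conn (c q) s j" using root_exists[OF ij(2)] by blast
    have rI: "r \<in> I q" "s \<in> I q" using r s by (auto simp: roots_def)
    have xr: "x r = x i" "x s = x j" using agree_conn[OF ag rI(1) ij(1)] agree_conn[OF ag rI(2) ij(2)] r s by auto
    show "x i = x j \<or> x i = x js \<and> x j = x i0 \<or> x i = x i0 \<and> x j = x js"
    proof (cases "r = s")
      case True
      then show ?thesis using xr by simp
    next
      case False
      have "conn (c (Suc q)) r j" using up[OF rI(1) ij(1) xr(1)] cn by (rule tr) (use rI ij in auto)
      then have rs: "conn (c (Suc q)) r s" by (rule tr) (use up[OF ij(2) rI(2)] xr rI ij in auto)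
      have mx: "max r s = js" by (rule merge_two_roots[OF q js(1,3) r(1) s(1) False rs])
      show ?thesis
      proof (cases "r < s")
        case True
        then have "s = js" using mx by simp
        then have "x r = x i0" using other[of r] r True rs by simp
        then show ?thesis using xr \<open>s = js\<close> by simp
      next
        case F: False
        then have "r = js" "s < js" using mx False by auto
        then have "x s = x i0" using other[of s] s rs conn_sym[of _ r s] by simp
        then show ?thesis using xr \<open>r = js\<close> by simp
      qed
    qed
  next
    assume H: "x i = x j \<or> x i = x js \<and> x j = x i0 \<or> x i = x i0 \<and> x j = x js"
    have *: "conn (c (Suc q)) i j" if "x i = x js" "x j = x i0" "i \<in> I q" "j \<in> I q" for i j
    proof -
      have "conn (c (Suc q)) i i0" using up[OF that(3) jsI that(1)] c0 by (rule tr) (use that jsI i0I in auto)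
      then show ?thesis using up[OF i0I that(4)] that by (intro tr[of i i0 j]) (auto simp: i0I)
    qed
    show "conn (c (Suc q)) i j"
      using H *[of i j] *[of j i] up[OF ij] ij conn_sym[of _ i j] by blast
  qed
qed

definition flow_ok :: "nat \<Rightarrow> (nat \<Rightarrow> nat) \<Rightarrow> (nat \<times> nat) list \<Rightarrow> bool" where
  "flow_ok q x w \<longleftrightarrow> (\<forall>i\<in>I q. \<forall>j\<in>I q. act w (x i) = act w (x j) \<longleftrightarrow> conn (c (Suc q)) i j)"

lemma prob_flow_ok:
  assumes q: "q < m" and ag: "agree q x"
  shows "measure_pmf.prob (word_pmf (c q - c (Suc q))) {w. flow_ok q x w} = flow_fac q"
proof -
  have d: "0 < c q - c (Suc q)" using c_less[of q "Suc q"] q by simp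
  have A: "x ` I q \<subseteq> {..<n}" using ag by (auto simp: agree_def)
  have card: "card (x ` I q) = num_blocks q" using card_labels[OF ag] by (simp add: num_blocks_def)
  show ?thesis
  proof (cases "merge_step q")
    case False
    have e: "conn (c (Suc q)) i j \<longleftrightarrow> x i = x j" if "i \<in> I q" "j \<in> I q" for i j
      using no_merge_conn_iff[OF q False that] agree_conn[OF ag that] by simp
    have "flow_ok q x w \<longleftrightarrow> inj_on (act w) (x ` I q)" for w
      by (simp add: flow_ok_def inj_on_def e cong: ball_cong) auto
    then show ?thesis using prob_word_inj[OF d A] False by (simp add: flow_fac_def card)
  next
    case True
    then obtain js where js: "js \<in> {2..k}" "lo js < hi js" "lo js = c (Suc q)" by (auto simp: merge_step_def)
    obtain i0 where i0: "i0 \<in> {1..<js}" "f (i0, js) = js" using shape_parent[OF sh0 js(1)] by blast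
    note mc = merge_conn_iff[OF q js ag i0]
    have "flow_ok q x w \<longleftrightarrow> merges_only (act w) (x ` I q) (x js) (x i0)" for w
      unfolding flow_ok_def merges_only_def ball_simps using mc(4) by (simp cong: ball_cong)
    then show ?thesis using prob_word_merges[OF d A _ _ mc(3)] mc(1,2) True by (simp add: flow_fac_def card)
  qed
qed

definition next_slots :: "nat \<Rightarrow> (nat \<Rightarrow> nat) \<Rightarrow> (nat \<times> nat) list \<times> nat \<Rightarrow> nat \<Rightarrow> nat" where
  "next_slots q x z i = (if c q \<le> t i then act (fst z) (x i) else snd z)"

definition samp_steps :: "nat set" where "samp_steps = {q. q < m \<and> samp_step q}"

definition step_pmf :: "nat \<Rightarrow> ((nat \<times> nat) list \<times> nat) pmf" where
  "step_pmf q = pair_pmf (word_pmf (c q - c (Suc q))) (if q \<in> samp_steps then slot_pmf else return_pmf 0)"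

lemma I_Suc:
  assumes q: "q < m"
  shows "I (Suc q) = I q \<union> {i\<in>{1..k}. t i = c (Suc q)}"
proof -
  have "c q \<le> t i \<or> t i = c (Suc q)" if "i \<in> {1..k}" "c (Suc q) \<le> t i" for i
    using c_consec[OF crit_t[OF that(1)] q] that(2) by auto
  moreover have "c (Suc q) < c q" using c_less[of q "Suc q"] q by simp
  ultimately show ?thesis by (auto simp: I_def)
qed

lemma slots_nonempty: "{..<n} \<noteq> {}"
proof -
  have "0 \<in> {..<n}" using n2 by simp
  then show ?thesis by blast
qed

lemma prob_agree_Suc:
  assumes q: "q < m" and ag: "agree q x"
  shows "measure_pmf.prob (step_pmf q) {z. agree (Suc q) (next_slots q x z)} = flow_fac q * samp_fac q"
proof -
  let ?up = "if q \<in> samp_steps then slot_pmf else return_pmf 0"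
  have cq: "c (Suc q) < c q" using c_less[of q "Suc q"] q by simp
  have step_pmf: "step_pmf q = bind_pmf (word_pmf (c q - c (Suc q))) (\<lambda>w. map_pmf (\<lambda>u. (w, u)) ?up)"
    by (simp add: step_pmf_def pair_pmf_def map_pmf_def)
  have nxI: "next_slots q x (w, u) i = act w (x i)" if "i \<in> I q" for w u i
    using that by (simp add: next_slots_def I_def)
  have "measure_pmf.prob (step_pmf q) {z. agree (Suc q) (next_slots q x z)}
      = samp_fac q * measure_pmf.prob (word_pmf (c q - c (Suc q))) {w. flow_ok q x w}
        + 0 * measure_pmf.prob (word_pmf (c q - c (Suc q))) {}"
    unfolding step_pmf
  proof (rule measure_bind_pmf_cases)
    fix w assume w: "w \<in> set_pmf (word_pmf (c q - c (Suc q)))"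
    have ran: "act w (x i) < n" if "i \<in> I q" for i
      using act_range[OF set_word_pmf[OF w], of "x i"] ag that by (auto simp: agree_def)
    have ag_flow: "flow_ok q x w" if A: "agree (Suc q) (next_slots q x (w, u))" for u
      unfolding flow_ok_def
    proof (intro ballI)
      fix i j assume ij: "i \<in> I q" "j \<in> I q"
      then have "i \<in> I (Suc q)" "j \<in> I (Suc q)" using I_Suc[OF q] by auto
      from agree_conn[OF A this] show "act w (x i) = act w (x j) \<longleftrightarrow> conn (c (Suc q)) i j"
        unfolding nxI[OF ij(1)] nxI[OF ij(2)] .
    qed
    have "measure_pmf.prob (map_pmf (\<lambda>u. (w, u)) ?up) {z. agree (Suc q) (next_slots q x z)}
        = measure_pmf.prob ?up {u. agree (Suc q) (next_slots q x (w, u))}"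
      by (simp add: vimage_def)
    also have "\<dots> = (if flow_ok q x w then samp_fac q else 0)"
    proof (cases "flow_ok q x w")
      case False
      then have "{u. agree (Suc q) (next_slots q x (w, u))} = {}" using ag_flow by blast
      then show ?thesis using False by simp
    next
      case fl: True
      show ?thesis
      proof (cases "samp_step q")
        case False
        then have "{i\<in>{1..k}. t i = c (Suc q)} = {}" unfolding samp_step_def by force
        then have "I (Suc q) = I q" using I_Suc[OF q] by (simp only: Un_empty_right)
        then have "agree (Suc q) (next_slots q x (w, u))" for u
          using fl ran nxI by (simp add: agree_def flow_ok_def)
        then show ?thesis using fl False by (simp add: samp_fac_def)
      next
        case sa: True
        then obtain i where i: "i \<in> {1..k}" "t i = c (Suc q)" by (auto simp: samp_step_def)
        have iI: "i \<notin> I q" using i cq by (auto simp: I_def)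
        have "{i\<in>{1..k}. t i = c (Suc q)} = {i}" using i(1) by (auto simp: i(2)[symmetric])
        then have IS: "I (Suc q) = insert i (I q)" using I_Suc[OF q] by simp
        have K: "q \<in> samp_steps" using sa q by (simp add: samp_steps_def)
        have nxi: "next_slots q x (w, u) i = u" for u using i cq by (simp add: next_slots_def)
        have nm: "\<not> merge_step q"
        proof
          assume "merge_step q"
          then obtain j where "j \<in> {2..k}" "lo j < hi j" "lo j = c (Suc q)" by (auto simp: merge_step_def)
          then show False using br[of j "lo j"] sa by (auto simp: samp_step_def)
        qed
        have agr: "agree (Suc q) (next_slots q x (w, u)) \<longleftrightarrow> u < n \<and> (\<forall>j\<in>I q. u = act w (x j) \<longleftrightarrow> conn (c (Suc q)) i j)" for u
        proof
          assume A: "agree (Suc q) (next_slots q x (w, u))"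
          have "u < n" using A nxi IS by (auto simp: agree_def)
          moreover have "u = act w (x j) \<longleftrightarrow> conn (c (Suc q)) i j" if "j \<in> I q" for j
            using agree_conn[OF A, of i j] IS that nxi nxI[OF that] by simp
          ultimately show "u < n \<and> (\<forall>j\<in>I q. u = act w (x j) \<longleftrightarrow> conn (c (Suc q)) i j)" by blast
        next
          assume A: "u < n \<and> (\<forall>j\<in>I q. u = act w (x j) \<longleftrightarrow> conn (c (Suc q)) i j)"
          show "agree (Suc q) (next_slots q x (w, u))"
            unfolding agree_def
          proof (intro conjI ballI)
            fix j assume "j \<in> I (Suc q)"
            then show "next_slots q x (w, u) j < n" using A ran IS nxi nxI by auto
          next
            fix j l assume jl: "j \<in> I (Suc q)" "l \<in> I (Suc q)"
            consider "j = i" "l = i" | "j = i" "l \<in> I q" | "l = i" "j \<in> I q" | "j \<in> I q" "l \<in> I q" using jl IS by auto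
            then show "next_slots q x (w, u) j = next_slots q x (w, u) l \<longleftrightarrow> conn (c (Suc q)) j l"
            proof cases
              case 1
              then show ?thesis by (simp add: conn_refl)
            next
              case 2
              then show ?thesis using A nxi nxI[of l] by simp
            next
              case 3
              then show ?thesis using A nxi nxI[of j] conn_sym[of _ j l] by auto
            next
              case 4
              then show ?thesis using fl nxI[of j] nxI[of l] by (simp add: flow_ok_def)
            qed
          qed
        qed
        show ?thesis
        proof (cases "point_step q")
          case True
          then obtain p where p: "p \<in> {2..k}" "lo p = hi p" "lo p = c (Suc q)" by (auto simp: point_step_def)
          have "a0 p = t i" using box_bounds[OF in_box_a0 p(1)] p i by simp
          from shape_direct[OF sh0 p(1) i(1) this] have ip: "i < p" "f (i, p) = p" by auto
          have "t i < t p" using ip by simp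
          then have "c q \<le> t p" using c_consec[OF crit_t q, of p] p i by auto
          then have pI: "p \<in> I q" using p by (auto simp: I_def)
          have cip: "conn (c (Suc q)) i p" using ip p by (simp add: conn_def usym_less)
          have cj: "conn (c (Suc q)) i j \<longleftrightarrow> act w (x p) = act w (x j)" if "j \<in> I q" for j
          proof -
            have "conn (c (Suc q)) i j \<longleftrightarrow> conn (c (Suc q)) p j"
              using conn_trans[of _ p i j] conn_trans[of _ i p j] cip conn_sym[of _ i p] i pI that I_sub by blast
            also have "\<dots> \<longleftrightarrow> act w (x p) = act w (x j)" using fl pI that by (simp add: flow_ok_def)
            finally show ?thesis .
          qed
          have "agree (Suc q) (next_slots q x (w, u)) \<longleftrightarrow> u = act w (x p)" for u
            unfolding agr using cj pI ran[OF pI] by auto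
          then have "{u. agree (Suc q) (next_slots q x (w, u))} = {act w (x p)}" by auto
          then show ?thesis using K fl sa True ran[OF pI] slots_nonempty
            by (simp add: samp_fac_def measure_pmf_single)
        next
          case np: False
          have nc: "\<not> conn (c (Suc q)) i j" if "j \<in> I q" for j
          proof
            assume cn: "conn (c (Suc q)) i j"
            have "c q \<le> t j" using that by (simp add: I_def)
            then have "t i < t j" using i cq by simp
            then have "i < j" unfolding t_less .
            then have ij: "i < j" "j \<le> k" "1 \<le> i" using that i(1) by (auto simp: I_def)
            then have "c (Suc q) \<le> lo (f (i, j))" using cn by (auto simp: conn_def usym_less)
            moreover have "lo (f (i, j)) \<le> t i" using ij by (intro lo_le_t) auto
            ultimately have eq: "lo (f (i, j)) = c (Suc q)" using i by simp
            have r: "f (i, j) \<in> {2..k}" using ij by (intro f_range) auto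
            have "\<not> lo (f (i, j)) < hi (f (i, j))" using nm r eq unfolding merge_step_def by blast
            then have "lo (f (i, j)) = hi (f (i, j))" using lohi[OF r] by simp
            then show False using np r eq unfolding point_step_def by blast
          qed
          have eq: "{u. agree (Suc q) (next_slots q x (w, u))} = {..<n} - act w ` x ` I q"
            unfolding agr using nc by auto
          have "inj_on (act w) (x ` I q)"
            using fl no_merge_conn_iff[OF q nm] agree_conn[OF ag] by (auto simp: flow_ok_def inj_on_def)
          then have "card (act w ` x ` I q) = num_blocks q" using card_labels[OF ag] by (simp add: card_image num_blocks_def)
          moreover have sub: "act w ` x ` I q \<subseteq> {..<n}" using ran by auto
          ultimately have cd: "card ({..<n} - act w ` x ` I q) = n - num_blocks q" "num_blocks q \<le> n"
            using card_mono[OF _ sub] finite_subset[OF sub] by (simp_all add: card_Diff_subset)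
          have "measure_pmf.prob slot_pmf ({..<n} - act w ` x ` I q) = real (n - num_blocks q) / real n"
            using measure_pmf_of_set[OF slots_nonempty, of "{..<n} - act w ` x ` I q"] cd
            by (simp add: Int_absorb1 Int_Diff)
          also have "\<dots> = 1 - real (num_blocks q) / real n" using n2 cd by (simp add: of_nat_diff diff_divide_distrib)
          finally show ?thesis using K fl sa np eq by (simp add: samp_fac_def)
        qed
      qed
    qed
    finally show "measure_pmf.prob (map_pmf (\<lambda>u. (w, u)) ?up) {z. agree (Suc q) (next_slots q x z)}
      = (if w \<in> {w. flow_ok q x w} then samp_fac q else 0) + (if w \<in> {} then 0 else 0)" by simp
  qed
  then show ?thesis by (simp add: prob_flow_ok[OF q ag])
qed

primrec run :: "((nat \<times> nat) list \<times> nat) list \<Rightarrow> nat \<Rightarrow> (nat \<Rightarrow> nat) \<Rightarrow> bool" where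
  "run [] q x \<longleftrightarrow> True"
| "run (z # zs) q x \<longleftrightarrow> agree (Suc q) (next_slots q x z) \<and> run zs (Suc q) (next_slots q x z)"

lemma prob_run:
  "q + r = m \<Longrightarrow> agree q x \<Longrightarrow>
    measure_pmf.prob (seq_pmf step_pmf r q) {zs. run zs q x} = (\<Prod>i\<in>{q..<m}. flow_fac i * samp_fac i)"
proof (induction r arbitrary: q x)
  case 0
  then show ?case by simp
next
  case (Suc r)
  have q: "q < m" using Suc.prems by simp
  let ?F = "\<Prod>i\<in>{Suc q..<m}. flow_fac i * samp_fac i"
  have "measure_pmf.prob (seq_pmf step_pmf (Suc r) q) {zs. run zs q x}
     = ?F * measure_pmf.prob (step_pmf q) {z. agree (Suc q) (next_slots q x z)} + 0 * measure_pmf.prob (step_pmf q) {}"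
    unfolding seq_pmf.simps
  proof (rule measure_bind_pmf_cases)
    fix z
    show "measure_pmf.prob (map_pmf (\<lambda>zs. z # zs) (seq_pmf step_pmf r (Suc q))) {zs. run zs q x}
      = (if z \<in> {z. agree (Suc q) (next_slots q x z)} then ?F else 0) + (if z \<in> {} then 0 else 0)"
      using Suc.IH[of "Suc q" "next_slots q x z"] Suc.prems by (simp add: vimage_def)
  qed
  also have "\<dots> = (\<Prod>i\<in>{q..<m}. flow_fac i * samp_fac i)"
    using prob_agree_Suc[OF q Suc.prems(2)] q by (simp add: prod.atLeast_Suc_lessThan)
  finally show ?case .
qed

definition sample_at :: "nat \<Rightarrow> nat" where "sample_at q = (THE i. i \<in> {1..k} \<and> t i = c (Suc q))"

lemma sample_at_eq: "i \<in> {1..k} \<Longrightarrow> t i = c (Suc q) \<Longrightarrow> sample_at q = i"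
  unfolding sample_at_def by (rule the_equality) (auto simp: t_eq[symmetric] simp del: t_eq)

lemma c_inj: "q \<le> m \<Longrightarrow> q' \<le> m \<Longrightarrow> c q = c q' \<Longrightarrow> q = q'"
  using c_less[of q q'] c_less[of q' q] by (cases q q' rule: linorder_cases) auto

lemma crit0_c: "x \<in> crit0 \<Longrightarrow> \<exists>q<m. c (Suc q) = x"
proof -
  assume x: "x \<in> crit0"
  then obtain q where q: "q \<le> m" "c q = x" using crit_c[of x] by (auto simp: crit_def)
  have "q \<noteq> 0"
  proof
    assume "q = 0"
    then show False using q c_0 crit0_less_top[OF x] by simp
  qed
  then obtain q' where "q = Suc q'" by (cases q) auto
  then show ?thesis using q by (intro exI[of _ q']) auto
qed

lemma bij_sample_at: "bij_betw sample_at samp_steps {1..k}"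
  unfolding bij_betw_def
proof
  have sample_at: "sample_at q \<in> {1..k} \<and> t (sample_at q) = c (Suc q)" if q: "q \<in> samp_steps" for q
  proof -
    obtain i where "i \<in> {1..k}" "t i = c (Suc q)" using q by (auto simp: samp_steps_def samp_step_def)
    then show ?thesis using sample_at_eq[of i q] by simp
  qed
  show "inj_on sample_at samp_steps"
  proof (rule inj_onI)
    fix q q' assume q: "q \<in> samp_steps" "q' \<in> samp_steps" "sample_at q = sample_at q'"
    then have "c (Suc q) = c (Suc q')" using sample_at by metis
    then show "q = q'" using c_inj[of "Suc q" "Suc q'"] q by (simp add: samp_steps_def)
  qed
  show "sample_at ` samp_steps = {1..k}"
  proof
    show "sample_at ` samp_steps \<subseteq> {1..k}" using sample_at by blast
    show "{1..k} \<subseteq> sample_at ` samp_steps"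
    proof
      fix i assume i: "i \<in> {1..k}"
      then obtain q where q: "q < m" "c (Suc q) = t i" using crit0_c[of "t i"] by (auto simp: crit0_def)
      then have "q \<in> samp_steps" using i by (auto simp: samp_steps_def samp_step_def)
      then show "i \<in> sample_at ` samp_steps" using sample_at_eq[OF i, of q] q by (intro image_eqI[of _ _ q]) auto
    qed
  qed
qed

definition step_data :: "nat \<Rightarrow> smg_omega \<Rightarrow> (nat \<times> nat) list \<times> nat" where
  "step_data q \<omega> = (ev_word \<omega> (c (Suc q)) (c q), if q \<in> samp_steps then snd \<omega> (sample_at q) else 0)"

definition runs :: "smg_omega \<Rightarrow> bool" where
  "runs \<omega> \<longleftrightarrow> run (map (\<lambda>q. step_data q \<omega>) [0..<m]) 0 (\<lambda>_. 0)"

lemma I_0: "I 0 = {}"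
proof -
  have less: "t i < c 0" if "i \<in> {1..k}" for i
    using that crit0_less_top[of "t i"] by (auto simp: c_0 crit0_def)
  show ?thesis
  proof (rule equals0I)
    fix i assume "i \<in> I 0"
    then have "i \<in> {1..k}" "c 0 \<le> t i" by (auto simp: I_def)
    with less[of i] show False by simp
  qed
qed

lemma runs_measurable[measurable]: "Measurable.pred (smg_space n \<mu>) runs"
proof -
  have "(\<lambda>\<omega>. map (\<lambda>q. step_data q \<omega>) [0..<m]) \<in> measurable (smg_space n \<mu>) (count_space UNIV)"
  proof (subst measurable_count_space_eq_countable, safe)
    fix zs :: "((nat \<times> nat) list \<times> nat) list"
    have "map (\<lambda>q. step_data q \<omega>) [0..<m] = zs \<longleftrightarrow> length zs = m \<and> (\<forall>q<m. ev_word \<omega> (c (Suc q)) (c q) = fst (zs ! q)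
        \<and> (q \<in> samp_steps \<longrightarrow> snd \<omega> (sample_at q) = snd (zs ! q)) \<and> (q \<notin> samp_steps \<longrightarrow> 0 = snd (zs ! q)))" for \<omega>
      by (auto simp: list_eq_iff_nth_eq[where ys=zs] step_data_def prod_eq_iff)
    then have "(\<lambda>\<omega>. map (\<lambda>q. step_data q \<omega>) [0..<m]) -` {zs} \<inter> space (smg_space n \<mu>)
        = {\<omega> \<in> space (smg_space n \<mu>). length zs = m \<and> (\<forall>q<m. ev_word \<omega> (c (Suc q)) (c q) = fst (zs ! q)
        \<and> (q \<in> samp_steps \<longrightarrow> snd \<omega> (sample_at q) = snd (zs ! q)) \<and> (q \<notin> samp_steps \<longrightarrow> 0 = snd (zs ! q)))}"
      by blast
    also have "\<dots> \<in> smg.events" by measurable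
    finally show "(\<lambda>\<omega>. map (\<lambda>q. step_data q \<omega>) [0..<m]) -` {zs} \<inter> space (smg_space n \<mu>) \<in> smg.events" .
  qed auto
  then show ?thesis unfolding runs_def by (rule measurable_compose) simp
qed

theorem prob_runs: "smg.prob {\<omega>. runs \<omega>} = (\<Prod>q<m. flow_fac q * samp_fac q)"
proof -
  obtain z where z: "z \<le> m" "c z = 0" using crit_c[of 0] by (auto simp: crit_def crit0_def)
  have "smg.prob {\<omega>. map (\<lambda>q. (ev_word \<omega> (c (Suc q)) (c q), if q \<in> samp_steps then snd \<omega> (sample_at q) else 0)) [0..<m]
      \<in> {zs. run zs 0 (\<lambda>_. 0)}}
    = measure_pmf.prob (seq_pmf (\<lambda>q. pair_pmf (word_pmf (c q - c (Suc q))) (if q \<in> samp_steps then slot_pmf else return_pmf 0)) m 0)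
        {zs. run zs 0 (\<lambda>_. 0)}"
    using c_less z bij_sample_at by (intro step_law) (auto simp: samp_steps_def)
  also have "\<dots> = measure_pmf.prob (seq_pmf step_pmf m 0) {zs. run zs 0 (\<lambda>_. 0)}"
    by (simp add: step_pmf_def[abs_def])
  also have "\<dots> = (\<Prod>i\<in>{0..<m}. flow_fac i * samp_fac i)"
    by (rule prob_run) (auto simp: agree_def I_0)
  finally show ?thesis by (simp add: runs_def step_data_def atLeast0LessThan)
qed

lemma agree_cong: "(\<And>i. i \<in> I q \<Longrightarrow> x i = y i) \<Longrightarrow> agree q x \<longleftrightarrow> agree q y"
  unfolding agree_def by (simp cong: ball_cong)

context
  fixes \<omega> assumes ni: "nice \<omega>"
begin

lemma next_slots_link:
  assumes q: "q < m" and x: "\<And>i. i \<in> I q \<Longrightarrow> x i = X \<omega> i (c q)" and i: "i \<in> I (Suc q)"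
  shows "next_slots q x (step_data q \<omega>) i = X \<omega> i (c (Suc q))"
proof (cases "c q \<le> t i")
  case True
  then have iI: "i \<in> I q" using i by (auto simp: I_def)
  have "X \<omega> i (c (Suc q)) = act (ev_word \<omega> (c (Suc q)) (c q)) (X \<omega> i (c q))"
    using c_less[of q "Suc q"] q by (intro X_flow[OF ni _ True]) auto
  then show ?thesis using True x[OF iI] by (simp add: next_slots_def step_data_def)
next
  case False
  then have i': "i \<in> {1..k}" "t i = c (Suc q)" using i I_Suc[OF q] by (auto simp: I_def)
  have "c (Suc q) \<in> t ` {1..k}" using i' by (metis imageI)
  then have "q \<in> samp_steps" "sample_at q = i" using q sample_at_eq[OF i'] by (auto simp: samp_steps_def samp_step_def)
  then show ?thesis using False X_self[OF ni, of i] i' by (simp add: next_slots_def step_data_def)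
qed

lemma run_link:
  assumes "q + r = m" and "\<And>i. i \<in> I q \<Longrightarrow> x i = X \<omega> i (c q)"
  shows "run (map (\<lambda>q. step_data q \<omega>) [q..<m]) q x \<longleftrightarrow> (\<forall>q'\<in>{q<..m}. agree q' (\<lambda>i. X \<omega> i (c q')))"
  using assms
proof (induction r arbitrary: q x)
  case 0
  then show ?case by simp
next
  case (Suc r)
  have q: "q < m" using Suc.prems by simp
  let ?y = "next_slots q x (step_data q \<omega>)"
  have y: "\<And>i. i \<in> I (Suc q) \<Longrightarrow> ?y i = X \<omega> i (c (Suc q))"
    by (rule next_slots_link[OF q Suc.prems(2)])
  have "run (map (\<lambda>q. step_data q \<omega>) [q..<m]) q x
      \<longleftrightarrow> agree (Suc q) ?y \<and> run (map (\<lambda>q. step_data q \<omega>) [Suc q..<m]) (Suc q) ?y"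
    using q by (simp add: upt_conv_Cons)
  also have "agree (Suc q) ?y \<longleftrightarrow> agree (Suc q) (\<lambda>i. X \<omega> i (c (Suc q)))" by (rule agree_cong) (rule y)
  also have "run (map (\<lambda>q. step_data q \<omega>) [Suc q..<m]) (Suc q) ?y \<longleftrightarrow> (\<forall>q'\<in>{Suc q<..m}. agree q' (\<lambda>i. X \<omega> i (c q')))"
    using Suc.prems(1) y by (intro Suc.IH) auto
  also have "{q<..m} = insert (Suc q) {Suc q<..m}" using q by auto
  ultimately show ?case by simp
qed

lemma runs_iff: "runs \<omega> \<longleftrightarrow> (\<forall>q\<in>{0<..m}. agree q (\<lambda>i. X \<omega> i (c q)))"
  unfolding runs_def by (rule run_link) (auto simp: I_0)

lemma cell_runs:
  assumes J: "\<And>i j. 1 \<le> i \<Longrightarrow> i < j \<Longrightarrow> j \<le> k \<Longrightarrow> merge_time t \<omega> i j \<in> cell_set lo hi (f (i, j))"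
  shows "runs \<omega>"
  unfolding runs_iff
proof
  fix q assume q: "q \<in> {0<..m}"
  then have cq: "c q \<in> crit" using c_in_crit by simp
  have key: "X \<omega> j (c q) = X \<omega> i (c q) \<longleftrightarrow> c q \<le> lo (f (i, j))" if ij: "i \<in> I q" "j \<in> I q" "i < j" for i j
  proof -
    have i: "1 \<le> i" "i < j" "j \<le> k" "i \<in> {1..k}" "c q \<le> t i" using ij by (auto simp: I_def)
    let ?p = "f (i, j)" and ?G = "merge_time t \<omega> i j"
    have p: "?p \<in> {2..k}" using i by (intro f_range) auto
    note mi = merge_iff[OF ni i(1,2,5)]
    show ?thesis
    proof (cases "lo ?p < hi ?p")
      case True
      then have G: "lo ?p < ?G" "?G \<le> hi ?p" using J[OF i(1-3)] by (auto simp: cell_set_def)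
      have "?G \<noteq> t i" using br[OF p True, of ?G] G i(4) by auto
      then have "X \<omega> j (c q) = X \<omega> i (c q) \<longleftrightarrow> c q < ?G" using mi by auto
      also have "\<dots> \<longleftrightarrow> c q \<le> lo ?p" using crit_avoid[OF cq p] G by auto
      finally show ?thesis .
    next
      case False
      then have lh: "lo ?p = hi ?p" using lohi[OF p] by simp
      then have G: "?G = lo ?p" using J[OF i(1-3)] by (simp add: cell_set_def)
      obtain l where l: "l \<in> {1..k}" "lo ?p = t l" using pt[OF p lh] by auto
      have "a0 ?p = t l" using box_bounds[OF in_box_a0 p] lh l by simp
      then have "i = l" using shape_point[OF sh0 i(1-3) l(1)] by simp
      then show ?thesis using mi G l i(5) by auto
    qed
  qed
  show "agree q (\<lambda>i. X \<omega> i (c q))"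
    unfolding agree_def
  proof (intro conjI ballI)
    show "X \<omega> i (c q) < n" for i by (rule X_less[OF ni])
    fix i j assume ij: "i \<in> I q" "j \<in> I q"
    consider "i = j" | "i < j" | "j < i" by linarith
    then show "X \<omega> i (c q) = X \<omega> j (c q) \<longleftrightarrow> conn (c q) i j"
    proof cases
      case 1
      then show ?thesis by (simp add: conn_refl)
    next
      case 2
      then show ?thesis using key[OF ij 2] by (auto simp: conn_def usym_less)
    next
      case 3
      then show ?thesis using key[OF ij(2,1) 3] by (auto simp: conn_def usym_commute[of f i j] usym_less)
    qed
  qed
qed

lemma runs_cell:
  assumes runs: "runs \<omega>" and i: "1 \<le> i" "i < j" "j \<le> k"
  shows "merge_time t \<omega> i j \<in> cell_set lo hi (f (i, j))"
proof -
  let ?p = "f (i, j)" and ?G = "merge_time t \<omega> i j"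
  have p: "?p \<in> {2..k}" using i by (intro f_range) auto
  have ik: "i \<in> {1..k}" using i by simp
  have key: "X \<omega> j x = X \<omega> i x \<longleftrightarrow> x \<le> lo ?p" if x: "x \<in> crit0" "x \<le> t i" for x
  proof -
    obtain q where q: "q < m" "c (Suc q) = x" using crit0_c[OF x(1)] by blast
    have ag: "agree (Suc q) (\<lambda>i. X \<omega> i (c (Suc q)))" using runs runs_iff q by auto
    have "t i < t j" using i by simp
    then have "x \<le> t j" using x by linarith
    then have "i \<in> I (Suc q)" "j \<in> I (Suc q)" using i q x by (auto simp: I_def)
    from agree_conn[OF ag this] show ?thesis using i q by (auto simp: conn_def usym_less)
  qed
  have cr: "lo ?p \<in> crit0" "hi ?p \<in> crit0" "t i \<in> crit0" using p ik by (auto simp: crit0_def)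
  have le: "lo ?p \<le> t i" using lo_le_t[OF i] .
  show ?thesis
  proof (cases "lo ?p < hi ?p")
    case True
    have "a0 ?p \<le> t i" using shape_le_t[OF sh0 i] .
    then have "\<not> hi ?p < t i \<longrightarrow> a0 ?p = t i" using box_t[OF in_box_a0 p ik] by auto
    then have hi: "hi ?p < t i" using box_t[OF in_box_a0 p ik] True by auto
    have "X \<omega> j (lo ?p) = X \<omega> i (lo ?p)" using key[OF cr(1) le] by simp
    then have "lo ?p < ?G" using merge_iff[OF ni i(1,2) le] hi True by auto
    moreover have "X \<omega> j (hi ?p) \<noteq> X \<omega> i (hi ?p)" using key[OF cr(2)] hi True by auto
    then have "?G \<le> hi ?p" using merge_iff[OF ni i(1,2), of "hi ?p"] hi by auto
    ultimately show ?thesis using True by (simp add: cell_set_def)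
  next
    case False
    then have lh: "lo ?p = hi ?p" using lohi[OF p] by simp
    obtain l where l: "l \<in> {1..k}" "lo ?p = t l" using pt[OF p lh] by auto
    have "a0 ?p = t l" using box_bounds[OF in_box_a0 p] lh l by simp
    then have "i = l" using shape_point[OF sh0 i l(1)] by simp
    then have "X \<omega> j (t i) = X \<omega> i (t i)" using key[OF cr(3)] l by simp
    then have "?G = t i" using merge_iff[OF ni i(1,2), of "t i"] merge_le[OF ni i(1,2)] by auto
    then show ?thesis using False lh l \<open>i = l\<close> by (simp add: cell_set_def)
  qed
qed

lemma genealogy_in_cell_iff:
  "(genealogy t k \<omega> = gen_of k f (attach_vec k (genealogy t k \<omega>)) \<and> in_box (attach_vec k (genealogy t k \<omega>)))
    \<longleftrightarrow> runs \<omega>"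
proof -
  let ?g = "genealogy t k \<omega>" and ?a = "attach_vec k (genealogy t k \<omega>)"
  have G: "?g (i, j) = merge_time t \<omega> i j" if "1 \<le> i" "i < j" "j \<le> k" for i j
    by (rule genealogy_apply[OF ni that])
  show ?thesis
  proof
    assume H: "?g = gen_of k f ?a \<and> in_box ?a"
    show "runs \<omega>"
    proof (rule cell_runs)
      fix i j assume i: "1 \<le> i" "i < j" "j \<le> k"
      have "merge_time t \<omega> i j = gen_of k f ?a (i, j)" using G[OF i] fun_cong[OF conjunct1[OF H], of "(i, j)"] by (rule trans[OF sym])
      also have "\<dots> = ?a (f (i, j))" by (rule gen_of_apply[OF i])
      finally show "merge_time t \<omega> i j \<in> cell_set lo hi (f (i, j))"
        using conjunct2[OF H] f_range[OF i] by (simp add: in_box_def)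
    qed
  next
    assume R: "runs \<omega>"
    have J: "merge_time t \<omega> i j \<in> cell_set lo hi (f (i, j))" if "1 \<le> i" "i < j" "j \<le> k" for i j
      by (rule runs_cell[OF R that])
    have aj: "?a j \<in> cell_set lo hi j" if j: "j \<in> {2..k}" for j
    proof -
      obtain p where p: "p \<in> {1..<j}" "f (p, j) = j" using shape_parent[OF sh0 j] by blast
      obtain i where i: "1 \<le> i" "i < j" "merge_time t \<omega> i j = g_attach ?g j" using attach_merge(1)[OF ni j] by blast
      have aj: "?a j = merge_time t \<omega> i j" using i j by (simp add: attach_vec_def)
      have ge: "merge_time t \<omega> p j \<le> merge_time t \<omega> i j" using attach_merge(2)[OF ni j, of p] i p by simp
      have r: "f (i, j) \<in> {2..k}" using i j by (intro f_range) auto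
      have Jp: "merge_time t \<omega> p j \<in> cell_set lo hi j" using J[of p j] p j by simp
      have Ji: "merge_time t \<omega> i j \<in> cell_set lo hi (f (i, j))" using J[of i j] i j by simp
      have "f (i, j) = j"
      proof (rule ccontr)
        assume ne: "f (i, j) \<noteq> j"
        have "a0 (f (i, j)) \<le> a0 j" using i j by (intro shape_le_a[OF sh0]) auto
        moreover have "a0 (f (i, j)) \<noteq> a0 j" using shape_inj[OF sh0 r j] ne by blast
        ultimately have "hi (f (i, j)) < lo j" using box_less_iff[OF in_box_a0 r j ne] by simp
        then show False using Jp Ji ge lohi[OF j] lohi[OF r] by (auto simp: cell_set_def split: if_splits)
      qed
      then show ?thesis using aj Ji by simp
    qed
    have attach_box: "in_box ?a" using aj by (simp add: in_box_def)
    obtain f' where f': "f' \<in> PiE (pairs_upto k) (\<lambda>_. {2..k})" "shape_ok t k f' ?a" "gen_of k f' ?a = ?g"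
      using gen_ok_shape[OF gen_ok_genealogy[OF ni, of k]] by blast
    have "?g p = gen_of k f ?a p" for p
    proof (cases "p \<in> pairs_upto k")
      case True
      then obtain i j where p: "p = (i, j)" and i: "1 \<le> i" "i < j" "j \<le> k" by (auto simp: pairs_upto_def)
      have r: "f (i, j) \<in> {2..k}" "f' (i, j) \<in> {2..k}" using f_range[OF i] f'(1) True p by auto
      have G': "merge_time t \<omega> i j = ?a (f' (i, j))"
        using G[OF i] gen_of_apply[OF i, of f' ?a] f'(3) by simp
      have "f' (i, j) = f (i, j)"
      proof (rule ccontr)
        assume ne: "f' (i, j) \<noteq> f (i, j)"
        have "?a (f' (i, j)) \<in> cell_set lo hi (f (i, j))" using J[OF i] G' by simp
        moreover have "?a (f' (i, j)) \<in> cell_set lo hi (f' (i, j))" by (rule aj[OF r(2)])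
        ultimately show False using cells_ordered[OF r(2,1) ne] lohi[OF r(1)] lohi[OF r(2)]
          by (auto simp: cell_set_def split: if_splits)
      qed
      then show ?thesis using G' G[OF i] gen_of_apply[OF i, of f ?a] p by simp
    next
      case False
      have "gen_of k f' ?a p = gen_of k f ?a p" using False by (simp add: gen_of_def)
      then show ?thesis using f'(3) by simp
    qed
    then show "?g = gen_of k f ?a \<and> in_box ?a" using attach_box by blast
  qed
qed

end
end

section \<open>Integral of the density over a cell\<close>

lemma sets_ref_meas[simp, measurable_cong]: "sets (ref_meas t) = sets borel"
  unfolding ref_meas_def by (simp add: sets_measure_of_conv) (metis sets.sigma_sets_eq space_borel)

lemma space_ref_meas[simp]: "space (ref_meas t) = UNIV"
  unfolding ref_meas_def by (simp add: space_measure_of_conv)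

lemma emeasure_ref_meas:
  assumes A: "A \<in> sets borel"
  shows "emeasure (ref_meas t) A = emeasure lborel A + emeasure (count_space UNIV) {i::nat. 1 \<le> i \<and> t i \<in> A}"
  unfolding ref_meas_def
proof (rule emeasure_measure_of_sigma)
  show "sigma_algebra UNIV (sets borel)" using sets.sigma_algebra_axioms[of borel] by simp
  show "positive (sets borel) (\<lambda>A. emeasure lborel A + emeasure (count_space UNIV) {i::nat. 1 \<le> i \<and> t i \<in> A})"
    by (simp add: positive_def)
  show "countably_additive (sets borel) (\<lambda>A. emeasure lborel A + emeasure (count_space UNIV) {i::nat. 1 \<le> i \<and> t i \<in> A})"
  proof (rule countably_additiveI)
    fix B :: "nat \<Rightarrow> real set"
    assume B: "range B \<subseteq> sets borel" "disjoint_family B" "\<Union> (range B) \<in> sets borel"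
    let ?c = "\<lambda>A. emeasure (count_space UNIV) {i::nat. 1 \<le> i \<and> t i \<in> A}"
    have "(\<Sum>i. emeasure lborel (B i) + ?c (B i)) = (\<Sum>i. emeasure lborel (B i)) + (\<Sum>i. ?c (B i))"
      by (rule suminf_add[symmetric]) auto
    also have "(\<Sum>i. emeasure lborel (B i)) = emeasure lborel (\<Union> (range B))"
      using B by (intro suminf_emeasure) auto
    also have "(\<Sum>i. ?c (B i)) = emeasure (count_space UNIV) (\<Union>i. {l::nat. 1 \<le> l \<and> t l \<in> B i})"
      using B(2) by (intro suminf_emeasure) (auto simp: disjoint_family_on_def)
    also have "(\<Union>i. {l::nat. 1 \<le> l \<and> t l \<in> B i}) = {l. 1 \<le> l \<and> t l \<in> \<Union> (range B)}" by auto
    finally show "(\<Sum>i. emeasure lborel (B i) + ?c (B i)) = emeasure lborel (\<Union> (range B)) + ?c (\<Union> (range B))" .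
  qed
qed (rule A)

lemma nn_integral_ref_lborel:
  assumes J: "J \<in> sets borel" "\<And>i. 1 \<le> i \<Longrightarrow> t i \<notin> J" and h: "h \<in> borel_measurable borel"
  shows "(\<integral>\<^sup>+x. h x * indicator J x \<partial>ref_meas t) = (\<integral>\<^sup>+x. h x * indicator J x \<partial>lborel)"
proof -
  have "restrict_space (ref_meas t) J = restrict_space lborel J"
  proof (rule measure_eqI)
    show "sets (restrict_space (ref_meas t) J) = sets (restrict_space lborel J)"
      by (simp add: sets_restrict_space)
    fix A assume A: "A \<in> sets (restrict_space (ref_meas t) J)"
    then have A': "A \<subseteq> J" "A \<in> sets borel" using J(1) by (auto simp: sets_restrict_space)
    then have "{i::nat. 1 \<le> i \<and> t i \<in> A} = {}" using J(2) by blast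
    then have "emeasure (ref_meas t) A = emeasure lborel A"
      unfolding emeasure_ref_meas[OF A'(2)] by (simp only: emeasure_empty add_0_right)
    then show "emeasure (restrict_space (ref_meas t) J) A = emeasure (restrict_space lborel J) A"
      using J(1) A' by (subst (1 2) emeasure_restrict_space) auto
  qed
  moreover have "(\<integral>\<^sup>+x. h x * indicator J x \<partial>M) = (\<integral>\<^sup>+x. h x \<partial>restrict_space M J)"
    if "sets M = sets borel" "space M = UNIV" for M
    using J(1) that by (subst nn_integral_restrict_space) auto
  ultimately show ?thesis by simp
qed

lemma (in moran_samples) emeasure_ref_point:
  assumes "1 \<le> l" shows "emeasure (ref_meas t) {t l} = 1"
proof -
  have "{i::nat. 1 \<le> i \<and> t i \<in> {t l}} = {l}" using assms by auto
  then show ?thesis by (subst emeasure_ref_meas) auto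
qed

lemma (in moran_samples) emeasure_ref_singleton:
  assumes "\<And>l. 1 \<le> l \<Longrightarrow> t l \<noteq> y" shows "emeasure (ref_meas t) {y} = 0"
proof -
  have e: "{i::nat. 1 \<le> i \<and> t i \<in> {y}} = {}" using assms by auto
  have "emeasure (ref_meas t) {y} = emeasure lborel {y} + emeasure (count_space UNIV) {i::nat. 1 \<le> i \<and> t i \<in> {y}}"
    by (rule emeasure_ref_meas) simp
  also have "\<dots> = 0" unfolding e by simp
  finally show ?thesis .
qed

lemma (in moran_samples) sigma_finite_ref_meas: "sigma_finite_measure (ref_meas t)"
proof
  let ?T = "t ` {1..}"
  let ?A = "range (\<lambda>N::nat. {- real N..real N} - ?T) \<union> (\<lambda>x. {x}) ` ?T"
  have T: "?T \<in> sets borel" by (rule sets.countable) auto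
  have "(\<Union>?A) = UNIV"
  proof -
    have "x \<in> \<Union>?A" for x
    proof (cases "x \<in> ?T")
      case False
      obtain N :: nat where "\<bar>x\<bar> < real N" using reals_Archimedean2 by blast
      then have "x \<in> {- real N..real N} - ?T" using False by auto
      then show ?thesis by blast
    qed auto
    then show ?thesis by blast
  qed
  moreover have "emeasure (ref_meas t) a \<noteq> \<infinity>" if "a \<in> ?A" for a
    using that
  proof
    assume "a \<in> range (\<lambda>N::nat. {- real N..real N} - ?T)"
    then obtain N :: nat where a: "a = {- real N..real N} - ?T" by auto
    have e: "{i::nat. 1 \<le> i \<and> t i \<in> a} = {}" unfolding a by auto
    have "emeasure (ref_meas t) a = emeasure lborel a + emeasure (count_space UNIV) {i::nat. 1 \<le> i \<and> t i \<in> a}"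
      using T by (intro emeasure_ref_meas) (auto simp: a)
    also have "\<dots> = emeasure lborel a" unfolding e by simp
    also have "\<dots> \<le> emeasure lborel {- real N..real N}" using T unfolding a by (intro emeasure_mono) auto
    also have "\<dots> < \<infinity>" by simp
    finally show ?thesis by simp
  next
    assume "a \<in> (\<lambda>x. {x}) ` ?T"
    then obtain l where "1 \<le> l" "a = {t l}" by auto
    then show ?thesis using emeasure_ref_point by simp
  qed
  moreover have "countable ?A" by auto
  moreover have "?A \<subseteq> sets (ref_meas t)" using T by auto
  ultimately show "\<exists>A. countable A \<and> A \<subseteq> sets (ref_meas t) \<and> \<Union> A = space (ref_meas t) \<and> (\<forall>a\<in>A. emeasure (ref_meas t) a \<noteq> \<infinity>)"
    by (intro exI[of _ ?A]) auto
qed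

context cell begin

definition branch_set :: "nat set" where "branch_set = {j\<in>{2..k}. lo j < hi j}"
definition direct_set :: "nat set" where "direct_set = {j\<in>{2..k}. lo j = hi j}"

lemma branch_direct_split: "{2..k} = branch_set \<union> direct_set" "branch_set \<inter> direct_set = {}" "finite branch_set" "finite direct_set"
proof -
  have "lo j < hi j \<or> lo j = hi j" if "j \<in> {2..k}" for j using lohi[OF that] by auto
  then show "{2..k} = branch_set \<union> direct_set" unfolding branch_set_def direct_set_def by blast
qed (auto simp: branch_set_def direct_set_def)

context
  fixes b :: "nat \<Rightarrow> real"
  assumes b: "in_box b"
begin

lemma sample_time_iff:
  assumes j: "j \<in> {2..k}" shows "is_sample_time t (b j) \<longleftrightarrow> j \<in> direct_set"
proof
  assume "is_sample_time t (b j)"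
  then obtain i where i: "1 \<le> i" "t i = b j" by (auto simp: is_sample_time_def)
  obtain i' where i': "i' \<in> {1..<j}" "b j \<le> t i'" using shape_less_t[OF box_shape[OF b] j] by blast
  then have "t i \<le> t i'" using i by simp
  then have "i \<le> i'" unfolding t_le .
  then have "i \<in> {1..k}" using i i' j by auto
  from box_t[OF b j this] show "j \<in> direct_set" using i(2) j by (auto simp: direct_set_def)
next
  assume J: "j \<in> direct_set"
  then obtain l where "l \<in> {1..k}" "lo j = t l" using pt[of j] by (auto simp: direct_set_def)
  moreover have "b j = lo j" using box_bounds[OF b j] J by (simp add: direct_set_def)
  ultimately show "is_sample_time t (b j)" by (auto simp: is_sample_time_def)
qed

lemma branch_idx_eq: "branch_idx t k b = branch_set"
  using sample_time_iff branch_direct_split by (auto simp: branch_idx_def)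

lemma dead_iff:
  assumes i: "i \<in> {1..k}" shows "dead t k b i \<longleftrightarrow> (\<exists>j\<in>direct_set. lo j = t i)"
proof
  assume "dead t k b i"
  then obtain j where j: "i < j" "j \<le> k" "b j = t i" by (auto simp: dead_def)
  then have j2: "j \<in> {2..k}" using i by auto
  then have "lo j = hi j \<and> hi j = t i" using box_t[OF b j2 i] j by simp
  then show "\<exists>j\<in>direct_set. lo j = t i" using j2 by (auto simp: direct_set_def)
next
  assume "\<exists>j\<in>direct_set. lo j = t i"
  then obtain j where j: "j \<in> direct_set" "lo j = t i" by blast
  then have j2: "j \<in> {2..k}" by (simp add: direct_set_def)
  have "b j = t i" using box_bounds[OF b j2] j by (simp add: direct_set_def)
  then show "dead t k b i" using shape_direct[OF box_shape[OF b] j2 i] j2 by (auto simp: dead_def)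
qed

definition dead_set :: "nat set" where "dead_set = {i\<in>{1..k}. dead t k b i}"

lemma live_eq: "live_idx t k b = {1..k} - dead_set"
  by (auto simp: live_idx_def dead_set_def)

lemma dead_point_card: "card {i\<in>dead_set. t i > x} = card {j\<in>direct_set. b j > x}"
proof (rule bij_betw_same_card[symmetric])
  let ?g = "\<lambda>j. THE i. i \<in> {1..k} \<and> t i = lo j"
  have g: "?g j \<in> {1..k} \<and> t (?g j) = lo j \<and> b j = lo j" if j: "j \<in> direct_set" for j
  proof -
    have j2: "j \<in> {2..k}" using j by (simp add: direct_set_def)
    obtain l where l: "l \<in> {1..k}" "lo j = t l" using pt[OF j2] j by (auto simp: direct_set_def)
    then have gj: "?g j = l" by (intro the_equality) auto
    have "b j = lo j" using box_bounds[OF b j2] j by (simp add: direct_set_def)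
    then show ?thesis unfolding gj using l by simp
  qed
  show "bij_betw ?g {j\<in>direct_set. b j > x} {i\<in>dead_set. t i > x}"
    unfolding bij_betw_def
  proof
    show "inj_on ?g {j\<in>direct_set. b j > x}"
    proof (rule inj_onI)
      fix j j' assume "j \<in> {j\<in>direct_set. b j > x}" "j' \<in> {j\<in>direct_set. b j > x}" and e: "?g j = ?g j'"
      then have J: "j \<in> direct_set" "j' \<in> direct_set" by auto
      have "lo j = lo j'" using g[OF J(1)] g[OF J(2)] e by metis
      then show "j = j'" using lo_inj J by (auto simp: direct_set_def)
    qed
    show "?g ` {j\<in>direct_set. b j > x} = {i\<in>dead_set. t i > x}"
    proof
      show "?g ` {j\<in>direct_set. b j > x} \<subseteq> {i\<in>dead_set. t i > x}"
      proof
        fix i assume "i \<in> ?g ` {j\<in>direct_set. b j > x}"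
        then obtain j where j: "j \<in> direct_set" "b j > x" "i = ?g j" by blast
        then show "i \<in> {i\<in>dead_set. t i > x}" using g[OF j(1)] dead_iff[of i] by (auto simp: dead_set_def)
      qed
      show "{i\<in>dead_set. t i > x} \<subseteq> ?g ` {j\<in>direct_set. b j > x}"
      proof
        fix i assume i: "i \<in> {i\<in>dead_set. t i > x}"
        then obtain j where j: "j \<in> direct_set" "lo j = t i" using dead_iff[of i] by (auto simp: dead_set_def)
        have "i = ?g j" using g[OF j(1)] j(2) t_eq[of "?g j" i] by simp
        then show "i \<in> ?g ` {j\<in>direct_set. b j > x}" using g[OF j(1)] j i by (intro image_eqI[of _ _ j]) auto
      qed
    qed
  qed
qed

lemma lineages_eq: "lineages t k b x = int (card {i\<in>{1..k}. t i > x}) - int (card {j\<in>{2..k}. b j > x})"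
proof -
  have "{i\<in>{1..k}. t i > x} = {i\<in>live_idx t k b. t i > x} \<union> {i\<in>dead_set. t i > x}"
    by (auto simp: live_eq dead_set_def)
  moreover have "{i\<in>live_idx t k b. t i > x} \<inter> {i\<in>dead_set. t i > x} = {}" by (auto simp: live_eq)
  moreover have "finite (live_idx t k b)" "finite dead_set" by (auto simp: live_eq dead_set_def)
  ultimately have 1: "card {i\<in>{1..k}. t i > x} = card {i\<in>live_idx t k b. t i > x} + card {i\<in>dead_set. t i > x}"
    by (simp add: card_Un_disjoint)
  have "{j\<in>{2..k}. b j > x} = {j\<in>branch_set. b j > x} \<union> {j\<in>direct_set. b j > x}" using branch_direct_split(1) by auto
  moreover have "{j\<in>branch_set. b j > x} \<inter> {j\<in>direct_set. b j > x} = {}" using branch_direct_split(2) by auto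
  ultimately have 2: "card {j\<in>{2..k}. b j > x} = card {j\<in>branch_set. b j > x} + card {j\<in>direct_set. b j > x}"
    using branch_direct_split(3,4) by (simp add: card_Un_disjoint)
  show ?thesis unfolding lineages_def branch_idx_eq using 1 2 dead_point_card[of x] by simp
qed

lemma card_live: "card (live_idx t k b) = Suc (card branch_set)" "card (live_idx t k b) \<le> k" "k - card (live_idx t k b) = card dead_set"
proof -
  define x where "x = Min crit0 - 1"
  have lt: "x < y" if "y \<in> crit0" for y using Min_le[OF finite_crit(1) that] by (simp add: x_def)
  have "{j\<in>direct_set. b j > x} = direct_set"
  proof -
    have "x < b j" if "j \<in> direct_set" for j
      using that lt[of "lo j"] box_bounds(1)[OF b, of j] by (auto simp: direct_set_def crit0_def)
    then show ?thesis by auto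
  qed
  moreover have "{i\<in>dead_set. t i > x} = dead_set"
  proof -
    have "x < t i" if "i \<in> dead_set" for i using that lt[of "t i"] by (auto simp: dead_set_def crit0_def)
    then show ?thesis by auto
  qed
  ultimately have c1: "card dead_set = card direct_set" using dead_point_card[of x] by simp
  have "card {2..k} = card branch_set + card direct_set"
    by (subst branch_direct_split(1)) (rule card_Un_disjoint[OF branch_direct_split(3,4,2)])
  then have c2: "card branch_set + card direct_set = k - 1" by simp
  have c3: "card (live_idx t k b) = k - card dead_set" unfolding live_eq by (subst card_Diff_subset) (auto simp: dead_set_def)
  show "card (live_idx t k b) = Suc (card branch_set)" "card (live_idx t k b) \<le> k" "k - card (live_idx t k b) = card dead_set"
    using c1 c2 c3 k2 by auto
qed

lemma lineages_step:
  assumes q: "q < m" and x: "c (Suc q) \<le> x" "x < c q"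
  shows "real_of_int (lineages t k b x) = (if \<exists>j\<in>branch_set. lo j = c (Suc q) \<and> x < b j then real (num_blocks q) - 1 else real (num_blocks q))"
proof -
  have t1: "{i\<in>{1..k}. t i > x} = I q"
  proof -
    have "x < t i \<longleftrightarrow> c q \<le> t i" if "i \<in> {1..k}" for i
      using c_consec[OF crit_t[OF that] q] x by auto
    then show ?thesis by (auto simp: I_def)
  qed
  define Lq where "Lq = {j\<in>{2..k}. c q \<le> lo j}"
  have sub: "Lq \<subseteq> I q"
  proof
    fix j assume "j \<in> Lq"
    then have j: "j \<in> {2..k}" "c q \<le> lo j" by (auto simp: Lq_def)
    obtain i where i: "i \<in> {1..<j}" "b j \<le> t i" using shape_less_t[OF box_shape[OF b] j(1)] by blast
    have "t i < t j" using i by simp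
    then have "c q \<le> t j" using i j box_bounds(1)[OF b j(1)] by linarith
    then show "j \<in> I q" using j by (auto simp: I_def)
  qed
  have "roots q = I q - Lq" by (auto simp: roots_def Lq_def I_def)
  then have num_blocks: "real (num_blocks q) = real (card (I q)) - real (card Lq)"
    using sub finite_I[of q] card_mono[OF finite_I sub] by (simp add: num_blocks_def card_Diff_subset finite_subset of_nat_diff)
  have bj: "x < b j \<longleftrightarrow> c q \<le> lo j \<or> (lo j < hi j \<and> lo j = c (Suc q) \<and> x < b j)" if j: "j \<in> {2..k}" for j
  proof
    assume xb: "x < b j"
    have "c (Suc q) \<le> lo j"
      using crit_avoid[OF c_in_crit j, of "Suc q"] q x xb box_bounds(2)[OF b j] by auto
    then consider "c q \<le> lo j" | "lo j = c (Suc q)" using c_squeeze[OF crit_lo[OF j] q] by blast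
    then show "c q \<le> lo j \<or> (lo j < hi j \<and> lo j = c (Suc q) \<and> x < b j)"
    proof cases
      case 2
      have "lo j \<noteq> hi j" using box_bounds[OF b j] 2 x xb by auto
      then show ?thesis using 2 xb lohi[OF j] by auto
    qed simp
  next
    assume "c q \<le> lo j \<or> (lo j < hi j \<and> lo j = c (Suc q) \<and> x < b j)"
    then show "x < b j" using box_bounds(1)[OF b j] x by auto
  qed
  show ?thesis
  proof (cases "\<exists>j\<in>branch_set. lo j = c (Suc q) \<and> x < b j")
    case True
    then obtain js where js: "js \<in> {2..k}" "lo js < hi js" "lo js = c (Suc q)" "x < b js" by (auto simp: branch_set_def)
    have "{j\<in>{2..k}. b j > x} = insert js Lq"
    proof
      show "{j\<in>{2..k}. b j > x} \<subseteq> insert js Lq" using bj lo_inj[OF _ js(1)] js(3) by (auto simp: Lq_def)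
      show "insert js Lq \<subseteq> {j\<in>{2..k}. b j > x}" using bj js by (auto simp: Lq_def)
    qed
    moreover have "js \<notin> Lq" using js c_less[of q "Suc q"] q by (auto simp: Lq_def)
    ultimately have "card {j\<in>{2..k}. b j > x} = Suc (card Lq)" by (simp add: Lq_def)
    then show ?thesis using True num_blocks unfolding lineages_eq t1 by simp
  next
    case False
    have "x < b j \<longleftrightarrow> c q \<le> lo j" if "j \<in> {2..k}" for j
      using bj[OF that] False that unfolding branch_set_def by blast
    then have "{j\<in>{2..k}. b j > x} = Lq" unfolding Lq_def by blast
    then show ?thesis using False num_blocks unfolding lineages_eq t1 by simp
  qed
qed

lemma lineages_above: "x \<ge> c 0 \<Longrightarrow> lineages t k b x = 0"
proof -
  assume x: "x \<ge> c 0"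
  have "\<not> x < t i" if "i \<in> {1..k}" for i using that x c_0 crit0_less_top[of "t i"] by (auto simp: crit0_def)
  then have 1: "{i\<in>{1..k}. t i > x} = {}" by blast
  have "\<not> x < b j" if "j \<in> {2..k}" for j
    using that x c_0 crit0_less_top[of "hi j"] box_bounds(2)[OF b that] by (auto simp: crit0_def)
  then have 2: "{j\<in>{2..k}. b j > x} = {}" by blast
  show ?thesis unfolding lineages_eq 1 2 by simp
qed

lemma lineages_below: "x < c m \<Longrightarrow> lineages t k b x = 1"
proof -
  assume x: "x < c m"
  have lt: "x < y" if y: "y \<in> crit" for y
  proof -
    obtain q where q: "q \<le> m" "c q = y" using crit_c[OF y] by blast
    then show ?thesis using c_less[of q m] x by (cases "q = m") auto
  qed
  have 1: "{i\<in>{1..k}. t i > x} = {1..k}" using lt[OF crit_t] by auto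
  have "x < b j" if "j \<in> {2..k}" for j using lt[OF crit_lo[OF that]] box_bounds(1)[OF b that] by simp
  then have 2: "{j\<in>{2..k}. b j > x} = {2..k}" by auto
  show ?thesis unfolding lineages_eq 1 2 using k2 by simp
qed

end
lemma branch_step:
  assumes "j \<in> branch_set" shows "\<exists>q<m. c (Suc q) = lo j \<and> c q = hi j"
proof -
  have j: "j \<in> {2..k}" "lo j < hi j" using assms by (auto simp: branch_set_def)
  obtain q where q: "q < m" "c (Suc q) = lo j" using crit0_c[of "lo j"] j(1) by (auto simp: crit0_def)
  have "c q \<le> hi j" using c_consec[OF crit_hi[OF j(1)] q(1)] q(2) j(2) by simp
  moreover have "c (Suc q) < c q" using c_less[of q "Suc q"] q by simp
  then have "hi j \<le> c q" using crit_avoid[OF c_in_crit j(1), of q] q by auto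
  ultimately show ?thesis using q by auto
qed

definition step_of :: "nat \<Rightarrow> nat" where "step_of j = (THE q. q < m \<and> c (Suc q) = lo j)"

lemma step_of_props:
  assumes "j \<in> branch_set" shows "step_of j < m" "c (Suc (step_of j)) = lo j" "c (step_of j) = hi j"
proof -
  obtain q where q: "q < m" "c (Suc q) = lo j" "c q = hi j" using branch_step[OF assms] by blast
  have "step_of j = q" unfolding step_of_def
  proof (rule the_equality)
    fix q' assume "q' < m \<and> c (Suc q') = lo j"
    then show "q' = q" using c_inj[of "Suc q'" "Suc q"] q by simp
  qed (use q in simp)
  then show "step_of j < m" "c (Suc (step_of j)) = lo j" "c (step_of j) = hi j" using q by auto
qed

lemma merge_step_iff_branch: "merge_step q \<longleftrightarrow> (\<exists>j\<in>branch_set. lo j = c (Suc q))"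
  by (auto simp: merge_step_def branch_set_def)

lemma bij_step_of: "bij_betw step_of branch_set {q. q < m \<and> merge_step q}"
  unfolding bij_betw_def
proof
  show "inj_on step_of branch_set"
  proof (rule inj_onI)
    fix j j' assume j: "j \<in> branch_set" "j' \<in> branch_set" "step_of j = step_of j'"
    then have "lo j = lo j'" using step_of_props(2)[OF j(1)] step_of_props(2)[OF j(2)] by simp
    then show "j = j'" using lo_inj[of j j'] j(1,2) by (simp add: branch_set_def)
  qed
  show "step_of ` branch_set = {q. q < m \<and> merge_step q}"
  proof
    show "step_of ` branch_set \<subseteq> {q. q < m \<and> merge_step q}" using step_of_props merge_step_iff_branch by force
    show "{q. q < m \<and> merge_step q} \<subseteq> step_of ` branch_set"
    proof
      fix q assume "q \<in> {q. q < m \<and> merge_step q}"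
      then obtain j where j: "j \<in> branch_set" "lo j = c (Suc q)" "q < m" using merge_step_iff_branch by auto
      then have "step_of j = q" using c_inj[of "Suc (step_of j)" "Suc q"] step_of_props(1,2)[OF j(1)] by simp
      then show "q \<in> step_of ` branch_set" using j by auto
    qed
  qed
qed

lemma num_blocks_ge_2:
  assumes "j \<in> branch_set" shows "2 \<le> num_blocks (step_of j)"
proof -
  define q where "q = step_of j"
  have j: "j \<in> {2..k}" "lo j < hi j" using assms by (auto simp: branch_set_def)
  note q = step_of_props[OF assms, folded q_def]
  have cq: "c (Suc q) < c q" using c_less[of q "Suc q"] q by simp
  obtain i0 where i0: "i0 \<in> {1..<j}" "f (i0, j) = j" using shape_parent[OF sh0 j(1)] by blast
  have "a0 j \<le> t i0" using shape_le_t[OF sh0, of i0 j] i0 j by simp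
  then have "lo j < t i0" using box_bounds(3)[OF in_box_a0 j] by simp
  then have ci: "c q \<le> t i0" using c_consec[OF crit_t q(1), of i0] i0 j q by auto
  have iI: "i0 \<in> I q" using i0 j ci by (auto simp: I_def)
  have "t i0 < t j" using i0 by simp
  then have "c q \<le> t j" using ci by linarith
  then have "j \<in> roots q" using j q cq by (auto simp: roots_def I_def)
  moreover obtain r where r: "r \<in> roots q" "r \<le> i0" using root_exists[OF iI] by blast
  moreover have "r \<noteq> j" using r i0 by auto
  moreover have "finite (roots q)" using finite_I by (auto simp: roots_def)
  ultimately have "card {r, j} \<le> card (roots q)" by (intro card_mono) auto
  then show ?thesis using \<open>r \<noteq> j\<close> by (simp add: num_blocks_def q_def)
qed

text \<open>On a cell the density is \<open>const_fac\<close> times the product of the \<open>coord_density j\<close>, so its integral factorises.\<close>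

definition coord_density :: "nat \<Rightarrow> real \<Rightarrow> real" where
  "coord_density j y = (if lo j < hi j then \<mu> / real (n choose 2) *
     exp (- \<mu> * (pair_rate (real (num_blocks (step_of j)) - 1) * (y - lo j) + pair_rate (num_blocks (step_of j)) * (hi j - y))) else 1)"

definition const_fac :: real where
  "const_fac = (\<Prod>q<m. samp_fac q) * (\<Prod>q\<in>{q. q < m \<and> \<not> merge_step q}. flow_fac q)"

lemma c_locate:
  assumes "c m \<le> x" "x < c 0" shows "\<exists>q<m. c (Suc q) \<le> x \<and> x < c q"
proof -
  define q0 where "q0 = (LEAST q. c q \<le> x)"
  have 1: "c q0 \<le> x" unfolding q0_def by (rule LeastI[of _ m]) (rule assms)
  have 2: "q0 \<le> m" unfolding q0_def by (rule Least_le) (rule assms)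
  have "q0 \<noteq> 0" using 1 assms by (metis not_le)
  then obtain q where q: "q0 = Suc q" by (cases q0) auto
  then have "\<not> c q \<le> x" using not_less_Least[of q "\<lambda>q. c q \<le> x"] by (simp add: q0_def[symmetric])
  then show ?thesis using 1 2 q by (intro exI[of _ q]) auto
qed

lemma card_measurable:
  fixes g :: "nat \<Rightarrow> real"
  assumes "finite A" shows "(\<lambda>x. real (card {i\<in>A. g i > x})) \<in> borel_measurable borel"
proof -
  have "real (card {i\<in>A. g i > x}) = (\<Sum>i\<in>A. indicator {..<g i} x)" for x
    using assms by (simp add: indicator_def sum.If_cases Int_def)
  then show ?thesis by simp
qed

context
  fixes b :: "nat \<Rightarrow> real"
  assumes b: "in_box b"
begin

definition branch_at :: "nat \<Rightarrow> nat" where "branch_at q = (THE j. j \<in> branch_set \<and> lo j = c (Suc q))"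

lemma branch_at_eq: "j \<in> branch_set \<Longrightarrow> lo j = c (Suc q) \<Longrightarrow> branch_at q = j"
  unfolding branch_at_def using lo_inj by (intro the_equality) (auto simp: branch_set_def)

definition split_time :: "nat \<Rightarrow> real" where "split_time q = (if merge_step q then b (branch_at q) else c (Suc q))"

lemma split_time_bounds: "q < m \<Longrightarrow> c (Suc q) \<le> split_time q \<and> split_time q \<le> c q"
proof (cases "merge_step q")
  case True
  assume q: "q < m"
  obtain j where j: "j \<in> branch_set" "lo j = c (Suc q)" using True merge_step_iff_branch by auto
  then have "step_of j = q" using c_inj[of "Suc (step_of j)" "Suc q"] step_of_props(1,2)[OF j(1)] q by simp
  then have "hi j = c q" using step_of_props(3)[OF j(1)] by simp
  moreover have "lo j \<le> b j" "b j \<le> hi j" using box_bounds[OF b, of j] j by (auto simp: branch_set_def)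
  ultimately show ?thesis using True branch_at_eq[OF j] j by (simp add: split_time_def)
next
  case False
  assume "q < m"
  then show ?thesis using False c_less[of q "Suc q"] by (simp add: split_time_def)
qed

lemma lineages_split_time:
  assumes q: "q < m" and x: "c (Suc q) < x" "x < c q"
  shows "real_of_int (lineages t k b x) = (if x < split_time q then real (num_blocks q) - 1 else real (num_blocks q))"
proof -
  have "(\<exists>j\<in>branch_set. lo j = c (Suc q) \<and> x < b j) \<longleftrightarrow> x < split_time q"
  proof (cases "merge_step q")
    case True
    obtain j where j: "j \<in> branch_set" "lo j = c (Suc q)" using True merge_step_iff_branch by auto
    have "split_time q = b j" using True branch_at_eq[OF j] by (simp add: split_time_def)
    then show ?thesis using j branch_at_eq by metis
  next
    case False
    then show ?thesis using merge_step_iff_branch x by (auto simp: split_time_def)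
  qed
  then show ?thesis using lineages_step[OF b q _ x(2)] x by simp
qed

definition rate :: "real \<Rightarrow> real" where
  "rate x = \<mu> * ((real_of_int (lineages t k b x) * (real_of_int (lineages t k b x) - 1) / 2) / real (n choose 2))"

lemma rate_eq: "rate x = \<mu> * pair_rate (real_of_int (lineages t k b x))"
  by (simp add: rate_def pair_rate_def n_choose_2)

definition step_rate :: "nat \<Rightarrow> real \<Rightarrow> real" where
  "step_rate q x = \<mu> * pair_rate (real (num_blocks q) - 1) * indicator {c (Suc q)<..<split_time q} x
     + \<mu> * pair_rate (num_blocks q) * indicator {split_time q<..<c q} x"

lemma rate_AE: "AE x in lborel. rate x = (\<Sum>q<m. step_rate q x)"
proof -
  have "finite (c ` {..m} \<union> split_time ` {..<m})" by simp
  then have "AE x in lborel. x \<notin> c ` {..m} \<union> split_time ` {..<m}"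
    by (intro AE_not_in finite_imp_null_set_lborel)
  then show ?thesis
  proof eventually_elim
    case (elim x)
    have nc: "x \<noteq> c q" if "q \<le> m" for q using elim that by auto
    have ns: "x \<noteq> split_time q" if "q < m" for q using elim that by auto
    have cmono: "c q' \<le> c q" if "q \<le> q'" "q' \<le> m" for q q'
      using c_less[of q q'] that by (cases "q = q'") auto
    have zero: "step_rate q x = 0" if "q < m" "x \<le> c (Suc q) \<or> c q \<le> x" for q
      using that split_time_bounds[OF that(1)] by (auto simp: step_rate_def indicator_def)
    consider "c 0 < x" | "x < c m" | "c m \<le> x" "x < c 0" using nc[of 0] by fastforce
    then show ?case
    proof cases
      case 1
      have "step_rate q x = 0" if "q < m" for q using zero[OF that] cmono[of 0 q] that 1 by auto
      then show ?thesis using lineages_above[OF b, of x] 1 by (simp add: rate_eq pair_rate_def)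
    next
      case 2
      have "step_rate q x = 0" if "q < m" for q using zero[OF that] cmono[of "Suc q" m] that 2 by auto
      then show ?thesis using lineages_below[OF b, of x] 2 by (simp add: rate_eq pair_rate_def)
    next
      case 3
      obtain q where q: "q < m" "c (Suc q) \<le> x" "x < c q" using c_locate[OF 3] by blast
      have lt: "c (Suc q) < x" using q nc[of "Suc q"] by auto
      have "step_rate q' x = 0" if "q' \<in> {..<m} - {q}" for q'
      proof -
        have "q' \<noteq> q" using that by simp
        then consider "q' < q" | "q < q'" by linarith
        then show ?thesis
        proof cases
          case 1
          then show ?thesis using zero[of q'] cmono[of "Suc q'" q] q that by auto
        next
          case 2
          then show ?thesis using zero[of q'] cmono[of "Suc q" q'] q that by auto
        qed
      qed
      then have "(\<Sum>q<m. step_rate q x) = step_rate q x"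
        using q by (subst sum.remove[of _ q]) auto
      also have "\<dots> = rate x"
        using lineages_split_time[OF q(1) lt q(3)] ns[OF q(1)] lt q by (auto simp: step_rate_def rate_eq indicator_def)
      finally show ?thesis by simp
    qed
  qed
qed

lemma integral_rate:
  "(\<integral>x. rate x \<partial>lborel) = (\<Sum>q<m. \<mu> * (pair_rate (real (num_blocks q) - 1) * (split_time q - c (Suc q)) + pair_rate (num_blocks q) * (c q - split_time q)))"
proof -
  have fin: "finite (live_idx t k b)" "finite (branch_idx t k b)"
    by (auto simp: live_idx_def branch_idx_def)
  have "(\<lambda>x. real_of_int (lineages t k b x)) = (\<lambda>x. real (card {i\<in>live_idx t k b. t i > x}) - real (card {j\<in>branch_idx t k b. b j > x}))"
    by (simp add: lineages_def)
  then have [measurable]: "(\<lambda>x. real_of_int (lineages t k b x)) \<in> borel_measurable borel"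
    using card_measurable[OF fin(1), of t] card_measurable[OF fin(2), of b] by simp
  have ind: "has_bochner_integral lborel (\<lambda>x. r * indicator {u<..<v} x) (r * (v - u))" if "u \<le> v" for r u v :: real
  proof -
    have "has_bochner_integral lborel (indicator {u<..<v} :: real \<Rightarrow> real) (measure lborel {u<..<v})"
      using that by (intro has_bochner_integral_real_indicator) auto
    then show ?thesis using that by (intro has_bochner_integral_mult_right) auto
  qed
  have "has_bochner_integral lborel (\<lambda>x. \<Sum>q<m. step_rate q x)
      (\<Sum>q<m. \<mu> * pair_rate (real (num_blocks q) - 1) * (split_time q - c (Suc q)) + \<mu> * pair_rate (num_blocks q) * (c q - split_time q))"
    unfolding step_rate_def using split_time_bounds by (intro has_bochner_integral_sum has_bochner_integral_add ind) auto
  then have "(\<integral>x. (\<Sum>q<m. step_rate q x) \<partial>lborel)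
      = (\<Sum>q<m. \<mu> * pair_rate (real (num_blocks q) - 1) * (split_time q - c (Suc q)) + \<mu> * pair_rate (num_blocks q) * (c q - split_time q))"
    by (rule has_bochner_integral_integral_eq)
  moreover have "(\<integral>x. rate x \<partial>lborel) = (\<integral>x. (\<Sum>q<m. step_rate q x) \<partial>lborel)"
    by (rule integral_cong_AE) (auto simp: rate_AE, simp_all add: rate_def step_rate_def)
  ultimately show ?thesis by (simp add: algebra_simps)
qed

lemma samp_prod:
  "(\<Prod>q<m. samp_fac q) = real n powi (int (card (live_idx t k b)) - int k)
    * (\<Prod>i\<in>live_idx t k b. 1 - real_of_int (lineages t k b (t i)) / real n)"
proof -
  let ?sf = "\<lambda>i. if i \<in> dead_set b then 1 / real n else 1 - real_of_int (lineages t k b (t i)) / real n"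
  have "(\<Prod>q<m. samp_fac q) = (\<Prod>q\<in>samp_steps. samp_fac q)"
    by (rule prod.mono_neutral_right) (auto simp: samp_steps_def samp_fac_def)
  also have "\<dots> = (\<Prod>q\<in>samp_steps. ?sf (sample_at q))"
  proof (rule prod.cong)
    fix q assume q: "q \<in> samp_steps"
    then have qm: "q < m" "samp_step q" by (auto simp: samp_steps_def)
    obtain i where i: "i \<in> {1..k}" "t i = c (Suc q)" using qm by (auto simp: samp_step_def)
    have sample_at: "sample_at q = i" by (rule sample_at_eq[OF i])
    have pd: "point_step q \<longleftrightarrow> i \<in> dead_set b"
      using dead_iff[OF b i(1)] i by (auto simp: point_step_def dead_set_def[OF b] direct_set_def)
    have "\<not> (\<exists>j\<in>branch_set. lo j = c (Suc q) \<and> c (Suc q) < b j)"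
    proof
      assume "\<exists>j\<in>branch_set. lo j = c (Suc q) \<and> c (Suc q) < b j"
      then obtain j where "j \<in> branch_set" "lo j = c (Suc q)" by blast
      then show False using br[of j "lo j"] qm(2) by (auto simp: branch_set_def samp_step_def)
    qed
    then have "real_of_int (lineages t k b (t i)) = real (num_blocks q)"
      using lineages_step[OF b qm(1), of "c (Suc q)"] c_less[of q "Suc q"] qm(1) i by auto
    then show "samp_fac q = ?sf (sample_at q)" using pd qm sample_at by (simp add: samp_fac_def)
  qed simp
  also have "\<dots> = (\<Prod>i\<in>{1..k}. ?sf i)" by (rule prod.reindex_bij_betw[OF bij_sample_at])
  also have "{1..k} = dead_set b \<union> live_idx t k b" by (auto simp: live_eq[OF b] dead_set_def[OF b])
  also have "(\<Prod>i\<in>dead_set b \<union> live_idx t k b. ?sf i) = (\<Prod>i\<in>dead_set b. ?sf i) * (\<Prod>i\<in>live_idx t k b. ?sf i)"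
    by (rule prod.union_disjoint) (auto simp: live_eq[OF b] dead_set_def[OF b])
  also have "(\<Prod>i\<in>dead_set b. ?sf i) = (1 / real n) ^ card (dead_set b)" by simp
  also have "(1 / real n) ^ card (dead_set b) = real n powi (int (card (live_idx t k b)) - int k)"
  proof -
    have "int (card (live_idx t k b)) - int k = - int (card (dead_set b))" using card_live(2,3)[OF b] by linarith
    then show ?thesis by (simp add: power_int_minus power_one_over inverse_eq_divide)
  qed
  also have "(\<Prod>i\<in>live_idx t k b. ?sf i) = (\<Prod>i\<in>live_idx t k b. 1 - real_of_int (lineages t k b (t i)) / real n)"
    by (rule prod.cong) (auto simp: live_eq[OF b])
  finally show ?thesis .
qed

theorem density_eq: "smg_density n \<mu> t k b = const_fac * (\<Prod>j\<in>{2..k}. coord_density j (b j))"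
proof -
  let ?E = "\<lambda>q. exp (- (\<mu> * (pair_rate (real (num_blocks q) - 1) * (split_time q - c (Suc q)) + pair_rate (num_blocks q) * (c q - split_time q))))"
  have "exp (- (\<integral>x. rate x \<partial>lborel)) = (\<Prod>q<m. ?E q)"
    unfolding integral_rate by (simp add: sum_negf[symmetric] exp_sum)
  also have "{..<m} = {q. q < m \<and> \<not> merge_step q} \<union> {q. q < m \<and> merge_step q}" by auto
  also have "(\<Prod>q\<in>{q. q < m \<and> \<not> merge_step q} \<union> {q. q < m \<and> merge_step q}. ?E q)
     = (\<Prod>q\<in>{q. q < m \<and> \<not> merge_step q}. ?E q) * (\<Prod>q\<in>{q. q < m \<and> merge_step q}. ?E q)"
    by (rule prod.union_disjoint) auto
  also have "(\<Prod>q\<in>{q. q < m \<and> \<not> merge_step q}. ?E q) = (\<Prod>q\<in>{q. q < m \<and> \<not> merge_step q}. flow_fac q)"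
    by (rule prod.cong) (auto simp: split_time_def flow_fac_def algebra_simps)
  also have "(\<Prod>q\<in>{q. q < m \<and> merge_step q}. ?E q) = (\<Prod>j\<in>branch_set. ?E (step_of j))"
    by (rule prod.reindex_bij_betw[OF bij_step_of, symmetric])
  finally have ex: "exp (- (\<integral>x. rate x \<partial>lborel))
      = (\<Prod>q\<in>{q. q < m \<and> \<not> merge_step q}. flow_fac q) * (\<Prod>j\<in>branch_set. ?E (step_of j))" .
  have "(\<mu> / real (n choose 2)) ^ card branch_set * (\<Prod>j\<in>branch_set. ?E (step_of j)) = (\<Prod>j\<in>branch_set. \<mu> / real (n choose 2) * ?E (step_of j))"
    by (simp only: prod.distrib prod_constant)
  also have "\<dots> = (\<Prod>j\<in>branch_set. coord_density j (b j))"
  proof (rule prod.cong)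
    fix j assume j: "j \<in> branch_set"
    note q = step_of_props[OF j]
    have "merge_step (step_of j)" using j q merge_step_iff_branch by auto
    then have "split_time (step_of j) = b j" using branch_at_eq[OF j, of "step_of j"] q by (simp add: split_time_def)
    then show "\<mu> / real (n choose 2) * ?E (step_of j) = coord_density j (b j)" using q j by (simp add: coord_density_def branch_set_def)
  qed simp
  also have "\<dots> = (\<Prod>j\<in>{2..k}. coord_density j (b j))"
    by (rule prod.mono_neutral_left) (auto simp: branch_set_def coord_density_def)
  finally have hp: "(\<mu> / real (n choose 2)) ^ card branch_set * (\<Prod>j\<in>branch_set. ?E (step_of j)) = (\<Prod>j\<in>{2..k}. coord_density j (b j))" .
  have "smg_density n \<mu> t k b = real n powi (int (card (live_idx t k b)) - int k) * (\<mu> / real (n choose 2)) ^ card branch_set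
      * exp (- (\<integral>x. rate x \<partial>lborel)) * (\<Prod>i\<in>live_idx t k b. 1 - real_of_int (lineages t k b (t i)) / real n)"
    by (simp add: smg_density_def Let_def rate_def[abs_def] card_live(1)[OF b])
  also have "\<dots> = (\<Prod>q<m. samp_fac q) * (\<mu> / real (n choose 2)) ^ card branch_set * exp (- (\<integral>x. rate x \<partial>lborel))"
    by (simp only: samp_prod ac_simps)
  also have "\<dots> = const_fac * ((\<mu> / real (n choose 2)) ^ card branch_set * (\<Prod>j\<in>branch_set. ?E (step_of j)))"
    by (simp only: ex const_fac_def ac_simps)
  finally show ?thesis unfolding hp .
qed

end

lemma coord_density_integral:
  assumes j: "j \<in> {2..k}"
  shows "(\<integral>\<^sup>+y. ennreal (coord_density j y) * indicator (cell_set lo hi j) y \<partial>ref_meas t)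
    = ennreal (if lo j < hi j then flow_fac (step_of j) else 1)"
proof (cases "lo j < hi j")
  case False
  then have lh: "lo j = hi j" using lohi[OF j] by simp
  then obtain l where l: "l \<in> {1..k}" "hi j = t l" using pt[OF j lh] by auto
  have "(\<integral>\<^sup>+y. ennreal (coord_density j y) * indicator (cell_set lo hi j) y \<partial>ref_meas t) = (\<integral>\<^sup>+y. indicator {t l} y \<partial>ref_meas t)"
    using False l by (simp add: coord_density_def cell_set_def)
  also have "\<dots> = 1" using l emeasure_ref_point[of l] by simp
  finally show ?thesis using False by simp
next
  case True
  have jB: "j \<in> branch_set" using j True by (simp add: branch_set_def)
  note q = step_of_props[OF jB]
  define N where "N = real (num_blocks (step_of j))"
  define h where "h y = \<mu> / real (n choose 2) * exp (- \<mu> * (pair_rate (N - 1) * (y - lo j) + pair_rate N * (hi j - y)))" for y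
  define F where "F y = exp (- \<mu> * (pair_rate (N - 1) * (y - lo j) + pair_rate N * (hi j - y))) / (N - 1)" for y
  have N: "1 < N" using num_blocks_ge_2[OF jB] by (simp add: N_def)
  have hj: "coord_density j y = h y" for y using True by (simp add: coord_density_def h_def N_def)
  have avoid: "t i \<notin> {lo j<..hi j}" if "1 \<le> i" for i
  proof
    assume ti: "t i \<in> {lo j<..hi j}"
    obtain i' where i': "i' \<in> {1..<j}" "a0 j \<le> t i'" using shape_less_t[OF sh0 j] by blast
    then have "i' \<in> {1..k}" using j by auto
    then have "a0 j < t i' \<or> a0 j = t i'" "hi j < t i'"
      using i' box_t[OF in_box_a0 j, of i'] True by auto
    then have "t i < t i'" using ti unfolding greaterThanAtMost_iff by linarith
    then have "i < i'" unfolding t_less .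
    then have "i \<in> {1..k}" using that i' j by auto
    then show False using br[OF j True, of "t i"] ti by auto
  qed
  have "(\<integral>\<^sup>+y. ennreal (coord_density j y) * indicator (cell_set lo hi j) y \<partial>ref_meas t)
     = (\<integral>\<^sup>+y. ennreal (h y) * indicator {lo j<..hi j} y \<partial>ref_meas t)"
    using True by (simp add: hj cell_set_def)
  also have "\<dots> = (\<integral>\<^sup>+y. ennreal (h y) * indicator {lo j<..hi j} y \<partial>lborel)"
    by (rule nn_integral_ref_lborel) (auto simp: h_def dest: avoid[simplified])
  also have "\<dots> = (\<integral>\<^sup>+y. ennreal (h y) * indicator {lo j..hi j} y \<partial>lborel)"
  proof (rule nn_integral_cong_AE)
    show "AE y in lborel. ennreal (h y) * indicator {lo j<..hi j} y = ennreal (h y) * indicator {lo j..hi j} y"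
      using AE_lborel_singleton[of "lo j"] by eventually_elim (auto split: split_indicator)
  qed
  also have "\<dots> = ennreal (F (hi j) - F (lo j))"
  proof (rule nn_integral_FTC_Icc)
    show "h \<in> borel_measurable borel" unfolding h_def by measurable
    show "0 \<le> h y" for y unfolding h_def using mu by auto
    show "lo j \<le> hi j" using True by simp
    fix y
    have "(F has_real_derivative exp (- \<mu> * (pair_rate (N - 1) * (y - lo j) + pair_rate N * (hi j - y)))
        * (\<mu> * (pair_rate N - pair_rate (N - 1))) / (N - 1)) (at y)"
    proof -
      have "((\<lambda>y. - \<mu> * (pair_rate (N - 1) * (y - lo j) + pair_rate N * (hi j - y))) has_real_derivative
          (\<mu> * (pair_rate N - pair_rate (N - 1)))) (at y)"
        by (auto intro!: derivative_eq_intros simp: algebra_simps)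
      from DERIV_cdivide[OF DERIV_fun_exp[OF this], of "N - 1"] show ?thesis unfolding F_def .
    qed
    also have "exp (- \<mu> * (pair_rate (N - 1) * (y - lo j) + pair_rate N * (hi j - y)))
        * (\<mu> * (pair_rate N - pair_rate (N - 1))) / (N - 1) = h y"
    proof -
      have e: "\<mu> * (pair_rate N - pair_rate (N - 1)) / (N - 1) = \<mu> / real (n choose 2)"
      proof -
        have "\<mu> * (2 * Y / Z) / Y = \<mu> / (Z / 2)" if "Y \<noteq> 0" for Y Z :: real using that by simp
        from this[of "N - 1" "real n * (real n - 1)"] N show ?thesis unfolding pair_rate_diff n_choose_2 by simp
      qed
      show ?thesis unfolding h_def e[symmetric] by simp
    qed
    finally show "DERIV F y :> h y" .
  qed
  also have "F (hi j) - F (lo j) = flow_fac (step_of j)"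
  proof -
    have "merge_step (step_of j)" using jB q merge_step_iff_branch by auto
    then show ?thesis using q by (simp add: flow_fac_def F_def N_def diff_divide_distrib mult.assoc)
  qed
  finally show ?thesis using True by simp
qed

lemma flow_fac_pos: "j \<in> branch_set \<Longrightarrow> 0 < flow_fac (step_of j)"
proof -
  assume j: "j \<in> branch_set"
  note q = step_of_props[OF j]
  have d: "0 < c (step_of j) - c (Suc (step_of j))" using q j by (simp add: branch_set_def)
  have N: "1 < real (num_blocks (step_of j))" using num_blocks_ge_2[OF j] by simp
  have "0 < 2 * (real (num_blocks (step_of j)) - 1) / (real n * (real n - 1))" using N n2 by simp
  then have "pair_rate (real (num_blocks (step_of j)) - 1) < pair_rate (num_blocks (step_of j))"
    using pair_rate_diff[of "real (num_blocks (step_of j))"] by linarith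
  then have "\<mu> * pair_rate (real (num_blocks (step_of j)) - 1) * (c (step_of j) - c (Suc (step_of j))) < \<mu> * pair_rate (num_blocks (step_of j)) * (c (step_of j) - c (Suc (step_of j)))"
    using mu d by simp
  then have "exp (- (\<mu> * pair_rate (num_blocks (step_of j)) * (c (step_of j) - c (Suc (step_of j))))) < exp (- (\<mu> * pair_rate (real (num_blocks (step_of j)) - 1) * (c (step_of j) - c (Suc (step_of j)))))"
    by simp
  moreover have "merge_step (step_of j)" using j q merge_step_iff_branch by auto
  ultimately show ?thesis using N by (simp add: flow_fac_def)
qed

lemma prod_split: "(\<Prod>q<m. flow_fac q * samp_fac q) = const_fac * (\<Prod>j\<in>branch_set. flow_fac (step_of j))"
proof -
  have "(\<Prod>q<m. flow_fac q) = (\<Prod>q\<in>{q. q < m \<and> \<not> merge_step q} \<union> {q. q < m \<and> merge_step q}. flow_fac q)"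
    by (rule prod.cong) auto
  also have "\<dots> = (\<Prod>q\<in>{q. q < m \<and> \<not> merge_step q}. flow_fac q) * (\<Prod>q\<in>{q. q < m \<and> merge_step q}. flow_fac q)"
    by (rule prod.union_disjoint) auto
  also have "(\<Prod>q\<in>{q. q < m \<and> merge_step q}. flow_fac q) = (\<Prod>j\<in>branch_set. flow_fac (step_of j))"
    by (rule prod.reindex_bij_betw[OF bij_step_of, symmetric])
  finally show ?thesis by (simp add: prod.distrib const_fac_def)
qed

lemma const_fac_nonneg: "0 \<le> const_fac"
proof -
  have "0 \<le> const_fac * (\<Prod>j\<in>branch_set. flow_fac (step_of j))"
    unfolding prod_split[symmetric] prob_runs[symmetric] by simp
  moreover have "0 < (\<Prod>j\<in>branch_set. flow_fac (step_of j))" using flow_fac_pos by (intro prod_pos) auto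
  ultimately show ?thesis by (simp add: zero_le_mult_iff)
qed

theorem box_integral:
  "(\<integral>\<^sup>+a. ennreal (smg_density n \<mu> t k a) * indicator {a. in_box a} a \<partial>attach_ref t k)
    = ennreal (smg.prob {\<omega>. runs \<omega>})"
proof -
  interpret R: product_sigma_finite "\<lambda>_::nat. ref_meas t"
    by (rule product_sigma_finite.intro) (rule sigma_finite_ref_meas)
  have hhm: "(\<lambda>y. ennreal (coord_density j y) * indicator (cell_set lo hi j) y) \<in> borel_measurable borel" for j
    unfolding coord_density_def cell_set_def by measurable
  have hpos: "0 \<le> coord_density j y" for j y using mu by (auto simp: coord_density_def)
  have "(\<integral>\<^sup>+a. ennreal (smg_density n \<mu> t k a) * indicator {a. in_box a} a \<partial>attach_ref t k)
    = (\<integral>\<^sup>+a. ennreal const_fac * (\<Prod>j\<in>{2..k}. ennreal (coord_density j (a j)) * indicator (cell_set lo hi j) (a j)) \<partial>attach_ref t k)"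
  proof (rule nn_integral_cong)
    fix a
    show "ennreal (smg_density n \<mu> t k a) * indicator {a. in_box a} a
      = ennreal const_fac * (\<Prod>j\<in>{2..k}. ennreal (coord_density j (a j)) * indicator (cell_set lo hi j) (a j))"
    proof (cases "in_box a")
      case True
      then have "(\<Prod>j\<in>{2..k}. ennreal (coord_density j (a j)) * indicator (cell_set lo hi j) (a j)) = (\<Prod>j\<in>{2..k}. ennreal (coord_density j (a j)))"
        by (intro prod.cong) (auto simp: in_box_def)
      then show ?thesis using True const_fac_nonneg hpos
        by (simp add: density_eq prod_ennreal ennreal_mult' prod_nonneg)
    next
      case False
      then obtain j where "j \<in> {2..k}" "a j \<notin> cell_set lo hi j" by (auto simp: in_box_def)
      then have "(\<Prod>j\<in>{2..k}. ennreal (coord_density j (a j)) * indicator (cell_set lo hi j) (a j)) = 0"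
        by (intro prod_zero bexI[of _ j]) auto
      then show ?thesis using False by simp
    qed
  qed
  also have "\<dots> = ennreal const_fac * (\<integral>\<^sup>+a. (\<Prod>j\<in>{2..k}. ennreal (coord_density j (a j)) * indicator (cell_set lo hi j) (a j)) \<partial>attach_ref t k)"
  proof (rule nn_integral_cmult)
    have "(\<lambda>a. ennreal (coord_density j (a j)) * indicator (cell_set lo hi j) (a j)) \<in> borel_measurable (attach_ref t k)" if "j \<in> {2..k}" for j
    proof -
      have "(\<lambda>a. a j) \<in> measurable (attach_ref t k) borel"
        unfolding attach_ref_def using measurable_component_singleton[OF that, of "\<lambda>_. ref_meas t"]
        by (simp cong: measurable_cong_sets)
      from measurable_compose[OF this hhm[of j]] show ?thesis .
    qed
    then show "(\<lambda>a. \<Prod>j\<in>{2..k}. ennreal (coord_density j (a j)) * indicator (cell_set lo hi j) (a j)) \<in> borel_measurable (attach_ref t k)"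
      by (rule borel_measurable_prod_ennreal)
  qed
  also have "(\<integral>\<^sup>+a. (\<Prod>j\<in>{2..k}. ennreal (coord_density j (a j)) * indicator (cell_set lo hi j) (a j)) \<partial>attach_ref t k)
      = (\<Prod>j\<in>{2..k}. \<integral>\<^sup>+y. ennreal (coord_density j y) * indicator (cell_set lo hi j) y \<partial>ref_meas t)"
    unfolding attach_ref_def using hhm by (intro R.product_nn_integral_prod) auto
  also have "\<dots> = (\<Prod>j\<in>{2..k}. ennreal (if lo j < hi j then flow_fac (step_of j) else 1))"
    by (rule prod.cong) (auto simp: coord_density_integral)
  also have "\<dots> = ennreal (\<Prod>j\<in>{2..k}. if lo j < hi j then flow_fac (step_of j) else 1)"
  proof (rule prod_ennreal)
    fix j assume "j \<in> {2..k}"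
    then show "0 \<le> (if lo j < hi j then flow_fac (step_of j) else 1)" using flow_fac_pos[of j] by (auto simp: branch_set_def)
  qed
  also have "(\<Prod>j\<in>{2..k}. if lo j < hi j then flow_fac (step_of j) else 1) = (\<Prod>j\<in>branch_set. flow_fac (step_of j))"
    by (subst prod.inter_filter[symmetric]) (auto simp: branch_set_def)
  also have "ennreal const_fac * ennreal (\<Prod>j\<in>branch_set. flow_fac (step_of j)) = ennreal (const_fac * (\<Prod>j\<in>branch_set. flow_fac (step_of j)))"
    using const_fac_nonneg by (simp add: ennreal_mult')
  finally show ?thesis by (simp only: prob_runs prod_split)
qed

end

section \<open>Measurability of the genealogy\<close>

context moran_samples begin

lemma X_measurable:
  assumes S[measurable]: "S \<in> borel_measurable (smg_space n \<mu>)"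
  shows "(\<lambda>\<omega>. X \<omega> i (S \<omega>)) \<in> measurable (smg_space n \<mu>) (count_space UNIV)"
proof (subst measurable_count_space_eq_countable, safe)
  fix v
  have "X \<omega> i (S \<omega>) = v \<longleftrightarrow> (\<exists>w u. ev_word \<omega> (S \<omega>) (t i) = w \<and> snd \<omega> i = u \<and> act w u = v)" for \<omega>
    by (simp add: X_eq)
  then have "(\<lambda>\<omega>. X \<omega> i (S \<omega>)) -` {v} \<inter> space (smg_space n \<mu>)
    = {\<omega>\<in>space (smg_space n \<mu>). \<exists>w u. ev_word \<omega> (S \<omega>) (t i) = w \<and> snd \<omega> i = u \<and> act w u = v}"
    by blast
  also have "\<dots> \<in> smg.events" by measurable
  finally show "(\<lambda>\<omega>. X \<omega> i (S \<omega>)) -` {v} \<inter> space (smg_space n \<mu>) \<in> smg.events" .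
qed auto

lemma X_eq_measurable:
  assumes [measurable]: "S \<in> borel_measurable (smg_space n \<mu>)"
  shows "Measurable.pred (smg_space n \<mu>) (\<lambda>\<omega>. X \<omega> j (S \<omega>) = X \<omega> i (S \<omega>))"
proof -
  note [measurable] = X_measurable[OF assms]
  have "Measurable.pred (smg_space n \<mu>) (\<lambda>\<omega>. \<exists>v. X \<omega> i (S \<omega>) = v \<and> X \<omega> j (S \<omega>) = v)" by measurable
  then show ?thesis by simp
qed

abbreviation evs :: "smg_omega \<Rightarrow> nat \<Rightarrow> real \<Rightarrow> int set" where
  "evs \<omega> l s \<equiv> {m. s < ev_time \<omega> m \<and> ev_time \<omega> m \<le> t l}"

text \<open>The event times of an exceptional sample point may accumulate; \<open>explosion\<close> is the largest time with
  infinitely many events between it and \<open>t l\<close>, where the ancestral line need not be right-continuous.\<close>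

definition explosion :: "nat \<Rightarrow> smg_omega \<Rightarrow> real" where
  "explosion l \<omega> = real_of_ereal (INF r\<in>\<rat>. if finite (evs \<omega> l r) then ereal r else \<infinity>)"

lemma explosion_measurable[measurable]: "explosion l \<in> borel_measurable (smg_space n \<mu>)"
proof -
  have [measurable]: "(\<lambda>\<omega>. if finite (evs \<omega> l r) then ereal r else \<infinity>) \<in> borel_measurable (smg_space n \<mu>)" for r
    by measurable
  have "(\<lambda>\<omega>. INF r\<in>(\<rat>::real set). if finite (evs \<omega> l r) then ereal r else \<infinity>) \<in> borel_measurable (smg_space n \<mu>)"
    by (rule borel_measurable_INF) (auto simp: countable_rat)
  then show ?thesis unfolding explosion_def[abs_def] by measurable
qed

lemma X_right_const:
  "explosion l \<omega> = s \<or> (\<exists>e>s. \<forall>r. s \<le> r \<and> r < e \<longrightarrow> X \<omega> l r = X \<omega> l s)"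
proof (cases "finite (evs \<omega> l s)")
  case True
  define e where "e = Min (insert (s + 1) (ev_time \<omega> ` evs \<omega> l s))"
  have fin: "finite (insert (s + 1) (ev_time \<omega> ` evs \<omega> l s))" using True by simp
  have e: "s < e" unfolding e_def using fin by (subst Min_gr_iff) auto
  have "X \<omega> l r = X \<omega> l s" if r: "s \<le> r" "r < e" for r
  proof -
    have "evs \<omega> l r = evs \<omega> l s"
    proof
      show "evs \<omega> l s \<subseteq> evs \<omega> l r"
      proof
        fix m assume m: "m \<in> evs \<omega> l s"
        then have "e \<le> ev_time \<omega> m" unfolding e_def using fin by (intro Min_le) auto
        then show "m \<in> evs \<omega> l r" using m r by auto
      qed
    qed (use r in auto)
    then show ?thesis by (simp add: X_eq ev_word_def)
  qed
  then show ?thesis using e by blast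
next
  case inf: False
  have Xl: "X \<omega> l r = snd \<omega> l" if "infinite (evs \<omega> l r)" for r
    using that by (simp add: X_eq ev_word_def sorted_list_of_set.fold_insort_key.infinite)
  show ?thesis
  proof (cases "\<exists>s1>s. infinite (evs \<omega> l s1)")
    case True
    then obtain s1 where s1: "s1 > s" "infinite (evs \<omega> l s1)" by blast
    have "X \<omega> l r = X \<omega> l s" if "s \<le> r" "r < s1" for r
    proof -
      have "evs \<omega> l s1 \<subseteq> evs \<omega> l r" using that by auto
      then have "infinite (evs \<omega> l r)" using s1(2) finite_subset by blast
      then show ?thesis using Xl inf by simp
    qed
    then show ?thesis using s1 by blast
  next
    case False
    have "(INF r\<in>\<rat>. if finite (evs \<omega> l r) then ereal r else \<infinity>) = ereal s"
    proof (rule antisym)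
      show "(INF r\<in>\<rat>. if finite (evs \<omega> l r) then ereal r else \<infinity>) \<le> ereal s"
      proof (rule dense_ge)
        fix z assume z: "ereal s < z"
        show "(INF r\<in>\<rat>. if finite (evs \<omega> l r) then ereal r else \<infinity>) \<le> z"
        proof (cases z)
          case (real y)
          then obtain r where r: "r \<in> \<rat>" "s < r" "r < y" using Rats_dense_in_real[of s y] z by auto
          have "(INF r\<in>\<rat>. if finite (evs \<omega> l r) then ereal r else \<infinity>) \<le> (if finite (evs \<omega> l r) then ereal r else \<infinity>)"
            using r(1) by (rule INF_lower)
          also have "\<dots> = ereal r" using False r(2) by auto
          also have "\<dots> \<le> z" using real r by simp
          finally show ?thesis .
        qed (use z in auto)
      qed
      show "ereal s \<le> (INF r\<in>\<rat>. if finite (evs \<omega> l r) then ereal r else \<infinity>)"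
      proof (rule INF_greatest)
        fix r :: real
        show "ereal s \<le> (if finite (evs \<omega> l r) then ereal r else \<infinity>)"
        proof (cases "finite (evs \<omega> l r)")
          case True
          have "s \<le> r"
          proof (rule ccontr)
            assume "\<not> s \<le> r"
            then have "evs \<omega> l s \<subseteq> evs \<omega> l r" by auto
            then show False using inf True finite_subset by blast
          qed
          then show ?thesis using True by simp
        qed simp
      qed
    qed
    then show ?thesis by (simp add: explosion_def)
  qed
qed

lemma merge_time_exists_iff:
  "(\<exists>s>x. s \<le> t i \<and> X \<omega> j s = X \<omega> i s) \<longleftrightarrow>
    (\<exists>s\<in>\<rat>. x < s \<and> s \<le> t i \<and> X \<omega> j s = X \<omega> i s) \<or> (x < t i \<and> X \<omega> j (t i) = X \<omega> i (t i))
    \<or> (x < explosion i \<omega> \<and> explosion i \<omega> \<le> t i \<and> X \<omega> j (explosion i \<omega>) = X \<omega> i (explosion i \<omega>))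
    \<or> (x < explosion j \<omega> \<and> explosion j \<omega> \<le> t i \<and> X \<omega> j (explosion j \<omega>) = X \<omega> i (explosion j \<omega>))"
    (is "?L \<longleftrightarrow> ?R1 \<or> ?R2 \<or> ?R3 \<or> ?R4")
proof
  assume ?L
  then obtain s where s: "x < s" "s \<le> t i" "X \<omega> j s = X \<omega> i s" by blast
  consider "s = t i" | "s = explosion i \<omega>" | "s = explosion j \<omega>"
    | "s < t i" "explosion i \<omega> \<noteq> s" "explosion j \<omega> \<noteq> s" using s(2) by fastforce
  then show "?R1 \<or> ?R2 \<or> ?R3 \<or> ?R4"
  proof cases
    case 4
    obtain e where e: "s < e" "\<And>r. s \<le> r \<and> r < e \<Longrightarrow> X \<omega> i r = X \<omega> i s" using X_right_const[of i \<omega> s] 4(2) by blast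
    obtain e' where e': "s < e'" "\<And>r. s \<le> r \<and> r < e' \<Longrightarrow> X \<omega> j r = X \<omega> j s" using X_right_const[of j \<omega> s] 4(3) by blast
    obtain r where r: "r \<in> \<rat>" "s < r" "r < min (min e e') (t i)"
      using Rats_dense_in_real[of s "min (min e e') (t i)"] e e' 4(1) by auto
    have "X \<omega> j r = X \<omega> i r" using e(2)[of r] e'(2)[of r] r s(3) by simp
    then have ?R1 using r s by (intro bexI[of _ r]) auto
    then show ?thesis by blast
  qed (use s in auto)
next
  assume "?R1 \<or> ?R2 \<or> ?R3 \<or> ?R4"
  then show ?L by blast
qed

lemma merge_time_measurable[measurable]: "(\<lambda>\<omega>. merge_time t \<omega> i j) \<in> borel_measurable (smg_space n \<mu>)"
proof (subst borel_measurable_iff_greater, rule allI)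
  fix x :: real
  let ?Q = "\<lambda>x \<omega>. \<exists>s>x. s \<le> t i \<and> X \<omega> j s = X \<omega> i s"
  have [measurable]: "Measurable.pred (smg_space n \<mu>) (\<lambda>\<omega>. X \<omega> j s = X \<omega> i s)" for s
    by (rule X_eq_measurable[of "\<lambda>_. s"]) simp
  have [measurable]: "Measurable.pred (smg_space n \<mu>) (\<lambda>\<omega>. X \<omega> j (explosion l \<omega>) = X \<omega> i (explosion l \<omega>))" for l
    by (rule X_eq_measurable) measurable
  have Q[measurable]: "Measurable.pred (smg_space n \<mu>) (?Q x)" for x
  proof -
    have 1: "Measurable.pred (smg_space n \<mu>) (\<lambda>\<omega>. \<exists>s\<in>\<rat>. x < s \<and> s \<le> t i \<and> X \<omega> j s = X \<omega> i s)"
    proof -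
      have "(\<Union>s\<in>\<rat>. {\<omega>\<in>space (smg_space n \<mu>). x < s \<and> s \<le> t i \<and> X \<omega> j s = X \<omega> i s}) \<in> smg.events"
      proof (rule sets.countable_UN'[OF countable_rat], rule image_subsetI)
        fix s
        show "{\<omega>\<in>space (smg_space n \<mu>). x < s \<and> s \<le> t i \<and> X \<omega> j s = X \<omega> i s} \<in> smg.events" by measurable
      qed
      also have "(\<Union>s\<in>\<rat>. {\<omega>\<in>space (smg_space n \<mu>). x < s \<and> s \<le> t i \<and> X \<omega> j s = X \<omega> i s})
        = {\<omega>\<in>space (smg_space n \<mu>). \<exists>s\<in>\<rat>. x < s \<and> s \<le> t i \<and> X \<omega> j s = X \<omega> i s}" by blast
      finally show ?thesis unfolding pred_def .
    qed
    show ?thesis unfolding merge_time_exists_iff using 1 by measurable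
  qed
  have eq: "x < merge_time t \<omega> i j \<longleftrightarrow>
      ((\<exists>N::nat. ?Q (- real N) \<omega>) \<and> ?Q x \<omega>) \<or> (\<not> (\<exists>N::nat. ?Q (- real N) \<omega>) \<and> x < Sup ({} :: real set))" for \<omega>
  proof (cases "{s. s \<le> t i \<and> X \<omega> j s = X \<omega> i s} = {}")
    case True
    then have "\<not> ?Q y \<omega>" for y by blast
    then show ?thesis unfolding merge_time_def True by blast
  next
    case False
    then obtain s where s: "s \<le> t i" "X \<omega> j s = X \<omega> i s" by blast
    obtain N :: nat where "- s < real N" using reals_Archimedean2 by blast
    then have "?Q (- real N) \<omega>" using s by (intro exI[of _ s]) auto
    moreover have "bdd_above {s. s \<le> t i \<and> X \<omega> j s = X \<omega> i s}" by (rule bdd_aboveI[of _ "t i"]) auto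
    then have "x < merge_time t \<omega> i j \<longleftrightarrow> ?Q x \<omega>"
      unfolding merge_time_def less_cSup_iff[OF False \<open>bdd_above _\<close>] by blast
    ultimately show ?thesis by blast
  qed
  show "{\<omega> \<in> space (smg_space n \<mu>). x < merge_time t \<omega> i j} \<in> smg.events"
    unfolding eq by measurable
qed

lemma genealogy_measurable: "genealogy t k \<in> measurable (smg_space n \<mu>) gen_space"
  unfolding gen_space_def
proof (rule measurable_PiM_single')
  fix p :: "nat \<times> nat"
  show "(\<lambda>\<omega>. genealogy t k \<omega> p) \<in> borel_measurable (smg_space n \<mu>)"
    by (cases p) (auto simp: genealogy_def trunc_def)
qed auto

end

section \<open>From cells to measurable sets\<close>

definition separated :: "(nat \<Rightarrow> real) \<Rightarrow> nat \<Rightarrow> (nat \<Rightarrow> real) \<Rightarrow> (nat \<Rightarrow> real) \<Rightarrow> bool" where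
  "separated t k lo hi \<longleftrightarrow>
     (\<forall>j\<in>{2..k}. lo j \<le> hi j \<and> (lo j = hi j \<longrightarrow> lo j \<in> t ` {1..k})
        \<and> (lo j < hi j \<longrightarrow> (\<forall>x. lo j \<le> x \<and> x \<le> hi j \<longrightarrow> x \<notin> insert 0 (t ` {1..k})))) \<and>
     (\<forall>j\<in>{2..k}. \<forall>j'\<in>{2..k}. j \<noteq> j' \<longrightarrow> (\<forall>x. \<not> (lo j \<le> x \<and> x \<le> hi j \<and> lo j' \<le> x \<and> x \<le> hi j')))"

abbreviation attach_space :: "nat \<Rightarrow> (nat \<Rightarrow> real) measure" where
  "attach_space k \<equiv> \<Pi>\<^sub>M j\<in>{2..k}. (borel :: real measure)"

definition attach_box :: "nat \<Rightarrow> (nat \<Rightarrow> real) \<Rightarrow> (nat \<Rightarrow> real) \<Rightarrow> (nat \<Rightarrow> real) set" where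
  "attach_box k lo hi = (\<Pi>\<^sub>E j\<in>{2..k}. cell_set lo hi j)"

definition shapes :: "nat \<Rightarrow> (nat \<times> nat \<Rightarrow> nat) set" where
  "shapes k = PiE (pairs_upto k) (\<lambda>_. {2..k})"

lemma space_attach_space: "space (attach_space k) = extensional {2..k}"
  by (simp add: space_PiM PiE_UNIV_domain PiE_def)

lemma sets_attach_ref[measurable_cong]: "sets (attach_ref t k) = sets (attach_space k)"
  unfolding attach_ref_def by (intro sets_PiM_cong) auto

lemma space_attach_ref: "space (attach_ref t k) = extensional {2..k}"
  using sets_eq_imp_space_eq[OF sets_attach_ref, of t k] space_attach_space by simp

lemma coordinate_measurable: "(\<lambda>a. a x) \<in> borel_measurable (attach_space k)"
proof (cases "x \<in> {2..k}")
  case False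
  have "(\<lambda>a. a x) \<in> borel_measurable (attach_space k) \<longleftrightarrow> (\<lambda>a. undefined :: real) \<in> borel_measurable (attach_space k)"
    using False by (intro measurable_cong) (auto simp: space_attach_space extensional_def)
  then show ?thesis by simp
qed measurable

lemma pred_compare:
  fixes f g :: "'b \<Rightarrow> real"
  assumes "f \<in> borel_measurable M" "g \<in> borel_measurable M"
  shows "Measurable.pred M (\<lambda>x. f x \<le> g x)" "Measurable.pred M (\<lambda>x. f x < g x)" "Measurable.pred M (\<lambda>x. f x = g x)"
  using assms by simp_all

lemma shape_ok_measurable[measurable]: "Measurable.pred (attach_space k) (shape_ok t k f)"
  unfolding shape_ok_def[abs_def] case_prod_beta
  by (intro pred_intros_logic(3,4) pred_intros_countable_bounded(3) pred_compare borel_measurable_min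
      coordinate_measurable borel_measurable_const; simp)

lemma gen_of_measurable[measurable]: "gen_of k f \<in> measurable (attach_space k) gen_space"
  unfolding gen_space_def
proof (rule measurable_PiM_single')
  show "(\<lambda>a. gen_of k f a p) \<in> borel_measurable (attach_space k)" for p
    unfolding gen_of_def using coordinate_measurable[of "f p" k] by simp
qed auto

lemma cell_set_borel[measurable]: "cell_set lo hi j \<in> sets borel"
  by (simp add: cell_set_def)

lemma attach_box_sets[measurable]: "attach_box k lo hi \<in> sets (attach_space k)"
  unfolding attach_box_def by (intro sets_PiM_I_finite) auto

lemma finite_pairs_upto: "finite (pairs_upto k)"
  by (rule finite_subset[of _ "{..k} \<times> {..k}"]) (auto simp: pairs_upto_def)

lemma finite_shapes: "finite (shapes k)"
  unfolding shapes_def by (intro finite_PiE finite_pairs_upto) auto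

lemma dead_measurable[measurable]: "Measurable.pred (attach_space k) (\<lambda>a. dead t k a i)"
proof -
  have "dead t k a i \<longleftrightarrow> (\<exists>j\<in>{i<..k}. a j = t i)" for a by (auto simp: dead_def)
  then show ?thesis
    by simp (intro pred_intros_countable_bounded(4) pred_compare coordinate_measurable borel_measurable_const)
qed

lemma lineages_sum:
  "real_of_int (lineages t k a x) = (\<Sum>i\<in>{1..k}. if \<not> dead t k a i \<and> x < t i then 1 else 0)
    - (\<Sum>j\<in>{2..k}. if \<not> is_sample_time t (a j) \<and> x < a j then 1 else 0)"
proof -
  have "{i\<in>live_idx t k a. t i > x} = {1..k} \<inter> {i. \<not> dead t k a i \<and> x < t i}"
    "{j\<in>branch_idx t k a. a j > x} = {2..k} \<inter> {j. \<not> is_sample_time t (a j) \<and> x < a j}"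
    by (auto simp: live_idx_def branch_idx_def)
  then show ?thesis by (simp add: lineages_def sum.If_cases)
qed

lemma sample_time_measurable[measurable]: "Measurable.pred (attach_space k) (\<lambda>a. is_sample_time t (a j))"
proof -
  have "is_sample_time t (a j) \<longleftrightarrow> (\<exists>i\<in>{1..}. t i = a j)" for a by (auto simp: is_sample_time_def)
  then show ?thesis
    by simp (intro pred_intros_countable_bounded(4) pred_compare coordinate_measurable borel_measurable_const)
qed

lemma smg_density_measurable[measurable]: "smg_density n \<mu> t k \<in> borel_measurable (attach_space k)"
proof -
  have L[measurable]: "(\<lambda>p. real_of_int (lineages t k (fst p) (snd p))) \<in> borel_measurable (attach_space k \<Otimes>\<^sub>M lborel)"
    unfolding lineages_sum by measurable
  have Lt[measurable]: "(\<lambda>a. real_of_int (lineages t k a x)) \<in> borel_measurable (attach_space k)" for x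
    unfolding lineages_sum by measurable
  have int[measurable]: "(\<lambda>a. \<integral>x. \<mu> * ((real_of_int (lineages t k a x) * (real_of_int (lineages t k a x) - 1) / 2) / real (n choose 2)) \<partial>lborel)
      \<in> borel_measurable (attach_space k)"
  proof (rule lborel.borel_measurable_lebesgue_integral)
    show "(\<lambda>(a, x). \<mu> * ((real_of_int (lineages t k a x) * (real_of_int (lineages t k a x) - 1) / 2) / real (n choose 2)))
        \<in> borel_measurable (attach_space k \<Otimes>\<^sub>M lborel)"
      unfolding case_prod_beta by measurable
  qed
  have card: "card (live_idx t k a) = (\<Sum>i\<in>{1..k}. if \<not> dead t k a i then 1 else 0)" for a
  proof -
    have "live_idx t k a = {1..k} \<inter> {i. \<not> dead t k a i}" by (auto simp: live_idx_def)
    then show ?thesis by (simp add: sum.If_cases)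
  qed
  have cm: "(\<lambda>a. card (live_idx t k a)) \<in> measurable (attach_space k) (count_space UNIV)"
    unfolding card by measurable
  have pm[measurable]: "(\<lambda>a. real n powi (int (card (live_idx t k a)) - int k) * (\<mu> / real (n choose 2)) ^ (card (live_idx t k a) - 1))
      \<in> borel_measurable (attach_space k)"
    by (rule measurable_compose[OF cm]) simp
  have prod: "(\<Prod>i\<in>live_idx t k a. 1 - real_of_int (lineages t k a (t i)) / real n)
      = (\<Prod>i\<in>{1..k}. if \<not> dead t k a i then 1 - real_of_int (lineages t k a (t i)) / real n else 1)" for a
  proof -
    have "live_idx t k a = {1..k} \<inter> {i. \<not> dead t k a i}" by (auto simp: live_idx_def)
    then show ?thesis by (simp add: prod.If_cases)
  qed
  have "(\<lambda>a. (real n powi (int (card (live_idx t k a)) - int k) * (\<mu> / real (n choose 2)) ^ (card (live_idx t k a) - 1))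
      * exp (- (\<integral>x. \<mu> * ((real_of_int (lineages t k a x) * (real_of_int (lineages t k a x) - 1) / 2) / real (n choose 2)) \<partial>lborel))
      * (\<Prod>i\<in>live_idx t k a. 1 - real_of_int (lineages t k a (t i)) / real n)) \<in> borel_measurable (attach_space k)"
    unfolding prod by measurable
  then show ?thesis by (simp add: smg_density_def[abs_def] Let_def)
qed

lemma emeasure_eq_countable_cover:
  assumes sets: "sets N = sets M"
    and B: "countable B" "B \<subseteq> sets M"
    and eq: "\<And>b S. b \<in> B \<Longrightarrow> S \<in> sets M \<Longrightarrow> S \<subseteq> b \<Longrightarrow> emeasure M S = emeasure N S"
    and S: "S \<in> sets M" "S \<subseteq> \<Union>B"
  shows "emeasure M S = emeasure N S"
proof (cases "B = {}")
  case True
  then show ?thesis using S by simp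
next
  case False
  define b where "b = from_nat_into B"
  have b: "b i \<in> B" for i using False by (simp add: b_def from_nat_into)
  have rb: "range b = B" using B(1) False by (simp add: b_def)
  have meas: "b i \<in> sets M" for i using b B(2) by blast
  define d where "d i = S \<inter> disjointed b i" for i
  have dm: "d i \<in> sets M" for i
    using S(1) sets.range_disjointed_sets[of b M] meas by (auto simp: d_def)
  have dead_set: "disjoint_family d"
    using disjoint_family_disjointed[of b] by (auto simp: disjoint_family_on_def d_def)
  have un: "(\<Union>i. d i) = S"
    using S(2) UN_disjointed_eq[of b] rb by (auto simp: d_def)
  have "emeasure M S = (\<Sum>i. emeasure M (d i))"
    using suminf_emeasure[of d M] dm dead_set unfolding un[symmetric] by (simp add: image_subset_iff)
  also have "\<dots> = (\<Sum>i. emeasure N (d i))"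
    using eq[OF b dm] disjointed_subset[of b] by (auto simp: d_def intro!: suminf_cong)
  also have "\<dots> = emeasure N S"
    using suminf_emeasure[of d N] dm dead_set sets unfolding un[symmetric] by (simp add: image_subset_iff)
  finally show ?thesis .
qed

lemma finite_separation:
  assumes "finite (A :: real set)"
  shows "\<exists>e>0. \<forall>u\<in>A. \<forall>v\<in>A. u \<noteq> v \<longrightarrow> e \<le> \<bar>u - v\<bar>"
proof -
  define E where "E = insert 1 ((\<lambda>(u, v). \<bar>u - v\<bar>) ` {(u, v). u \<in> A \<and> v \<in> A \<and> u \<noteq> v})"
  have "finite {(u, v). u \<in> A \<and> v \<in> A \<and> u \<noteq> v}"
    by (rule finite_subset[of _ "A \<times> A"]) (use assms in auto)
  then have fin: "finite E" by (simp add: E_def)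
  have "0 < Min E" using fin by (subst Min_gr_iff) (auto simp: E_def)
  moreover have "Min E \<le> \<bar>u - v\<bar>" if "u \<in> A" "v \<in> A" "u \<noteq> v" for u v
    using fin that by (intro Min_le) (auto simp: E_def intro!: image_eqI[of _ _ "(u, v)"])
  ultimately show ?thesis by blast
qed

context moran_samples begin

definition avec :: "nat \<Rightarrow> smg_omega \<Rightarrow> nat \<Rightarrow> real" where
  "avec k \<omega> = attach_vec k (genealogy t k \<omega>)"

definition gen_cond :: "nat \<Rightarrow> (nat \<times> nat \<Rightarrow> nat) \<Rightarrow> smg_omega \<Rightarrow> bool" where
  "gen_cond k f \<omega> \<longleftrightarrow> genealogy t k \<omega> = gen_of k f (avec k \<omega>) \<and> shape_ok t k f (avec k \<omega>)"

lemma genealogy_coord_measurable[measurable]: "(\<lambda>\<omega>. genealogy t k \<omega> p) \<in> borel_measurable (smg_space n \<mu>)"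
  using measurable_compose[OF genealogy_measurable[unfolded gen_space_def] measurable_component_singleton[of p UNIV]] by simp

lemma avec_measurable[measurable]: "avec k \<in> measurable (smg_space n \<mu>) (attach_space k)"
proof (rule measurable_PiM_single')
  fix j assume j: "j \<in> {2..k}"
  have "g_attach g j = Max ((\<lambda>i. g (i, j)) ` {1..<j})" for g
    unfolding g_attach_def by (rule arg_cong[where f=Max]) auto
  then have "avec k \<omega> j = Max ((\<lambda>i. genealogy t k \<omega> (i, j)) ` {1..<j})" for \<omega>
    using j by (simp add: avec_def attach_vec_def)
  then show "(\<lambda>\<omega>. avec k \<omega> j) \<in> borel_measurable (smg_space n \<mu>)" by simp
qed (auto simp: avec_def attach_vec_def)

lemma avec_ext: "avec k \<omega> \<in> extensional {2..k}"
  by (simp add: avec_def attach_vec_def)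

lemma gen_cond_measurable[measurable]: "Measurable.pred (smg_space n \<mu>) (gen_cond k f)"
proof -
  have [measurable]: "(\<lambda>\<omega>. gen_of k f (avec k \<omega>) p) \<in> borel_measurable (smg_space n \<mu>)" for p
    using measurable_compose[OF measurable_compose[OF avec_measurable gen_of_measurable[unfolded gen_space_def]]
      measurable_component_singleton[of p UNIV]] by simp
  have "gen_cond k f = (\<lambda>\<omega>. (\<forall>p. genealogy t k \<omega> p = gen_of k f (avec k \<omega>) p) \<and> shape_ok t k f (avec k \<omega>))"
    by (auto simp: gen_cond_def fun_eq_iff)
  then show ?thesis by simp measurable
qed

definition shape_law :: "nat \<Rightarrow> (nat \<times> nat \<Rightarrow> nat) \<Rightarrow> (nat \<Rightarrow> real) measure" where
  "shape_law k f = distr (density (smg_space n \<mu>) (indicator {\<omega>. gen_cond k f \<omega>})) (attach_space k) (avec k)"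

definition shape_density :: "nat \<Rightarrow> (nat \<times> nat \<Rightarrow> nat) \<Rightarrow> (nat \<Rightarrow> real) measure" where
  "shape_density k f = density (attach_ref t k) (\<lambda>a. ennreal (smg_density n \<mu> t k a) * indicator {a. shape_ok t k f a} a)"

lemma sets_shape_law[simp]: "sets (shape_law k f) = sets (attach_space k)" "sets (shape_density k f) = sets (attach_space k)"
  by (simp_all add: shape_law_def shape_density_def sets_attach_ref)

lemma gen_cond_sets[measurable]: "{\<omega>. gen_cond k f \<omega>} \<in> smg.events"
proof -
  have "{\<omega>\<in>space (smg_space n \<mu>). gen_cond k f \<omega>} \<in> smg.events" by measurable
  then show ?thesis by simp
qed

lemma emeasure_shape_law:
  assumes S[measurable]: "S \<in> sets (attach_space k)"
  shows "emeasure (shape_law k f) S = emeasure (smg_space n \<mu>) {\<omega>. gen_cond k f \<omega> \<and> avec k \<omega> \<in> S}"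
proof -
  have [measurable]: "avec k -` S \<in> smg.events" using measurable_sets[OF avec_measurable S] by simp
  have "emeasure (shape_law k f) S = emeasure (density (smg_space n \<mu>) (indicator {\<omega>. gen_cond k f \<omega>})) (avec k -` S)"
    unfolding shape_law_def by (subst emeasure_distr) auto
  also have "\<dots> = (\<integral>\<^sup>+\<omega>. indicator {\<omega>. gen_cond k f \<omega>} \<omega> * indicator (avec k -` S) \<omega> \<partial>smg_space n \<mu>)"
    by (subst emeasure_density) auto
  also have "\<dots> = (\<integral>\<^sup>+\<omega>. indicator ({\<omega>. gen_cond k f \<omega>} \<inter> avec k -` S) \<omega> \<partial>smg_space n \<mu>)"
    by (intro nn_integral_cong) (auto split: split_indicator)
  also have "\<dots> = emeasure (smg_space n \<mu>) ({\<omega>. gen_cond k f \<omega>} \<inter> avec k -` S)" by (rule nn_integral_indicator) auto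
  also have "{\<omega>. gen_cond k f \<omega>} \<inter> avec k -` S = {\<omega>. gen_cond k f \<omega> \<and> avec k \<omega> \<in> S}" by auto
  finally show ?thesis .
qed

lemma emeasure_shape_density:
  assumes S[measurable]: "S \<in> sets (attach_space k)"
  shows "emeasure (shape_density k f) S = (\<integral>\<^sup>+a. ennreal (smg_density n \<mu> t k a) * indicator {a. shape_ok t k f a} a * indicator S a \<partial>attach_ref t k)"
proof -
  have m: "{a\<in>space (attach_space k). shape_ok t k f a} \<in> sets (attach_space k)" by measurable
  have "(\<lambda>a. ennreal (smg_density n \<mu> t k a) * indicator {a\<in>space (attach_space k). shape_ok t k f a} a) \<in> borel_measurable (attach_space k)"
    using m by measurable
  also have "?this \<longleftrightarrow> (\<lambda>a. ennreal (smg_density n \<mu> t k a) * indicator {a. shape_ok t k f a} a) \<in> borel_measurable (attach_space k)"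
    by (intro measurable_cong) (auto split: split_indicator)
  finally have "(\<lambda>a. ennreal (smg_density n \<mu> t k a) * indicator {a. shape_ok t k f a} a) \<in> borel_measurable (attach_ref t k)"
    by (simp cong: measurable_cong_sets add: sets_attach_ref)
  then show ?thesis unfolding shape_density_def using S by (subst emeasure_density) (auto simp: sets_attach_ref)
qed

lemma shape_law_box:
  assumes k: "2 \<le> k" and sep: "separated t k lo hi"
  shows "emeasure (shape_law k f) (attach_box k lo hi) = emeasure (shape_density k f) (attach_box k lo hi)"
proof (cases "\<exists>a0. shape_ok t k f a0 \<and> (\<forall>j\<in>{2..k}. a0 j \<in> cell_set lo hi j)")
  case True
  then obtain a0 where a0: "shape_ok t k f a0" "\<forall>j\<in>{2..k}. a0 j \<in> cell_set lo hi j" by blast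
  interpret C: cell n \<mu> t k f lo hi a0
  proof unfold_locales
    show "lo j \<le> hi j" if "j \<in> {2..k}" for j using sep that by (simp add: separated_def)
    show "lo j \<in> t ` {1..k}" if "j \<in> {2..k}" "lo j = hi j" for j using sep that unfolding separated_def by blast
    show "x \<notin> insert 0 (t ` {1..k})" if "j \<in> {2..k}" "lo j < hi j" "lo j \<le> x" "x \<le> hi j" for j x
      using sep that unfolding separated_def by blast
    show False if "j \<in> {2..k}" "j' \<in> {2..k}" "j \<noteq> j'" "lo j \<le> x" "x \<le> hi j" "lo j' \<le> x" "x \<le> hi j'" for j j' x
      using sep that unfolding separated_def by blast
  qed (use k a0 in auto)
  have bx: "a \<in> attach_box k lo hi \<longleftrightarrow> C.in_box a" if "a \<in> extensional {2..k}" for a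
    using that by (auto simp: attach_box_def C.in_box_def PiE_def)
  have [measurable]: "{\<omega>. C.runs \<omega>} \<in> smg.events"
  proof -
    have "{\<omega>\<in>space (smg_space n \<mu>). C.runs \<omega>} \<in> smg.events" by measurable
    then show ?thesis by simp
  qed
  have "emeasure (shape_law k f) (attach_box k lo hi) = emeasure (smg_space n \<mu>) {\<omega>. gen_cond k f \<omega> \<and> avec k \<omega> \<in> attach_box k lo hi}"
    by (rule emeasure_shape_law) measurable
  also have "\<dots> = emeasure (smg_space n \<mu>) {\<omega>. C.runs \<omega>}"
  proof (rule emeasure_eq_AE)
    show "AE \<omega> in smg_space n \<mu>. \<omega> \<in> {\<omega>. gen_cond k f \<omega> \<and> avec k \<omega> \<in> attach_box k lo hi} \<longleftrightarrow> \<omega> \<in> {\<omega>. C.runs \<omega>}"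
      using AE_nice
    proof eventually_elim
      case (elim \<omega>)
      show ?case using C.genealogy_in_cell_iff[OF elim, folded avec_def] bx[OF avec_ext] C.box_shape[of "avec k \<omega>"]
        unfolding gen_cond_def by blast
    qed
    have "{\<omega>\<in>space (smg_space n \<mu>). gen_cond k f \<omega> \<and> avec k \<omega> \<in> attach_box k lo hi} \<in> smg.events" by measurable
    then show "{\<omega>. gen_cond k f \<omega> \<and> avec k \<omega> \<in> attach_box k lo hi} \<in> smg.events" by simp
  qed simp
  also have "\<dots> = (\<integral>\<^sup>+a. ennreal (smg_density n \<mu> t k a) * indicator {a. C.in_box a} a \<partial>attach_ref t k)"
    unfolding C.box_integral by (simp add: smg.emeasure_eq_measure)
  also have "\<dots> = (\<integral>\<^sup>+a. ennreal (smg_density n \<mu> t k a) * indicator {a. shape_ok t k f a} a * indicator (attach_box k lo hi) a \<partial>attach_ref t k)"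
    by (rule nn_integral_cong) (auto simp: space_attach_ref bx C.box_shape split: split_indicator)
  also have "\<dots> = emeasure (shape_density k f) (attach_box k lo hi)" by (rule emeasure_shape_density[symmetric]) measurable
  finally show ?thesis .
next
  case False
  have num_blocks: "\<not> (shape_ok t k f a \<and> a \<in> attach_box k lo hi)" for a
    using False unfolding attach_box_def by (metis PiE_mem)
  have e: "{\<omega>. gen_cond k f \<omega> \<and> avec k \<omega> \<in> attach_box k lo hi} = {}" using num_blocks unfolding gen_cond_def by blast
  have 1: "emeasure (shape_law k f) (attach_box k lo hi) = 0" unfolding emeasure_shape_law[OF attach_box_sets] e by simp
  have "ennreal (smg_density n \<mu> t k a) * indicator {a. shape_ok t k f a} a * indicator (attach_box k lo hi) a = 0" for a
    using num_blocks[of a] by (auto split: split_indicator)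
  then have 2: "emeasure (shape_density k f) (attach_box k lo hi) = 0"
    unfolding emeasure_shape_density[OF attach_box_sets] by (simp only: nn_integral_const) simp
  show ?thesis using 1 2 by simp
qed

lemma shape_law_box_atMost:
  assumes k: "2 \<le> k" and sep: "separated t k lo hi"
  shows "emeasure (shape_law k f) (attach_box k lo hi \<inter> (\<Pi>\<^sub>E j\<in>{2..k}. {..x j})) = emeasure (shape_density k f) (attach_box k lo hi \<inter> (\<Pi>\<^sub>E j\<in>{2..k}. {..x j}))"
proof (cases "\<forall>j\<in>{2..k}. if lo j < hi j then lo j < x j else hi j \<le> x j")
  case True
  define hi' where "hi' j = min (hi j) (x j)" for j
  have T: "lo j < hi j \<Longrightarrow> lo j < x j" "\<not> lo j < hi j \<Longrightarrow> hi j \<le> x j" if "j \<in> {2..k}" for j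
    using bspec[OF True that] by simp_all
  have le: "lo j \<le> hi j" if "j \<in> {2..k}" for j using sep that by (simp add: separated_def)
  have cs: "cell_set lo hi j \<inter> {..x j} = cell_set lo hi' j" if "j \<in> {2..k}" for j
    using T[OF that] le[OF that] by (auto simp: cell_set_def hi'_def)
  have "attach_box k lo hi \<inter> (\<Pi>\<^sub>E j\<in>{2..k}. {..x j}) = (\<Pi>\<^sub>E j\<in>{2..k}. cell_set lo hi j \<inter> {..x j})"
    unfolding attach_box_def by (rule PiE_Int)
  also have "\<dots> = attach_box k lo hi'" unfolding attach_box_def by (rule PiE_cong) (rule cs)
  finally have eq: "attach_box k lo hi \<inter> (\<Pi>\<^sub>E j\<in>{2..k}. {..x j}) = attach_box k lo hi'" .
  have lt: "lo j < hi' j \<longleftrightarrow> lo j < hi j" "hi' j \<le> hi j" "\<not> lo j < hi j \<Longrightarrow> hi' j = hi j" if "j \<in> {2..k}" for j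
    using T[OF that] le[OF that] by (auto simp: hi'_def)
  have "separated t k lo hi'"
    unfolding separated_def
  proof (intro conjI ballI impI allI)
    fix j assume j: "j \<in> {2..k}"
    show "lo j \<le> hi' j" using lt[OF j] le[OF j] by (cases "lo j < hi j") auto
    show "lo j \<in> t ` {1..k}" if "lo j = hi' j"
    proof -
      have "lo j = hi j" using that lt[OF j] le[OF j] by (cases "lo j < hi j") auto
      then show ?thesis using sep j unfolding separated_def by blast
    qed
    show "y \<notin> insert 0 (t ` {1..k})" if "lo j < hi' j" "lo j \<le> y \<and> y \<le> hi' j" for y
    proof -
      have "lo j < hi j" "lo j \<le> y \<and> y \<le> hi j" using that lt[OF j] by auto
      then show ?thesis using sep j unfolding separated_def by blast
    qed
  next
    fix j j' y assume j: "j \<in> {2..k}" "j' \<in> {2..k}" "j \<noteq> j'"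
    have "\<not> (lo j \<le> y \<and> y \<le> hi j \<and> lo j' \<le> y \<and> y \<le> hi j')" using sep j unfolding separated_def by blast
    then show "\<not> (lo j \<le> y \<and> y \<le> hi' j \<and> lo j' \<le> y \<and> y \<le> hi' j')"
      using lt(2)[OF j(1)] lt(2)[OF j(2)] by auto
  qed
  then show ?thesis unfolding eq by (rule shape_law_box[OF k])
next
  case False
  then obtain j where j: "j \<in> {2..k}" "\<not> (if lo j < hi j then lo j < x j else hi j \<le> x j)" by blast
  then have "cell_set lo hi j \<inter> {..x j} = {}" by (auto simp: cell_set_def split: if_splits)
  then have "attach_box k lo hi \<inter> (\<Pi>\<^sub>E j\<in>{2..k}. {..x j}) = {}" using j(1) by (auto simp: attach_box_def dest!: PiE_mem)
  then show ?thesis by simp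
qed

lemma shape_law_sub_box:
  assumes k: "2 \<le> k" and sep: "separated t k lo hi" and S: "S \<in> sets (attach_space k)" "S \<subseteq> attach_box k lo hi"
  shows "emeasure (shape_law k f) S = emeasure (shape_density k f) S"
proof -
  define E where "E = {PiE {2..k} F | F. \<forall>j\<in>{2..k}. F j \<in> range (\<lambda>x::real. {..x})}"
  let ?M = "density (shape_law k f) (indicator (attach_box k lo hi))" and ?N = "density (shape_density k f) (indicator (attach_box k lo hi))"
  let ?Om = "\<Pi>\<^sub>E j\<in>{2..k}. (UNIV :: real set)"
  have den: "emeasure (density (L k f) (indicator (attach_box k lo hi))) X = emeasure (L k f) (attach_box k lo hi \<inter> X)"
    if "X \<in> sets (attach_space k)" "sets (L k f) = sets (attach_space k)" for X L
    using that by (subst emeasure_density) (auto simp: nn_integral_indicator indicator_inter_arith[symmetric])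
  have EP: "E \<subseteq> Pow ?Om" by (auto simp: E_def)
  have gen: "sets (attach_space k) = sigma_sets ?Om E"
  proof -
    let ?P = "{{f\<in>?Om. \<forall>i\<in>j. f i \<in> A i} | A j. j \<in> {{2..k}} \<and> A \<in> Pi j (\<lambda>_. range (\<lambda>x::real. {..x}))}"
    have "attach_space k = PiM {2..k} (\<lambda>_. sigma UNIV (range (\<lambda>x::real. {..x})))"
      by (simp only: borel_eq_atMost)
    also have "sets \<dots> = sets (sigma ?Om ?P)"
    proof (rule sets_PiM_sigma)
      show "\<exists>S\<subseteq>range (\<lambda>x::real. {..x}). countable S \<and> UNIV = \<Union>S"
        using real_arch_simple by (intro exI[of _ "range (\<lambda>i::nat. {..real i})"]) auto
    qed auto
    also have "?P = E"
    proof
      show "?P \<subseteq> E"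
      proof
        fix X assume "X \<in> ?P"
        then obtain A where A: "X = {f\<in>?Om. \<forall>i\<in>{2..k}. f i \<in> A i}" "A \<in> Pi {2..k} (\<lambda>_. range (\<lambda>x::real. {..x}))" by blast
        have "X = PiE {2..k} A" unfolding A(1) by (auto simp: PiE_def)
        then show "X \<in> E" using A(2) unfolding E_def by blast
      qed
      show "E \<subseteq> ?P"
      proof
        fix X assume "X \<in> E"
        then obtain F where F: "X = PiE {2..k} F" "\<forall>j\<in>{2..k}. F j \<in> range (\<lambda>x::real. {..x})" unfolding E_def by blast
        have "X = {f\<in>?Om. \<forall>i\<in>{2..k}. f i \<in> F i}" unfolding F(1) by (auto simp: PiE_def)
        moreover have "F \<in> Pi {2..k} (\<lambda>_. range (\<lambda>x::real. {..x}))" using F(2) by blast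
        ultimately show "X \<in> ?P" by blast
      qed
    qed
    also have "sets (sigma ?Om E) = sigma_sets ?Om E" using EP by (rule sets_measure_of)
    finally show ?thesis .
  qed
  have "?M = ?N"
  proof (rule measure_eqI_generator_eq[where \<Omega>="?Om" and E=E and A="\<lambda>i. PiE {2..k} (\<lambda>_. {..real i})"])
    show "Int_stable E"
    proof (rule Int_stableI)
      fix X Y assume "X \<in> E" "Y \<in> E"
      then obtain F F' where F: "X = PiE {2..k} F" "\<forall>j\<in>{2..k}. F j \<in> range (\<lambda>x::real. {..x})"
        "Y = PiE {2..k} F'" "\<forall>j\<in>{2..k}. F' j \<in> range (\<lambda>x::real. {..x})" unfolding E_def by blast
      have "F j \<inter> F' j \<in> range (\<lambda>x::real. {..x})" if j: "j \<in> {2..k}" for j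
      proof -
        obtain u v where "F j = {..u}" "F' j = {..v}" using bspec[OF F(2) j] bspec[OF F(4) j] by blast
        then have "F j \<inter> F' j = {..min u v}" by auto
        then show ?thesis by blast
      qed
      then show "X \<inter> Y \<in> E" unfolding E_def F(1,3) PiE_Int by blast
    qed
    show "E \<subseteq> Pow ?Om" by (rule EP)
    show "sets ?M = sigma_sets ?Om E" "sets ?N = sigma_sets ?Om E"
      using gen by simp_all
    show "range (\<lambda>i. PiE {2..k} (\<lambda>_. {..real i})) \<subseteq> E" by (auto simp: E_def)
    show "(\<Union>i. PiE {2..k} (\<lambda>_. {..real i})) = ?Om"
    proof
      show "?Om \<subseteq> (\<Union>i. PiE {2..k} (\<lambda>_. {..real i}))"
      proof
        fix a assume a: "a \<in> ?Om"
        obtain N :: nat where N: "Max (insert 0 (a ` {2..k})) < real N" using reals_Archimedean2 by blast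
        have "a j \<le> real N" if "j \<in> {2..k}" for j
        proof -
          have "a j \<le> Max (insert 0 (a ` {2..k}))" using that by (intro Max_ge) auto
          then show ?thesis using N by linarith
        qed
        then show "a \<in> (\<Union>i. PiE {2..k} (\<lambda>_. {..real i}))" using a by (intro UN_I[of N]) (auto simp: PiE_def Pi_iff)
      qed
    qed (auto simp: PiE_def)
    fix X assume X: "X \<in> E"
    then obtain F where F: "X = PiE {2..k} F" "\<forall>j\<in>{2..k}. F j \<in> range (\<lambda>x::real. {..x})" unfolding E_def by blast
    then have "\<forall>j\<in>{2..k}. \<exists>x. F j = {..x}" by auto
    then obtain x where x: "\<And>j. j \<in> {2..k} \<Longrightarrow> F j = {..x j}" by metis
    have "X = (\<Pi>\<^sub>E j\<in>{2..k}. {..x j})" unfolding F(1) by (rule PiE_cong) (rule x)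
    moreover have "X \<in> sets (attach_space k)" unfolding gen using X by (rule sigma_sets.Basic)
    ultimately show "emeasure ?M X = emeasure ?N X"
      using shape_law_box_atMost[OF k sep, of f x] by (simp add: den)
  next
    fix i
    have "emeasure ?M (PiE {2..k} (\<lambda>_. {..real i})) = emeasure (shape_law k f) (attach_box k lo hi \<inter> PiE {2..k} (\<lambda>_. {..real i}))"
      by (rule den) (auto intro!: sets_PiM_I_finite)
    also have "\<dots> \<le> 1"
      by (subst emeasure_shape_law) (auto intro!: sets_PiM_I_finite sets.Int smg.emeasure_le_1)
    finally show "emeasure ?M (PiE {2..k} (\<lambda>_. {..real i})) \<noteq> \<infinity>" by (auto simp: top_unique)
  qed
  then have "emeasure ?M S = emeasure ?N S" by simp
  then show ?thesis using S by (simp add: den Int_absorb1)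
qed

definition boxes :: "nat \<Rightarrow> (nat \<Rightarrow> real) set set" where
  "boxes k = {attach_box k lo hi | lo hi. lo \<in> PiE {2..k} (\<lambda>_. \<rat> \<union> t ` {1..k})
     \<and> hi \<in> PiE {2..k} (\<lambda>_. \<rat> \<union> t ` {1..k}) \<and> separated t k lo hi}"

lemma countable_boxes: "countable (boxes k)"
proof -
  let ?P = "PiE {2..k} (\<lambda>_. \<rat> \<union> t ` {1..k} :: real set)"
  have "countable ?P" by (intro countable_PiE) (auto simp: countable_rat)
  then have "countable ((\<lambda>(lo, hi). attach_box k lo hi) ` (?P \<times> ?P))" by (intro countable_image countable_SIGMA)
  then show ?thesis by (rule countable_subset[rotated]) (auto simp: boxes_def)
qed

lemma boxes_sets: "boxes k \<subseteq> sets (attach_space k)"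
  unfolding boxes_def by auto

lemma boxes_cover:
  assumes sh: "shape_ok t k f a" and ext: "a \<in> extensional {2..k}"
    and z: "\<And>j. j \<in> {2..k} \<Longrightarrow> a j = 0 \<Longrightarrow> 0 \<in> t ` {1..k}"
  shows "a \<in> \<Union>(boxes k)"
proof -
  define A where "A = insert 0 (t ` {1..k}) \<union> a ` {2..k}"
  obtain e where e: "0 < e" "\<And>u v. u \<in> A \<Longrightarrow> v \<in> A \<Longrightarrow> u \<noteq> v \<Longrightarrow> e \<le> \<bar>u - v\<bar>"
  proof -
    have "finite A" by (simp add: A_def)
    from finite_separation[OF this] show ?thesis using that by metis
  qed
  have "\<exists>r\<in>\<rat>. a j - e / 3 < r \<and> r < a j" "\<exists>r\<in>\<rat>. a j < r \<and> r < a j + e / 3" for j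
    using Rats_dense_in_real[of "a j - e / 3" "a j"] Rats_dense_in_real[of "a j" "a j + e / 3"] e(1) by auto
  then obtain l h where lh: "\<And>j. l j \<in> \<rat> \<and> a j - e / 3 < l j \<and> l j < a j" "\<And>j. h j \<in> \<rat> \<and> a j < h j \<and> h j < a j + e / 3"
    by metis
  define lo where "lo = (\<lambda>j\<in>{2..k}. if a j \<in> t ` {1..k} then a j else l j)"
  define hi where "hi = (\<lambda>j\<in>{2..k}. if a j \<in> t ` {1..k} then a j else h j)"
  have pt: "lo j = a j \<and> hi j = a j" if "j \<in> {2..k}" "a j \<in> t ` {1..k}" for j
    using that by (simp add: lo_def hi_def)
  have br: "lo j < a j \<and> a j < hi j" if "j \<in> {2..k}" "a j \<notin> t ` {1..k}" for j
    using that lh(1)[of j] lh(2)[of j] by (simp add: lo_def hi_def)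
  have near: "\<bar>x - a j\<bar> < e / 3" if "j \<in> {2..k}" "lo j \<le> x" "x \<le> hi j" for j x
  proof (cases "a j \<in> t ` {1..k}")
    case True
    then have "x = a j" using pt[OF that(1) True] that(2,3) by linarith
    then show ?thesis using e(1) by simp
  next
    case False
    then have "lo j = l j" "hi j = h j" using that(1) unfolding lo_def hi_def by simp_all
    then have "a j - e / 3 < x" "x < a j + e / 3" using that(2,3) lh(1)[of j] lh(2)[of j] by linarith+
    then show ?thesis unfolding abs_less_iff by linarith
  qed
  have inA: "a j \<in> A" if "j \<in> {2..k}" for j using that by (auto simp: A_def)
  have "separated t k lo hi"
    unfolding separated_def
  proof (intro conjI ballI impI allI)
    fix j assume j: "j \<in> {2..k}"
    show "lo j \<le> hi j" using pt[OF j] br[OF j] by linarith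
    show "lo j \<in> t ` {1..k}" if "lo j = hi j"
    proof -
      have "a j \<in> t ` {1..k}" using that br[OF j] by linarith
      with pt[OF j this] show ?thesis by simp
    qed
    fix x assume lt: "lo j < hi j" and x: "lo j \<le> x \<and> x \<le> hi j"
    have np: "a j \<notin> t ` {1..k}" using lt pt[OF j] by linarith
    show "x \<notin> insert 0 (t ` {1..k})"
    proof
      assume xT: "x \<in> insert 0 (t ` {1..k})"
      then have "x \<in> A" by (auto simp: A_def)
      have "x = a j"
      proof (rule ccontr)
        assume "x \<noteq> a j"
        then have "e \<le> \<bar>x - a j\<bar>" by (rule e(2)[OF \<open>x \<in> A\<close> inA[OF j]])
        then show False using near[OF j, of x] x e(1) by linarith
      qed
      then have "a j = 0" using xT np by blast
      then show False using z[OF j] np by metis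
    qed
  next
    fix j j' x assume j: "j \<in> {2..k}" "j' \<in> {2..k}" "j \<noteq> j'"
    show "\<not> (lo j \<le> x \<and> x \<le> hi j \<and> lo j' \<le> x \<and> x \<le> hi j')"
    proof
      assume x: "lo j \<le> x \<and> x \<le> hi j \<and> lo j' \<le> x \<and> x \<le> hi j'"
      have "a j \<noteq> a j'" using shape_inj[OF sh j(1,2)] j(3) by blast
      then have "e \<le> \<bar>a j - a j'\<bar>" by (rule e(2)[OF inA[OF j(1)] inA[OF j(2)]])
      then show False using near[OF j(1), of x] near[OF j(2), of x] x e(1) by linarith
    qed
  qed
  moreover have "lo \<in> PiE {2..k} (\<lambda>_. \<rat> \<union> t ` {1..k})" "hi \<in> PiE {2..k} (\<lambda>_. \<rat> \<union> t ` {1..k})"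
    unfolding lo_def hi_def using conjunct1[OF lh(1)] conjunct1[OF lh(2)] by (simp_all add: PiE_iff)
  moreover have "a \<in> attach_box k lo hi"
    unfolding attach_box_def PiE_def
  proof (intro IntI Pi_I ext)
    fix j assume j: "j \<in> {2..k}"
    show "a j \<in> cell_set lo hi j"
    proof (cases "a j \<in> t ` {1..k}")
      case True
      then show ?thesis using pt[OF j True] by (simp add: cell_set_def)
    next
      case False
      then show ?thesis using br[OF j False] by (simp add: cell_set_def)
    qed
  qed
  ultimately show ?thesis unfolding boxes_def by blast
qed

lemma product_ref: "product_sigma_finite (\<lambda>_::nat. ref_meas t)"
  by (rule product_sigma_finite.intro) (rule sigma_finite_ref_meas)

lemma AE_coord_neq:
  assumes y: "\<And>l. 1 \<le> l \<Longrightarrow> t l \<noteq> y" and j: "j \<in> {2..k}"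
  shows "AE a in attach_ref t k. a j \<noteq> y"
proof -
  interpret R: product_sigma_finite "\<lambda>_::nat. ref_meas t" by (rule product_ref)
  let ?F = "\<lambda>i. if i = j then {y} else UNIV"
  have "emeasure (attach_ref t k) (PiE {2..k} ?F) = (\<Prod>i\<in>{2..k}. emeasure (ref_meas t) (?F i))"
    unfolding attach_ref_def by (rule R.emeasure_PiM) auto
  also have "\<dots> = 0"
    by (rule prod_zero) (use j emeasure_ref_singleton[OF y] in \<open>auto intro!: bexI[of _ j]\<close>)
  finally have "PiE {2..k} ?F \<in> null_sets (attach_ref t k)"
    unfolding attach_ref_def by (intro null_setsI sets_PiM_I_finite) auto
  then show ?thesis
    by (rule AE_I') (use j in \<open>auto simp: space_attach_ref PiE_def\<close>)
qed

lemma AE_no_ties: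
  "AE a in attach_ref t k. \<forall>j\<in>{2..k}. \<forall>j'\<in>{2..k}. j \<noteq> j' \<longrightarrow> a j = a j' \<longrightarrow> is_sample_time t (a j)"
proof -
  interpret R: product_sigma_finite "\<lambda>_::nat. ref_meas t" by (rule product_ref)
  have "AE a in attach_ref t k. a j = a j' \<longrightarrow> is_sample_time t (a j)" if j: "j \<in> {2..k}" "j' \<in> {2..k}" "j \<noteq> j'" for j j'
  proof -
    let ?N = "{a\<in>space (attach_space k). a j = a j' \<and> \<not> is_sample_time t (a j)}"
    let ?I = "{2..k} - {j}"
    have I: "insert j ?I = {2..k}" using j by auto
    have "?N \<in> sets (attach_space k)"
    proof -
      have [measurable]: "Measurable.pred (attach_space k) (\<lambda>a. a j = a j')"
        by (intro pred_compare coordinate_measurable)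
      show ?thesis by measurable
    qed
    then have N: "?N \<in> sets (attach_ref t k)" by (simp only: sets_attach_ref)
    then have Nm: "(indicator ?N :: _ \<Rightarrow> ennreal) \<in> borel_measurable (PiM (insert j ?I) (\<lambda>_. ref_meas t))"
      unfolding I attach_ref_def by simp
    have "emeasure (attach_ref t k) ?N = (\<integral>\<^sup>+a. indicator ?N a \<partial>PiM (insert j ?I) (\<lambda>_. ref_meas t))"
      using N unfolding I attach_ref_def by simp
    also have "\<dots> = (\<integral>\<^sup>+x. \<integral>\<^sup>+y. indicator ?N (x(j := y)) \<partial>ref_meas t \<partial>PiM ?I (\<lambda>_. ref_meas t))"
      by (rule R.product_nn_integral_insert[OF _ _ Nm]) auto
    also have "\<dots> = (\<integral>\<^sup>+x. 0 \<partial>PiM ?I (\<lambda>_. ref_meas t))"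
    proof (rule nn_integral_cong)
      fix x
      have le: "indicator ?N (x(j := y)) \<le> (indicator {y. y = x j' \<and> \<not> is_sample_time t (x j')} y :: ennreal)" for y
        using j by (auto split: split_indicator)
      have "(\<integral>\<^sup>+y. indicator ?N (x(j := y)) \<partial>ref_meas t) \<le> (\<integral>\<^sup>+y. indicator {y. y = x j' \<and> \<not> is_sample_time t (x j')} y \<partial>ref_meas t)"
        by (intro nn_integral_mono le)
      also have "\<dots> = 0"
      proof (cases "is_sample_time t (x j')")
        case False
        then have "emeasure (ref_meas t) {x j'} = 0" by (intro emeasure_ref_singleton) (auto simp: is_sample_time_def)
        moreover have "{y. y = x j' \<and> \<not> is_sample_time t (x j')} = {x j'}" using False by auto
        ultimately show ?thesis by simp
      qed simp
      finally show "(\<integral>\<^sup>+y. indicator ?N (x(j := y)) \<partial>ref_meas t) = 0" by simp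
    qed
    finally have "?N \<in> null_sets (attach_ref t k)" using N by (intro null_setsI) simp_all
    then show ?thesis by (rule AE_I') (auto simp: space_attach_ref space_attach_space)
  qed
  then show ?thesis by (simp add: AE_finite_all AE_ball_countable)
qed

theorem shape_law_eq_density:
  assumes k: "2 \<le> k" and S[measurable]: "S \<in> sets (attach_space k)"
  shows "emeasure (shape_law k f) S = emeasure (shape_density k f) S"
proof -
  let ?U = "\<Union>(boxes k)"
  have U[measurable]: "?U \<in> sets (attach_space k)"
    using sets.countable_Union[OF countable_boxes boxes_sets] .
  have "emeasure (shape_law k f) (S \<inter> ?U) = emeasure (shape_density k f) (S \<inter> ?U)"
  proof (rule emeasure_eq_countable_cover[OF _ countable_boxes])
    fix b T assume "b \<in> boxes k" "T \<in> sets (shape_law k f)" "T \<subseteq> b"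
    then show "emeasure (shape_law k f) T = emeasure (shape_density k f) T"
      using shape_law_sub_box[OF k] by (auto simp: boxes_def)
  qed (use boxes_sets in auto)
  moreover have "emeasure (shape_law k f) (S - ?U) = 0"
  proof -
    have "AE \<omega> in smg_space n \<mu>. \<not> (gen_cond k f \<omega> \<and> avec k \<omega> \<in> S - ?U)"
      using AE_nice
    proof eventually_elim
      case (elim \<omega>)
      have "avec k \<omega> \<in> ?U" if "gen_cond k f \<omega>"
      proof (rule boxes_cover[OF _ avec_ext])
        show "shape_ok t k f (avec k \<omega>)" using that by (simp add: gen_cond_def)
        fix j assume j: "j \<in> {2..k}" "avec k \<omega> j = 0"
        then show "0 \<in> t ` {1..k}" using attach_eq_0[OF elim j(1)] by (simp add: avec_def attach_vec_def)
      qed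
      then show ?case by blast
    qed
    then have "emeasure (smg_space n \<mu>) {\<omega>\<in>space (smg_space n \<mu>). gen_cond k f \<omega> \<and> avec k \<omega> \<in> S - ?U} = 0"
      by (rule emeasure_eq_0_AE)
    then show ?thesis by (subst emeasure_shape_law) auto
  qed
  moreover have "emeasure (shape_density k f) (S - ?U) = 0"
  proof -
    have "AE a in attach_ref t k. \<forall>j\<in>{2..k}. a j = 0 \<longrightarrow> is_sample_time t 0"
    proof (cases "is_sample_time t 0")
      case False
      have "AE a in attach_ref t k. \<forall>j\<in>{2..k}. a j \<noteq> 0"
      proof (subst AE_ball_countable)
        show "\<forall>j\<in>{2..k}. AE a in attach_ref t k. a j \<noteq> 0"
          using False by (intro ballI AE_coord_neq) (auto simp: is_sample_time_def)
      qed simp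
      then show ?thesis by eventually_elim blast
    qed simp
    then have "AE a in attach_ref t k. ennreal (smg_density n \<mu> t k a) * indicator {a. shape_ok t k f a} a * indicator (S - ?U) a = 0"
      using AE_space
    proof eventually_elim
      case (elim a)
      have "a \<in> ?U" if sh: "shape_ok t k f a"
      proof (rule boxes_cover[OF sh])
        show "a \<in> extensional {2..k}" using elim(2) by (simp add: space_attach_ref)
        fix j assume j: "j \<in> {2..k}" "a j = 0"
        then obtain l where l: "1 \<le> l" "t l = 0" using elim(1) by (auto simp: is_sample_time_def)
        obtain i where i: "i \<in> {1..<j}" "a j \<le> t i" using shape_less_t[OF sh j(1)] by blast
        then have "t l \<le> t i" using l j by simp
        then have "l \<le> i" unfolding t_le .
        then show "0 \<in> t ` {1..k}" using l i j by (intro image_eqI[of _ _ l]) auto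
      qed
      then show ?case by (auto split: split_indicator)
    qed
    then have "(\<integral>\<^sup>+a. ennreal (smg_density n \<mu> t k a) * indicator {a. shape_ok t k f a} a * indicator (S - ?U) a \<partial>attach_ref t k) = (\<integral>\<^sup>+a. 0 \<partial>attach_ref t k)"
      by (rule nn_integral_cong_AE)
    then show ?thesis by (subst emeasure_shape_density) auto
  qed
  moreover have "emeasure L S = emeasure L (S \<inter> ?U) + emeasure L (S - ?U)" if "sets L = sets (attach_space k)" for L
    using that by (subst plus_emeasure) (auto simp: Int_Diff_Un)
  ultimately show ?thesis by simp
qed

lemma gen_ok_if_no_ties:
  assumes v: "valid_gen t k g"
    and ties: "\<forall>j\<in>{2..k}. \<forall>j'\<in>{2..k}. j \<noteq> j' \<longrightarrow> attach_vec k g j = attach_vec k g j' \<longrightarrow> is_sample_time t (attach_vec k g j)"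
  shows "gen_ok t k g"
proof -
  have False if j: "j \<in> {2..k}" "j' \<in> {2..k}" "j < j'" "g_attach g j = g_attach g j'" for j j'
  proof -
    have "is_sample_time t (g_attach g j)" using bspec[OF bspec[OF ties j(1)] j(2)] j by (simp add: attach_vec_def)
    then obtain l where l: "1 \<le> l" "t l = g_attach g j" by (auto simp: is_sample_time_def)
    note v4 = v[unfolded valid_gen_def, THEN conjunct2, THEN conjunct2, THEN conjunct2, THEN conjunct1, rule_format]
    have 1: "l < j" "g (l, j) = t l" using v4[OF j(1) l(1)] l by simp_all
    have 2: "g (l, j') = t l" using v4[OF j(2) l(1)] l j(4) by simp
    have "t l < g (j, j')"
      using v[unfolded valid_gen_def, THEN conjunct2, THEN conjunct2, THEN conjunct2, THEN conjunct2, rule_format, of l j j']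
        1 2 l j by simp
    moreover have "g (j, j') \<le> g_attach g j'" using j by (intro g_attach_props(2)) auto
    ultimately show False using l j by simp
  qed
  then have "inj_on (g_attach g) {2..k}"
    by (intro linorder_inj_onI') blast
  then show ?thesis using v by (simp add: gen_ok_def)
qed

lemma card_genealogies:
  assumes ext: "a \<in> extensional {2..k}"
    and ties: "\<forall>j\<in>{2..k}. \<forall>j'\<in>{2..k}. j \<noteq> j' \<longrightarrow> a j = a j' \<longrightarrow> is_sample_time t (a j)"
  shows "card {g. valid_gen t k g \<and> attach_vec k g = a \<and> g \<in> A} = card {f\<in>shapes k. shape_ok t k f a \<and> gen_of k f a \<in> A}"
proof -
  have "{g. valid_gen t k g \<and> attach_vec k g = a \<and> g \<in> A} = (\<lambda>f. gen_of k f a) ` {f\<in>shapes k. shape_ok t k f a \<and> gen_of k f a \<in> A}"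
  proof
    show "{g. valid_gen t k g \<and> attach_vec k g = a \<and> g \<in> A} \<subseteq> (\<lambda>f. gen_of k f a) ` {f\<in>shapes k. shape_ok t k f a \<and> gen_of k f a \<in> A}"
    proof
      fix g assume "g \<in> {g. valid_gen t k g \<and> attach_vec k g = a \<and> g \<in> A}"
      then have g: "valid_gen t k g" "attach_vec k g = a" "g \<in> A" by auto
      have "gen_ok t k g" using gen_ok_if_no_ties[OF g(1)] ties g(2) by simp
      from gen_ok_shape[OF this] obtain f where "f \<in> shapes k" "shape_ok t k f a" "gen_of k f a = g"
        unfolding g(2) shapes_def by blast
      then show "g \<in> (\<lambda>f. gen_of k f a) ` {f\<in>shapes k. shape_ok t k f a \<and> gen_of k f a \<in> A}" using g(3) by blast
    qed
    show "(\<lambda>f. gen_of k f a) ` {f\<in>shapes k. shape_ok t k f a \<and> gen_of k f a \<in> A} \<subseteq> {g. valid_gen t k g \<and> attach_vec k g = a \<and> g \<in> A}"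
      using gen_ok_gen_of attach_vec_gen_of[OF _ ext] by (auto simp: gen_ok_def)
  qed
  moreover have "inj_on (\<lambda>f. gen_of k f a) {f\<in>shapes k. shape_ok t k f a \<and> gen_of k f a \<in> A}"
  proof (rule inj_onI)
    fix f f' assume "f \<in> {f\<in>shapes k. shape_ok t k f a \<and> gen_of k f a \<in> A}" "f' \<in> {f\<in>shapes k. shape_ok t k f a \<and> gen_of k f a \<in> A}"
      "gen_of k f a = gen_of k f' a"
    then show "f = f'" by (intro gen_of_inj[of f k f' a]) (auto simp: shapes_def)
  qed
  ultimately show ?thesis by (simp add: card_image)
qed

theorem genealogy_law:
  assumes k: "2 \<le> k" and A[measurable]: "A \<in> sets gen_space"
  shows "emeasure (smg_space n \<mu>) {\<omega>. genealogy t k \<omega> \<in> A}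
    = (\<integral>\<^sup>+a. ennreal (smg_density n \<mu> t k a) * of_nat (card {g. valid_gen t k g \<and> attach_vec k g = a \<and> g \<in> A}) \<partial>attach_ref t k)"
proof -
  define S where "S f = {a\<in>space (attach_space k). gen_of k f a \<in> A}" for f
  have S[measurable]: "S f \<in> sets (attach_space k)" for f unfolding S_def by measurable
  have gA[measurable]: "{\<omega>. genealogy t k \<omega> \<in> A} \<in> smg.events"
    using measurable_sets[OF genealogy_measurable A, of k] by (simp add: vimage_def)
  have C: "{\<omega>. gen_cond k f \<omega> \<and> avec k \<omega> \<in> S f} \<in> smg.events" for f
  proof -
    have "{\<omega>\<in>space (smg_space n \<mu>). gen_cond k f \<omega> \<and> avec k \<omega> \<in> S f} \<in> smg.events" by measurable
    then show ?thesis by simp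
  qed
  have "emeasure (smg_space n \<mu>) {\<omega>. genealogy t k \<omega> \<in> A} = (\<integral>\<^sup>+\<omega>. indicator {\<omega>. genealogy t k \<omega> \<in> A} \<omega> \<partial>smg_space n \<mu>)"
    by simp
  also have "\<dots> = (\<integral>\<^sup>+\<omega>. (\<Sum>f\<in>shapes k. indicator {\<omega>. gen_cond k f \<omega> \<and> avec k \<omega> \<in> S f} \<omega>) \<partial>smg_space n \<mu>)"
  proof (rule nn_integral_cong_AE)
    show "AE \<omega> in smg_space n \<mu>. indicator {\<omega>. genealogy t k \<omega> \<in> A} \<omega>
      = (\<Sum>f\<in>shapes k. indicator {\<omega>. gen_cond k f \<omega> \<and> avec k \<omega> \<in> S f} \<omega> :: ennreal)"
      using AE_nice
    proof eventually_elim
      case (elim \<omega>)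
      obtain f0 where f0: "f0 \<in> shapes k" "shape_ok t k f0 (avec k \<omega>)" "gen_of k f0 (avec k \<omega>) = genealogy t k \<omega>"
        using gen_ok_shape[OF gen_ok_genealogy[OF elim, of k]] unfolding shapes_def avec_def by blast
      have iff: "gen_cond k f \<omega> \<and> avec k \<omega> \<in> S f \<longleftrightarrow> f = f0 \<and> genealogy t k \<omega> \<in> A" if f: "f \<in> shapes k" for f
      proof
        assume H: "gen_cond k f \<omega> \<and> avec k \<omega> \<in> S f"
        then have g: "genealogy t k \<omega> = gen_of k f (avec k \<omega>)" by (simp add: gen_cond_def)
        then have "gen_of k f0 (avec k \<omega>) = gen_of k f (avec k \<omega>)" using f0(3) by (rule trans[rotated])
        then have "f0 = f" using f0 f by (intro gen_of_inj[of f0 k f "avec k \<omega>"]) (auto simp: shapes_def)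
        moreover have "genealogy t k \<omega> \<in> A" unfolding g using H by (simp add: S_def)
        ultimately show "f = f0 \<and> genealogy t k \<omega> \<in> A" by simp
      next
        assume "f = f0 \<and> genealogy t k \<omega> \<in> A"
        then show "gen_cond k f \<omega> \<and> avec k \<omega> \<in> S f"
          using f0 avec_ext[of k \<omega>] by (simp add: gen_cond_def S_def space_attach_space)
      qed
      have "(\<Sum>f\<in>shapes k. indicator {\<omega>. gen_cond k f \<omega> \<and> avec k \<omega> \<in> S f} \<omega> :: ennreal)
          = (\<Sum>f\<in>shapes k. if f = f0 then indicator {\<omega>. genealogy t k \<omega> \<in> A} \<omega> else 0)"
        using iff by (intro sum.cong refl) (auto split: split_indicator)
      also have "\<dots> = indicator {\<omega>. genealogy t k \<omega> \<in> A} \<omega>"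
        using f0(1) finite_shapes by simp
      finally show ?case by simp
    qed
  qed
  also have "\<dots> = (\<Sum>f\<in>shapes k. emeasure (smg_space n \<mu>) {\<omega>. gen_cond k f \<omega> \<and> avec k \<omega> \<in> S f})"
    using C by (subst nn_integral_sum) auto
  also have "\<dots> = (\<Sum>f\<in>shapes k. emeasure (shape_density k f) (S f))"
    using shape_law_eq_density[OF k S] by (simp add: emeasure_shape_law[OF S])
  also have "\<dots> = (\<Sum>f\<in>shapes k. \<integral>\<^sup>+a. ennreal (smg_density n \<mu> t k a) * indicator {a\<in>space (attach_space k). shape_ok t k f a \<and> gen_of k f a \<in> A} a \<partial>attach_ref t k)"
    unfolding emeasure_shape_density[OF S]
    by (intro sum.cong refl nn_integral_cong) (auto simp: S_def split: split_indicator)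
  also have "\<dots> = (\<integral>\<^sup>+a. (\<Sum>f\<in>shapes k. ennreal (smg_density n \<mu> t k a) * indicator {a\<in>space (attach_space k). shape_ok t k f a \<and> gen_of k f a \<in> A} a) \<partial>attach_ref t k)"
  proof (rule nn_integral_sum[symmetric])
    fix f
    have [measurable]: "{a\<in>space (attach_space k). shape_ok t k f a \<and> gen_of k f a \<in> A} \<in> sets (attach_space k)" by measurable
    show "(\<lambda>a. ennreal (smg_density n \<mu> t k a) * indicator {a\<in>space (attach_space k). shape_ok t k f a \<and> gen_of k f a \<in> A} a)
        \<in> borel_measurable (attach_ref t k)" by measurable
  qed
  also have "\<dots> = (\<integral>\<^sup>+a. ennreal (smg_density n \<mu> t k a) * of_nat (card {g. valid_gen t k g \<and> attach_vec k g = a \<and> g \<in> A}) \<partial>attach_ref t k)"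
  proof (rule nn_integral_cong_AE)
    show "AE a in attach_ref t k. (\<Sum>f\<in>shapes k. ennreal (smg_density n \<mu> t k a) * indicator {a\<in>space (attach_space k). shape_ok t k f a \<and> gen_of k f a \<in> A} a)
      = ennreal (smg_density n \<mu> t k a) * of_nat (card {g. valid_gen t k g \<and> attach_vec k g = a \<and> g \<in> A})"
      using AE_no_ties AE_space
    proof eventually_elim
      case (elim a)
      have ext: "a \<in> extensional {2..k}" using elim(2) by (simp add: space_attach_ref)
      have "(\<Sum>f\<in>shapes k. indicator {a\<in>space (attach_space k). shape_ok t k f a \<and> gen_of k f a \<in> A} a :: ennreal)
          = (\<Sum>f\<in>shapes k. if shape_ok t k f a \<and> gen_of k f a \<in> A then 1 else 0)"
        using ext by (intro sum.cong) (auto simp: space_attach_space split: split_indicator)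
      also have "\<dots> = of_nat (card {f\<in>shapes k. shape_ok t k f a \<and> gen_of k f a \<in> A})"
        using finite_shapes by (simp add: sum.If_cases Int_def)
      finally show ?case
        by (simp add: sum_distrib_left[symmetric] card_genealogies[OF ext elim(1)])
    qed
  qed
  finally show ?thesis .
qed

end

lemma genealogy_trunc: "j \<le> k \<Longrightarrow> genealogy t j \<omega> = trunc j (genealogy t k \<omega>)"
  by (auto simp: genealogy_def trunc_def fun_eq_iff)

lemma trunc_chain_measurable:
  "(\<lambda>g. \<lambda>j\<in>{1..k}. trunc j g) \<in> measurable gen_space (\<Pi>\<^sub>M j\<in>{1..k}. gen_space)"
proof (rule measurable_restrict)
  fix j
  show "trunc j \<in> measurable gen_space gen_space"
    unfolding gen_space_def
  proof (rule measurable_PiM_single')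
    show "(\<lambda>g. trunc j g p) \<in> borel_measurable (PiM UNIV (\<lambda>_. borel))" for p
      by (cases p) (auto simp: trunc_def)
  qed auto
qed

theorem theorem4:
  fixes n k :: nat and \<mu> :: real and t :: "nat \<Rightarrow> real"
  assumes "n \<ge> 2" and "\<mu> > 0" and "strict_mono t" and "k \<ge> 2"
  shows "genealogy t k \<in> measurable (smg_space n \<mu>) gen_space
    \<and> (\<lambda>\<omega>. \<lambda>j\<in>{1..k}. genealogy t j \<omega>)
        \<in> measurable (smg_space n \<mu>) (\<Pi>\<^sub>M j\<in>{1..k}. gen_space)
    \<and> (\<forall>B \<in> sets (\<Pi>\<^sub>M j\<in>{1..k}. gen_space).
         emeasure (smg_space n \<mu>)
           {\<omega> \<in> space (smg_space n \<mu>). (\<lambda>j\<in>{1..k}. genealogy t j \<omega>) \<in> B}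
         = (\<integral>\<^sup>+ a. ennreal (smg_density n \<mu> t k a)
              * of_nat (card {g. valid_gen t k g \<and> attach_vec k g = a
                               \<and> (\<lambda>j\<in>{1..k}. trunc j g) \<in> B}) \<partial>attach_ref t k))
    \<and> (\<forall>A \<in> sets gen_space.
         emeasure (smg_space n \<mu>) {\<omega> \<in> space (smg_space n \<mu>). genealogy t k \<omega> \<in> A}
         = (\<integral>\<^sup>+ a. ennreal (smg_density n \<mu> t k a)
              * of_nat (card {g. valid_gen t k g \<and> attach_vec k g = a \<and> g \<in> A}) \<partial>attach_ref t k))"
proof (intro conjI ballI)
  interpret moran_samples n \<mu> t using assms by unfold_locales auto
  show "genealogy t k \<in> measurable (smg_space n \<mu>) gen_space" by (rule genealogy_measurable)
  have chain: "(\<lambda>j\<in>{1..k}. genealogy t j \<omega>) = (\<lambda>j\<in>{1..k}. trunc j (genealogy t k \<omega>))" for \<omega>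
    using genealogy_trunc by (auto simp: restrict_def fun_eq_iff)
  show "(\<lambda>\<omega>. \<lambda>j\<in>{1..k}. genealogy t j \<omega>) \<in> measurable (smg_space n \<mu>) (\<Pi>\<^sub>M j\<in>{1..k}. gen_space)"
    unfolding chain by (rule measurable_compose[OF genealogy_measurable trunc_chain_measurable])
  show law: "emeasure (smg_space n \<mu>) {\<omega> \<in> space (smg_space n \<mu>). genealogy t k \<omega> \<in> A}
      = (\<integral>\<^sup>+ a. ennreal (smg_density n \<mu> t k a)
           * of_nat (card {g. valid_gen t k g \<and> attach_vec k g = a \<and> g \<in> A}) \<partial>attach_ref t k)"
    if "A \<in> sets gen_space" for A
    using genealogy_law[OF assms(4) that] by simp
  fix B assume B: "B \<in> sets (\<Pi>\<^sub>M j\<in>{1..k}. gen_space)"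
  let ?A = "{g. (\<lambda>j\<in>{1..k}. trunc j g) \<in> B}"
  have "?A \<in> sets gen_space"
    using measurable_sets[OF trunc_chain_measurable B] by (simp add: vimage_def gen_space_def space_PiM)
  from law[OF this] show "emeasure (smg_space n \<mu>) {\<omega> \<in> space (smg_space n \<mu>). (\<lambda>j\<in>{1..k}. genealogy t j \<omega>) \<in> B}
      = (\<integral>\<^sup>+ a. ennreal (smg_density n \<mu> t k a)
           * of_nat (card {g. valid_gen t k g \<and> attach_vec k g = a
                            \<and> (\<lambda>j\<in>{1..k}. trunc j g) \<in> B}) \<partial>attach_ref t k)"
    unfolding chain mem_Collect_eq .
qed

end
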